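(* Let $0<\alpha\le 1$ and let $f:[0,1]\to\mathbb{R}$ be strictly positive and $\alpha$-Lipschitzian. Let $D=\{(x,y)\in\mathbb{R}^2 : 0\le x\le 1,\ 0\le y\le f(x)\}$, and let $Z_i=(X_i,Y_i)$, $i\ge 1$, be independent random points uniformly distributed on $D$. Let $\hat f_n$ be the kernel estimator built from $Z_1,\dots,Z_n$, the integers $k_n$, the bandwidths $h_n$ and the kernel $K$, as defined in the context. If $h_nk_n\to\infty$, $n=o(k_n^{1/2}h_n^{-1/2-\alpha})$, $n=o(k_n^{5/2}h_n^{3/2})$ and $k_n=o(n/\ln n)$ as $n\to\infty$, then for every $x\in\,]0,1[$, $$\frac{n h_n^{1/2}}{k_n^{1/2}}\left(\hat f_n(x)-f(x)\right)\Rightarrow \mathcal N(0,\sigma^2)$$ (convergence in distribution), with $\sigma=\|K\|_2/c$, where $\|K\|_2=\left(\int_{\mathbb{R}}K(t)^2\,dt\right)^{1/2}$ and $c^{-1}=\lambda(D)=\int_0^1 f(t)\,dt$ is the Lebesgue measure of $D$.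
   Context: $\alpha$-Lipschitzian means: there is $L>0$ with $|f(x)-f(y)|\le L|x-y|^\alpha$ for all $x,y\in[0,1]$. $(k_n)$ is a nondecreasing sequence of integers with $0<k_n<n$ and $k_n\to\infty$; $(h_n)$ is a nonincreasing sequence of positive numbers with $h_n\to 0$. $K$ is a bounded probability density on $\mathbb{R}$, with support within a compact interval $[-A,A]$, with a bounded first derivative, and piecewise $C^2$. Put $K_n(t)=\frac{1}{h_n}K(t/h_n)$, $t\in\mathbb{R}$. For $r=1,\dots,k_n$ let $I_{n,r}=[(r-1)/k_n,\,r/k_n[$, let $x_r$ be the center of $I_{n,r}$, and let $$U_{n,r}=\max\{Y_i : 1\le i\le n,\ X_i\in I_{n,r}\},\qquad \max\varnothing=0.$$ The estimator is $$\hat f_n(x)=\frac{1}{k_n}\sum_{r=1}^{k_n}K_n(x-x_r)\left(U_{n,r}+\frac{1}{n-k_n}\sum_{s=1}^{k_n}U_{n,s}\right),\quad x\in\mathbb{R}.$$ *)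

theory Defs
  imports "HOL-Probability.Probability" "HOL-Library.Landau_Symbols"
begin

definition holder_01 :: "real \<Rightarrow> (real \<Rightarrow> real) \<Rightarrow> bool" where
  "holder_01 \<alpha> f \<longleftrightarrow>
     (\<exists>L>0. \<forall>x\<in>{0..1}. \<forall>y\<in>{0..1}. \<bar>f x - f y\<bar> \<le> L * \<bar>x - y\<bar> powr \<alpha>)"

definition region :: "(real \<Rightarrow> real) \<Rightarrow> (real \<times> real) set" where
  "region f = {(x, y). 0 \<le> x \<and> x \<le> 1 \<and> 0 \<le> y \<and> y \<le> f x}"

definition C2_on_Icc :: "(real \<Rightarrow> real) \<Rightarrow> real \<Rightarrow> real \<Rightarrow> bool" where
  "C2_on_Icc g a b \<longleftrightarrow> (\<exists>g' g''.
     (\<forall>t\<in>{a..b}. (g has_real_derivative g' t) (at t within {a..b})) \<and>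
     (\<forall>t\<in>{a..b}. (g' has_real_derivative g'' t) (at t within {a..b})) \<and>
     continuous_on {a..b} g'')"

(* Usual convention for "piecewise": away from finitely many break points, the function agrees on
   each bounded open piece with a function that is C^2 up to the end points of the piece (so the
   one-sided limits of the derivatives at the break points exist and are finite). *)
definition piecewise_C2 :: "(real \<Rightarrow> real) \<Rightarrow> bool" where
  "piecewise_C2 K \<longleftrightarrow> (\<exists>S. finite S \<and>
     (\<forall>a b. a < b \<longrightarrow> {a<..<b} \<inter> S = {} \<longrightarrow>
        (\<exists>g. C2_on_Icc g a b \<and> (\<forall>t\<in>{a<..<b}. K t = g t))))"

definition L2_norm :: "(real \<Rightarrow> real) \<Rightarrow> real" where
  "L2_norm K = sqrt (\<integral>t. (K t)\<^sup>2 \<partial>lborel)"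

definition scaled_kernel :: "(real \<Rightarrow> real) \<Rightarrow> real \<Rightarrow> real \<Rightarrow> real" where
  "scaled_kernel K h t = K (t / h) / h"

definition cell :: "nat \<Rightarrow> nat \<Rightarrow> real set" where
  "cell k r = {(real r - 1) / real k ..< real r / real k}"

definition cell_center :: "nat \<Rightarrow> nat \<Rightarrow> real" where
  "cell_center k r = ((real r - 1) / real k + real r / real k) / 2"

definition cell_max :: "(nat \<Rightarrow> real \<times> real) \<Rightarrow> nat \<Rightarrow> nat \<Rightarrow> nat \<Rightarrow> real" where
  "cell_max z n k r =
     (let Ys = {snd (z i) | i. i \<in> {1..n} \<and> fst (z i) \<in> cell k r}
      in if Ys = {} then 0 else Max Ys)"

definition kernel_estimator ::
  "(real \<Rightarrow> real) \<Rightarrow> (nat \<Rightarrow> nat) \<Rightarrow> (nat \<Rightarrow> real) \<Rightarrow> nat \<Rightarrow> (nat \<Rightarrow> real \<times> real) \<Rightarrow> real \<Rightarrow> real" where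
  "kernel_estimator K k h n z x =
     1 / real (k n) * (\<Sum>r = 1..k n. scaled_kernel K (h n) (x - cell_center (k n) r) *
       (cell_max z n (k n) r + 1 / (real n - real (k n)) * (\<Sum>s = 1..k n. cell_max z n (k n) s)))"

lemma holder_01_imp_continuous_on:
  assumes "holder_01 \<alpha> f" and "0 < \<alpha>"
  shows "continuous_on {0..1} f"
  unfolding continuous_on_def
proof
  fix x :: real assume x: "x \<in> {0..1}"
  from assms(1) obtain L where L: "L > 0"
    "\<And>x y. x \<in> {0..1} \<Longrightarrow> y \<in> {0..1} \<Longrightarrow> \<bar>f x - f y\<bar> \<le> L * \<bar>x - y\<bar> powr \<alpha>"
    unfolding holder_01_def by blast
  have "((\<lambda>y. L * \<bar>y - x\<bar> powr \<alpha>) \<longlongrightarrow> L * \<bar>x - x\<bar> powr \<alpha>) (at x within {0..1})"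
    using \<open>0 < \<alpha>\<close> by (intro tendsto_intros tendsto_powr') auto
  hence lim: "((\<lambda>y. L * \<bar>y - x\<bar> powr \<alpha>) \<longlongrightarrow> 0) (at x within {0..1})"
    using \<open>0 < \<alpha>\<close> by simp
  have "\<forall>\<^sub>F y in at x within {0..1}. norm (f y - f x) \<le> L * \<bar>y - x\<bar> powr \<alpha>"
    using L(2) x by (auto simp: eventually_at_filter)
  from Lim_null_comparison[OF this lim] show "(f \<longlongrightarrow> f x) (at x within {0..1})"
    using LIM_zero_iff by blast
qed

lemma region_closed:
  assumes "continuous_on {0..1} f"
  shows "closed (region f)"
proof -
  have "region f = {z \<in> {0..1} \<times> {0..}. snd z \<le> f (fst z)}"
    by (auto simp: region_def)
  also have "closed \<dots>"
    by (intro continuous_on_closed_Collect_le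
        closed_Times continuous_intros continuous_on_compose2[OF assms]) auto
  finally show ?thesis .
qed

lemma measure_region:
  assumes cont: "continuous_on {0..1} f" and nonneg: "\<And>x. x \<in> {0..1} \<Longrightarrow> 0 \<le> f x"
  shows "measure lborel (region f) = (LBINT x:{0..1}. f x)"
proof -
  have si: "set_integrable lborel {0..1} f"
    by (rule borel_integrable_atLeastAtMost') (rule cont)
  have [measurable]: "region f \<in> sets (lborel \<Otimes>\<^sub>M lborel)"
    using region_closed[OF cont] by (metis borel_closed lborel_prod sets_lborel)
  have "emeasure lborel (region f) = emeasure (lborel \<Otimes>\<^sub>M lborel) (region f)"
    by (simp add: lborel_prod)
  also have "\<dots> = (\<integral>\<^sup>+x. emeasure lborel (Pair x -` region f) \<partial>lborel)"
    by (rule lborel.emeasure_pair_measure_alt) measurable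
  also have "\<dots> = (\<integral>\<^sup>+x. ennreal (indicator {0..1} x * f x) \<partial>lborel)"
  proof (rule nn_integral_cong)
    fix x :: real
    have "Pair x -` region f = (if x \<in> {0..1} then {0..f x} else {})"
      by (auto simp: region_def)
    thus "emeasure lborel (Pair x -` region f) = ennreal (indicator {0..1} x * f x)"
      using nonneg[of x] by auto
  qed
  also have "\<dots> = ennreal (LBINT x:{0..1}. f x)"
    unfolding set_lebesgue_integral_def real_scaleR_def
    by (rule nn_integral_eq_integral)
      (use si nonneg in \<open>auto simp: set_integrable_def indicator_def\<close>)
  finally show ?thesis
    using nonneg by (auto simp: measure_def set_lebesgue_integral_def indicator_def
        intro!: integral_nonneg_AE)
qed

end

(* For a cell r let V_r be the normalised area of the part of D that lies in the cell above U_{n,r}.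
   Since f is Hoelder continuous, U_{n,r} differs from f(x_r) - (k_n/c) V_r by at most L k_n^{-alpha},
   so the estimator is, up to a deterministic error that is negligible after scaling, a constant plus
   a weighted sum of the variables 1 - n V_r.

   {V_r >= v_r for all r} is the event that n points avoid a set of probability sum_r v_r, so it has
   probability (1 - sum_r v_r)^n. When n is replaced by an independent Poisson variable N of mean n,
   this becomes exp(- n sum_r v_r): the variables n V_r become independent and exponentially
   distributed, truncated at n p_r with p_r the probability of the cell. As V_r decreases in the
   number of points and its mean is nearly 1/(n+1), the replacement changes the characteristic
   function of sum_r rho_r (1 - n V_r) by O(sum_r |rho_r| / sqrt n), and a Lyapunov estimate together
   with Levy's continuity theorem concludes. The variance is the limit of sum_r rho_r^2, a Riemann sum
   for ||K||_2^2 / c^2. *)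
theory Submission
  imports Defs
begin

text \<open>The second summand of the estimator corrects a bias. A cell maximum falls short of
  \<open>f\<close> by about \<open>k/(c n)\<close> on average, so the maxima add up to about
  \<open>(k/c)(1 - k/n)\<close>, and division by \<open>n - k\<close> returns
  \<open>k/(c n)\<close>. After linearization the cancellation is exact, hence the centring at
  \<open>f x\<close>. Areas are used instead of heights because their joint tail is the same for
  every \<open>f\<close>; the shape of \<open>f\<close> survives only in the truncation levels. For
  fixed n the tail \<open>(1 - sum v)^n\<close> does not factorize. Since void areas for all numbers
  of points live on one space, a random number of points is coupled to the fixed one, and a
  first-moment bound suffices. Each growth condition removes one error: the one with \<alpha> the
  oscillation of \<open>f\<close> on the kernel window and, as eventually 1/k <= h, on a cell; the
  one with \<open>k^(5/2) h^(3/2)\<close> the error of the sum of the weights, which must be of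
  second order in 1/(h k) and so relies on a Lipschitz derivative of \<open>K\<close>; and k =
  o(n/ln n) the total truncation error \<open>k exp(- c m n / k)\<close>, m being the minimum of
  \<open>f\<close>.\<close>

section \<open>Poisson moments\<close>

text \<open>The weights satisfy (m + 1) P(N = m + 1) = r P(N = m). Read forwards this size-bias
  identity gives the moments; read backwards it clears the denominator in 1/(N + 1).\<close>

lemma nn_integral_poisson_shift:
  fixes g :: "nat \<Rightarrow> ennreal"
  assumes r: "0 < r"
  shows "(\<integral>\<^sup>+m. of_nat m * g m \<partial>measure_pmf (poisson_pmf r)) =
         ennreal r * (\<integral>\<^sup>+m. g (Suc m) \<partial>measure_pmf (poisson_pmf r))"
proof -
  have pos: "0 \<le> r" using r by simp
  have "(\<integral>\<^sup>+m. of_nat m * g m \<partial>measure_pmf (poisson_pmf r)) =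
      (\<Sum>m. ennreal (pmf (poisson_pmf r) m) * (of_nat m * g m))"
    by (simp add: nn_integral_measure_pmf nn_integral_count_space_nat)
  also have "\<dots> = (\<Sum>m. ennreal (pmf (poisson_pmf r) (Suc m)) * (of_nat (Suc m) * g (Suc m)))"
    by (subst suminf_offset[where i = 1]) auto
  also have "\<dots> = (\<Sum>m. ennreal r * (ennreal (pmf (poisson_pmf r) m) * g (Suc m)))"
  proof (rule suminf_cong)
    fix m
    have "pmf (poisson_pmf r) (Suc m) * real (Suc m) = r * pmf (poisson_pmf r) m"
      using r by (simp add: field_simps del: of_nat_Suc)
    then have "ennreal (pmf (poisson_pmf r) (Suc m)) * of_nat (Suc m) =
        ennreal r * ennreal (pmf (poisson_pmf r) m)"
      using pos by (simp add: ennreal_mult'[symmetric] ennreal_of_nat_eq_real_of_nat del: of_nat_Suc pmf_poisson)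
    then show "ennreal (pmf (poisson_pmf r) (Suc m)) * (of_nat (Suc m) * g (Suc m)) =
        ennreal r * (ennreal (pmf (poisson_pmf r) m) * g (Suc m))"
      by (metis mult.assoc)
  qed
  also have "\<dots> = ennreal r * (\<integral>\<^sup>+m. g (Suc m) \<partial>measure_pmf (poisson_pmf r))"
    by (simp add: nn_integral_measure_pmf nn_integral_count_space_nat)
  finally show ?thesis .
qed

text \<open>The probability generating function: it turns the fixed-size tail
  \<open>(1 - v) ^ m\<close> into \<open>exp (- r * v)\<close>.\<close>

lemma nn_integral_poisson_power:
  assumes r: "0 < r" and z: "0 \<le> z"
  shows "(\<integral>\<^sup>+m. ennreal (z ^ m) \<partial>measure_pmf (poisson_pmf r)) = ennreal (exp (r * (z - 1)))"
proof -
  have "(\<integral>\<^sup>+m. ennreal (z ^ m) \<partial>measure_pmf (poisson_pmf r)) =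
      (\<Sum>m. ennreal ((r * z) ^ m / fact m * exp (- r)))"
    using r z by (auto simp: nn_integral_measure_pmf nn_integral_count_space_nat ennreal_mult'[symmetric]
        power_mult_distrib field_simps intro!: suminf_cong)
  also have "\<dots> = ennreal (exp (r * z) * exp (- r))"
  proof (rule suminf_ennreal_eq)
    show "0 \<le> (r * z) ^ m / fact m * exp (- r)" for m using r z by simp
    show "(\<lambda>m. (r * z) ^ m / fact m * exp (- r)) sums (exp (r * z) * exp (- r))"
      using exp_converges[of "r * z"] by (intro sums_mult2) (simp add: field_simps)
  qed
  finally show ?thesis by (simp add: mult_exp_exp algebra_simps)
qed

lemma poisson_moments:
  assumes r: "0 < r"
  shows integrable_poisson: "integrable (measure_pmf (poisson_pmf r)) (\<lambda>m. real m)"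
    and integrable_poisson_sq: "integrable (measure_pmf (poisson_pmf r)) (\<lambda>m. (real m)\<^sup>2)"
    and expectation_poisson: "measure_pmf.expectation (poisson_pmf r) (\<lambda>m. real m) = r"
    and expectation_poisson_sq: "measure_pmf.expectation (poisson_pmf r) (\<lambda>m. (real m)\<^sup>2) = r\<^sup>2 + r"
proof -
  have 1: "(\<integral>\<^sup>+m. ennreal (real m) \<partial>measure_pmf (poisson_pmf r)) = ennreal r"
    using nn_integral_poisson_shift[OF r, of "\<lambda>_. 1"] by (simp add: ennreal_of_nat_eq_real_of_nat)
  have "(\<integral>\<^sup>+m. ennreal ((real m)\<^sup>2) \<partial>measure_pmf (poisson_pmf r)) =
      (\<integral>\<^sup>+m. of_nat m * of_nat m \<partial>measure_pmf (poisson_pmf r))"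
    by (simp add: ennreal_of_nat_eq_real_of_nat power2_eq_square ennreal_mult')
  also have "\<dots> = ennreal r * (\<integral>\<^sup>+m. of_nat m + 1 \<partial>measure_pmf (poisson_pmf r))"
    by (subst nn_integral_poisson_shift[OF r]) (simp add: add.commute)
  also have "(\<integral>\<^sup>+m. of_nat m + 1 \<partial>measure_pmf (poisson_pmf r)) = ennreal r + 1"
    using 1 by (subst nn_integral_add) (simp_all add: ennreal_of_nat_eq_real_of_nat[abs_def])
  also have "ennreal r * (ennreal r + 1) = ennreal (r\<^sup>2 + r)"
  proof -
    have "ennreal r * (ennreal r + 1) = ennreal r * ennreal (r + 1)"
      using r by (subst ennreal_plus) auto
    also have "\<dots> = ennreal (r * (r + 1))" using r by (intro ennreal_mult[symmetric]) auto
    finally show ?thesis by (simp add: power2_eq_square distrib_left)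
  qed
  finally have 2: "(\<integral>\<^sup>+m. ennreal ((real m)\<^sup>2) \<partial>measure_pmf (poisson_pmf r)) = ennreal (r\<^sup>2 + r)" .
  have b1: "has_bochner_integral (measure_pmf (poisson_pmf r)) (\<lambda>m. real m) r"
    using r 1 by (intro has_bochner_integral_nn_integral) auto
  have b2: "has_bochner_integral (measure_pmf (poisson_pmf r)) (\<lambda>m. (real m)\<^sup>2) (r\<^sup>2 + r)"
    using r 2 by (intro has_bochner_integral_nn_integral) auto
  show "integrable (measure_pmf (poisson_pmf r)) (\<lambda>m. real m)"
    "integrable (measure_pmf (poisson_pmf r)) (\<lambda>m. (real m)\<^sup>2)"
    "measure_pmf.expectation (poisson_pmf r) (\<lambda>m. real m) = r"
    "measure_pmf.expectation (poisson_pmf r) (\<lambda>m. (real m)\<^sup>2) = r\<^sup>2 + r"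
    using b1 b2 by (auto simp: has_bochner_integral_iff)
qed

lemma expectation_poisson_abs_dev:
  assumes r: "0 < r"
  shows "integrable (measure_pmf (poisson_pmf r)) (\<lambda>m. \<bar>real m - r\<bar>)"
    and "measure_pmf.expectation (poisson_pmf r) (\<lambda>m. \<bar>real m - r\<bar>) \<le> sqrt r"
proof -
  note [simp] = poisson_moments[OF r]
  show int: "integrable (measure_pmf (poisson_pmf r)) (\<lambda>m. \<bar>real m - r\<bar>)"
    by (intro integrable_abs Bochner_Integration.integrable_diff) auto
  have s0: "0 < sqrt r" using r by simp
  \<comment> \<open>AM-GM in place of Cauchy-Schwarz. The weight \<open>sqrt r\<close> is the
    standard deviation, so both halves contribute \<open>sqrt r / 2\<close> in the mean.\<close>
  have pw: "\<bar>y\<bar> \<le> (y\<^sup>2 / sqrt r + sqrt r) / 2" for y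
  proof -
    have "0 \<le> (\<bar>y\<bar> - sqrt r)\<^sup>2" by simp
    also have "\<dots> = y\<^sup>2 - 2 * \<bar>y\<bar> * sqrt r + sqrt r * sqrt r"
      by (simp add: power2_eq_square algebra_simps)
    finally have "\<bar>y\<bar> * (2 * sqrt r) \<le> y\<^sup>2 + sqrt r * sqrt r" by simp
    then have "\<bar>y\<bar> \<le> (y\<^sup>2 + sqrt r * sqrt r) / (2 * sqrt r)" using s0 by (simp add: pos_le_divide_eq)
    also have "\<dots> = (y\<^sup>2 / sqrt r + sqrt r) / 2" using s0 by (simp add: field_simps)
    finally show ?thesis .
  qed
  have eq: "(\<lambda>m. ((real m - r)\<^sup>2 / sqrt r + sqrt r) / 2) =
      (\<lambda>m. ((real m)\<^sup>2 - 2 * r * real m + r\<^sup>2) / (2 * sqrt r) + sqrt r / 2)"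
    by (rule ext) (simp add: power2_diff add_divide_distrib diff_divide_distrib mult.commute)
  have "measure_pmf.expectation (poisson_pmf r) (\<lambda>m. \<bar>real m - r\<bar>)
      \<le> measure_pmf.expectation (poisson_pmf r) (\<lambda>m. ((real m - r)\<^sup>2 / sqrt r + sqrt r) / 2)"
    by (rule integral_mono[OF int]) (use pw in \<open>auto simp: eq\<close>)
  also have "\<dots> = (r\<^sup>2 + r - 2 * r * r + r\<^sup>2) / (2 * sqrt r) + sqrt r / 2"
    by (simp add: eq)
  also have "\<dots> = r / (2 * sqrt r) + sqrt r / 2" by (simp add: power2_eq_square)
  also have "\<dots> = sqrt r" 
  proof -
    have "r / (2 * sqrt r) = (r / sqrt r) / 2" by simp
    also have "\<dots> = sqrt r / 2" using r by (simp only: real_div_sqrt less_imp_le)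
    finally show ?thesis by linarith
  qed
  finally show "measure_pmf.expectation (poisson_pmf r) (\<lambda>m. \<bar>real m - r\<bar>) \<le> sqrt r" .
qed

text \<open>After multiplication by n the shift identity replaces N + 1 by N and cancels the random
  denominator. What is left is |N - 1 - n| / (n + 1), whose mean is controlled by the mean absolute
  deviation of N. The resulting order n^(-3/2) is what makes Poissonization affordable.\<close>

lemma nn_integral_poisson_inverse_dev:
  fixes n :: nat
  assumes n: "0 < n"
  shows "(\<integral>\<^sup>+m. ennreal \<bar>1 / (real m + 1) - 1 / (real n + 1)\<bar> \<partial>measure_pmf (poisson_pmf (real n)))
    \<le> ennreal ((1 + sqrt n) / (real n * (real n + 1)))" (is "?L \<le> _")
proof -
  have r: "0 < real n" using n by simp
  define g where "g m = ennreal (\<bar>real m - 1 - real n\<bar> / (real m * (real n + 1)))" for m :: nat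
  let ?P = "measure_pmf (poisson_pmf (real n))"
  have "\<bar>1 / (real m + 1) - 1 / (real n + 1)\<bar> = \<bar>real (Suc m) - 1 - real n\<bar> / (real (Suc m) * (real n + 1))" for m
  proof -
    have "1 / (real m + 1) - 1 / (real n + 1) = (real n - real m) / ((real m + 1) * (real n + 1))"
      by (simp add: field_simps)
    then show ?thesis by (simp add: abs_mult abs_minus_commute add.commute)
  qed
  then have L: "?L = (\<integral>\<^sup>+m. g (Suc m) \<partial>?P)" by (simp add: g_def del: of_nat_Suc)
  have "ennreal (real n) * ?L = (\<integral>\<^sup>+m. of_nat m * g m \<partial>?P)"
    unfolding L using nn_integral_poisson_shift[OF r, of g] by simp
  also have "\<dots> \<le> (\<integral>\<^sup>+m. ennreal ((\<bar>real m - real n\<bar> + 1) / (real n + 1)) \<partial>?P)"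
  proof (rule nn_integral_mono)
    fix m :: nat
    have "of_nat m * g m = ennreal (real m * (\<bar>real m - 1 - real n\<bar> / (real m * (real n + 1))))"
      by (simp add: g_def ennreal_of_nat_eq_real_of_nat ennreal_mult'[symmetric])
    also have "\<dots> \<le> ennreal ((\<bar>real m - real n\<bar> + 1) / (real n + 1))"
      by (intro ennreal_leI) (cases "m = 0"; simp add: divide_right_mono)
    finally show "of_nat m * g m \<le> ennreal ((\<bar>real m - real n\<bar> + 1) / (real n + 1))" .
  qed
  also have "\<dots> = ennreal (measure_pmf.expectation (poisson_pmf (real n)) (\<lambda>m. (\<bar>real m - real n\<bar> + 1) / (real n + 1)))"
    using expectation_poisson_abs_dev(1)[OF r] by (intro nn_integral_eq_integral) auto
  also have "\<dots> \<le> ennreal ((1 + sqrt n) / (real n + 1))"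
    using expectation_poisson_abs_dev[OF r] by (intro ennreal_leI) (simp add: divide_right_mono)
  also have "\<dots> = ennreal (real n) * ennreal ((1 + sqrt n) / (real n * (real n + 1)))"
    using n by (simp add: ennreal_mult'[symmetric])
  finally show ?thesis
    using n by (subst (asm) ennreal_mult_le_mult_iff) (auto simp: ennreal_eq_0_iff)
qed

section \<open>Void areas\<close>

text \<open>The map u -> exp(iu) is 1-Lipschitz. This serves both to change the number of points and
  to replace the estimator by its linearization.\<close>

lemma (in prob_space) norm_expectation_iexp_diff_le:
  assumes [measurable]: "random_variable borel X" "random_variable borel Y"
    and Z: "integrable M Z" and le: "AE \<omega> in M. \<bar>X \<omega> - Y \<omega>\<bar> \<le> Z \<omega>"
  shows "cmod (expectation (\<lambda>\<omega>. iexp (X \<omega>)) - expectation (\<lambda>\<omega>. iexp (Y \<omega>))) \<le> expectation Z"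
proof -
  have int: "integrable M (\<lambda>\<omega>. iexp (X \<omega>))" "integrable M (\<lambda>\<omega>. iexp (Y \<omega>))"
    by (auto intro!: integrable_const_bound[where B=1] simp del: of_real_mult)
  have "cmod (expectation (\<lambda>\<omega>. iexp (X \<omega>)) - expectation (\<lambda>\<omega>. iexp (Y \<omega>)))
      = cmod (expectation (\<lambda>\<omega>. iexp (X \<omega>) - iexp (Y \<omega>)))"
    using int by simp
  also have "\<dots> \<le> expectation (\<lambda>\<omega>. cmod (iexp (X \<omega>) - iexp (Y \<omega>)))"
    by (rule integral_norm_bound)
  also have "\<dots> \<le> expectation Z"
  proof (rule integral_mono_AE)
    show "integrable M (\<lambda>\<omega>. cmod (iexp (X \<omega>) - iexp (Y \<omega>)))" using int by simp
    show "AE \<omega> in M. cmod (iexp (X \<omega>) - iexp (Y \<omega>)) \<le> Z \<omega>"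
      using le
    proof eventually_elim
    case (elim \<omega>)
    have "iexp (X \<omega>) - iexp (Y \<omega>) = iexp (Y \<omega>) * (iexp (X \<omega> - Y \<omega>) - 1)"
      by (simp add: algebra_simps exp_add[symmetric])
    then have "cmod (iexp (X \<omega>) - iexp (Y \<omega>)) = cmod (iexp (X \<omega> - Y \<omega>) - 1)"
      by (simp add: norm_mult del: of_real_diff)
    also have "\<dots> \<le> \<bar>X \<omega> - Y \<omega>\<bar>"
      using iexp_approx1[of "X \<omega> - Y \<omega>" 0] by simp
    finally show "cmod (iexp (X \<omega>) - iexp (Y \<omega>)) \<le> Z \<omega>" using elim by simp
    qed
  qed (rule Z)
  finally show ?thesis .
qed

text \<open>\<open>V m i\<close> stands for the normalised area left empty in cell \<open>i\<close> above the first \<open>m\<close> points,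
  and \<open>p i\<close> for the normalised area of the whole cell.\<close>

locale void_family = prob_space M for M :: "'a measure" +
  fixes I :: "'i set" and p :: "'i \<Rightarrow> real" and V :: "nat \<Rightarrow> 'i \<Rightarrow> 'a \<Rightarrow> real"
  assumes fin: "finite I"
    and V_measurable: "\<And>m i. i \<in> I \<Longrightarrow> random_variable borel (V m i)"
    and V_nonneg: "\<And>m i \<omega>. i \<in> I \<Longrightarrow> \<omega> \<in> space M \<Longrightarrow> 0 \<le> V m i \<omega>"
    and V_le: "\<And>m i \<omega>. i \<in> I \<Longrightarrow> \<omega> \<in> space M \<Longrightarrow> V m i \<omega> \<le> p i"
    and V_antimono: "\<And>m m' i \<omega>. i \<in> I \<Longrightarrow> \<omega> \<in> space M \<Longrightarrow> m \<le> m' \<Longrightarrow> V m' i \<omega> \<le> V m i \<omega>"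
    and joint_tail: "\<And>m J v. J \<subseteq> I \<Longrightarrow> (\<And>i. i \<in> J \<Longrightarrow> 0 \<le> v i \<and> v i \<le> p i) \<Longrightarrow>
      prob {\<omega> \<in> space M. \<forall>i\<in>J. v i \<le> V m i \<omega>} = (1 - (\<Sum>i\<in>J. v i)) ^ m"
    and sum_p_le: "(\<Sum>i\<in>I. p i) \<le> 1"
begin

lemma p_nonneg: "i \<in> I \<Longrightarrow> 0 \<le> p i"
  using not_empty V_nonneg[of i _ 0] V_le[of i _ 0] by (meson all_not_in_conv order_trans)

lemma p_le_1: "i \<in> I \<Longrightarrow> p i \<le> 1"
  using sum_p_le member_le_sum[of i I p] fin p_nonneg by fastforce

lemma V_integrable: "i \<in> I \<Longrightarrow> integrable M (V m i)"
  using V_nonneg V_le p_nonneg V_measurable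
  by (intro integrable_const_bound[where B="p i"]) auto

text \<open>Layer-cake formula: the mean is the integral over 0 <= v <= \<open>p i\<close> of the
  tail \<open>(1 - v) ^ m\<close>, which \<open>joint_tail\<close> gives for a single index.\<close>

lemma expectation_V:
  assumes i: "i \<in> I"
  shows "expectation (V m i) = (1 - (1 - p i) ^ Suc m) / real (Suc m)"
proof -
  note [measurable] = V_measurable[OF i, of m]
  have "ennreal (expectation (V m i)) = (\<integral>\<^sup>+\<omega>. ennreal (V m i \<omega>) \<partial>M)"
    using V_integrable[OF i] V_nonneg[OF i] by (intro nn_integral_eq_integral[symmetric]) auto
  also have "\<dots> = (\<integral>\<^sup>+\<omega>. (\<integral>\<^sup>+v. indicator {0..p i} v * indicator {x. fst x \<le> V m i (snd x)} (v, \<omega>) \<partial>lborel) \<partial>M)"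
  proof (rule nn_integral_cong)
    fix \<omega> assume w: "\<omega> \<in> space M"
    have "(\<integral>\<^sup>+v. indicator {0..p i} v * indicator {x. fst x \<le> V m i (snd x)} (v, \<omega>) \<partial>lborel)
        = (\<integral>\<^sup>+v. indicator {0..V m i \<omega>} v \<partial>lborel)"
      using V_le[OF i w, of m] by (intro nn_integral_cong) (auto split: split_indicator)
    then show "ennreal (V m i \<omega>) = (\<integral>\<^sup>+v. indicator {0..p i} v * indicator {x. fst x \<le> V m i (snd x)} (v, \<omega>) \<partial>lborel)"
      using V_nonneg[OF i w, of m] by simp
  qed
  also have "\<dots> = (\<integral>\<^sup>+v. (\<integral>\<^sup>+\<omega>. indicator {0..p i} v * indicator {x. fst x \<le> V m i (snd x)} (v, \<omega>) \<partial>M) \<partial>lborel)"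
  proof -
    interpret pair_sigma_finite lborel M ..
    show ?thesis by (rule Fubini') measurable
  qed
  also have "\<dots> = (\<integral>\<^sup>+v. ennreal ((1 - v) ^ m) * indicator {0..p i} v \<partial>lborel)"
  proof (rule nn_integral_cong)
    fix v :: real
    show "(\<integral>\<^sup>+\<omega>. indicator {0..p i} v * indicator {x. fst x \<le> V m i (snd x)} (v, \<omega>) \<partial>M)
        = ennreal ((1 - v) ^ m) * indicator {0..p i} v"
    proof (cases "v \<in> {0..p i}")
      case True
      have "(\<integral>\<^sup>+\<omega>. indicator {0..p i} v * indicator {x. fst x \<le> V m i (snd x)} (v, \<omega>) \<partial>M)
          = (\<integral>\<^sup>+\<omega>. indicator {\<omega> \<in> space M. v \<le> V m i \<omega>} \<omega> \<partial>M)"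
        using True by (intro nn_integral_cong) (auto split: split_indicator)
      also have "\<dots> = emeasure M {\<omega> \<in> space M. v \<le> V m i \<omega>}" by (intro nn_integral_indicator) measurable
      also have "\<dots> = ennreal ((1 - v) ^ m)"
        using joint_tail[of "{i}" "\<lambda>_. v" m] i True by (simp add: emeasure_eq_measure)
      finally show ?thesis using True by simp
    qed simp
  qed
  also have "\<dots> = ennreal (- ((1 - p i) ^ Suc m / real (Suc m)) - (- ((1 - 0) ^ Suc m / real (Suc m))))"
  proof (rule nn_integral_FTC_Icc[where F = "\<lambda>v. - ((1 - v) ^ Suc m / real (Suc m))"])
    fix v assume v: "v \<in> {0..p i}"
    then show "0 \<le> (1 - v) ^ m" using p_le_1[OF i] by simp
    have "- ((real (Suc m) * (1 - v) ^ m * (0 - 1)) / real (Suc m)) = (1 - v) ^ m" by simp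
    moreover have "((\<lambda>v. (1 - v) ^ Suc m) has_real_derivative (real (Suc m) * (1 - v) ^ m * (0 - 1))) (at v)"
      using DERIV_power[of "\<lambda>v. 1 - v" "0 - 1" v UNIV "Suc m"]
      by (simp only: DERIV_const DERIV_ident DERIV_diff diff_Suc_1 diff_Suc_Suc minus_nat.diff_0 mult_ac of_nat_Suc)
    ultimately show "((\<lambda>v. - ((1 - v) ^ Suc m / real (Suc m))) has_real_derivative (1 - v) ^ m) (at v)"
      using DERIV_minus[OF DERIV_cdivide[where c = "real (Suc m)"]] by metis
  qed (use p_nonneg[OF i] in auto)
  finally have "ennreal (expectation (V m i)) = ennreal ((1 - (1 - p i) ^ Suc m) / real (Suc m))"
    by (simp add: diff_divide_distrib del: of_nat_Suc power_Suc)
  moreover have "0 \<le> expectation (V m i)" using V_nonneg[OF i] by (intro integral_nonneg_AE) auto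
  moreover have "0 \<le> (1 - (1 - p i) ^ Suc m) / real (Suc m)"
    using p_nonneg[OF i] p_le_1[OF i] by (intro divide_nonneg_nonneg) (auto intro: power_le_one simp del: power_Suc)
  ultimately show ?thesis by (simp del: of_nat_Suc power_Suc)
qed

text \<open>By monotonicity in the number of points the difference has constant sign, so its
  absolute mean is a difference of means. The truncation terms
  \<open>(1 - p i) ^ Suc m / Suc m\<close> decrease in m, hence dropping them only enlarges the
  bound.\<close>

lemma expectation_V_diff_le:
  assumes i: "i \<in> I"
  shows "expectation (\<lambda>\<omega>. \<bar>V m i \<omega> - V n i \<omega>\<bar>) \<le> \<bar>1 / (real m + 1) - 1 / (real n + 1)\<bar>"
proof -
  have *: "expectation (\<lambda>\<omega>. \<bar>V m i \<omega> - V n i \<omega>\<bar>) \<le> 1 / (real m + 1) - 1 / (real n + 1)" if "m \<le> n" for m n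
  proof -
    have "expectation (\<lambda>\<omega>. \<bar>V m i \<omega> - V n i \<omega>\<bar>) = expectation (\<lambda>\<omega>. V m i \<omega> - V n i \<omega>)"
      using V_antimono[OF i _ that] by (intro Bochner_Integration.integral_cong) auto
    also have "\<dots> = (1 - (1 - p i) ^ Suc m) / real (Suc m) - (1 - (1 - p i) ^ Suc n) / real (Suc n)"
      using V_integrable[OF i] by (simp add: expectation_V[OF i] del: power_Suc of_nat_Suc)
    also have "\<dots> \<le> 1 / real (Suc m) - 1 / real (Suc n)"
    proof -
      have "(1 - p i) ^ Suc n / real (Suc n) \<le> (1 - p i) ^ Suc m / real (Suc m)"
        using that p_le_1[OF i] p_nonneg[OF i] by (intro frac_le power_decreasing) auto
      then show ?thesis by (simp add: diff_divide_distrib del: power_Suc of_nat_Suc)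
    qed
    finally show ?thesis by (simp add: add.commute)
  qed
  show ?thesis
  proof (cases "m \<le> n")
    case False
    then show ?thesis using *[of n m] by (simp add: abs_minus_commute)
  qed (use * in fastforce)
qed

text \<open>Two counts are kept apart: \<open>n\<close> is the fixed normalization, \<open>m\<close>
  the number of points used, which becomes random under Poissonization. The centring 1 is the mean
  of a standard exponential variable.\<close>

definition wsum :: "('i \<Rightarrow> real) \<Rightarrow> nat \<Rightarrow> nat \<Rightarrow> 'a \<Rightarrow> real" where
  "wsum \<rho> n m \<omega> = (\<Sum>i\<in>I. \<rho> i * (1 - real n * V m i \<omega>))"

lemma wsum_measurable [measurable]: "random_variable borel (wsum \<rho> n m)"
  unfolding wsum_def using V_measurable by measurable

lemma expectation_wsum_diff_le:
  "cmod (expectation (\<lambda>\<omega>. iexp (wsum \<rho> n m \<omega>)) - expectation (\<lambda>\<omega>. iexp (wsum \<rho> n n \<omega>)))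
    \<le> real n * (\<Sum>i\<in>I. \<bar>\<rho> i\<bar>) * \<bar>1 / (real m + 1) - 1 / (real n + 1)\<bar>"
proof -
  define Z where "Z \<omega> = (\<Sum>i\<in>I. \<bar>\<rho> i\<bar> * real n * \<bar>V m i \<omega> - V n i \<omega>\<bar>)" for \<omega>
  have intZ: "integrable M Z"
    unfolding Z_def using V_integrable by auto
  have "cmod (expectation (\<lambda>\<omega>. iexp (wsum \<rho> n m \<omega>)) - expectation (\<lambda>\<omega>. iexp (wsum \<rho> n n \<omega>))) \<le> expectation Z"
  proof (rule norm_expectation_iexp_diff_le[OF wsum_measurable wsum_measurable intZ], rule AE_I2)
    fix \<omega> assume "\<omega> \<in> space M"
    have "wsum \<rho> n m \<omega> - wsum \<rho> n n \<omega> = (\<Sum>i\<in>I. \<rho> i * real n * (V n i \<omega> - V m i \<omega>))"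
      unfolding wsum_def by (simp add: sum_subtractf[symmetric] algebra_simps)
    also have "\<bar>\<dots>\<bar> \<le> (\<Sum>i\<in>I. \<bar>\<rho> i * real n * (V n i \<omega> - V m i \<omega>)\<bar>)" by (rule sum_abs)
    also have "\<dots> = Z \<omega>" by (auto simp: Z_def abs_mult intro!: sum.cong)
    finally show "\<bar>wsum \<rho> n m \<omega> - wsum \<rho> n n \<omega>\<bar> \<le> Z \<omega>" .
  qed
  also have "expectation Z = (\<Sum>i\<in>I. \<bar>\<rho> i\<bar> * real n * expectation (\<lambda>\<omega>. \<bar>V m i \<omega> - V n i \<omega>\<bar>))"
    unfolding Z_def using V_integrable by (subst Bochner_Integration.integral_sum) auto
  also have "\<dots> \<le> (\<Sum>i\<in>I. \<bar>\<rho> i\<bar> * real n * \<bar>1 / (real m + 1) - 1 / (real n + 1)\<bar>)"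
    by (intro sum_mono mult_left_mono expectation_V_diff_le) auto
  also have "\<dots> = real n * (\<Sum>i\<in>I. \<bar>\<rho> i\<bar>) * \<bar>1 / (real m + 1) - 1 / (real n + 1)\<bar>"
    by (simp add: sum_distrib_left sum_distrib_right mult_ac)
  finally show ?thesis .
qed

end

section \<open>Poissonization\<close>

context void_family
begin

text \<open>The first coordinate is the random number of points; the product makes it independent of
  the whole family \<open>V\<close>.\<close>

abbreviation poissonized :: "nat \<Rightarrow> (nat \<times> 'a) measure" where
  "poissonized n \<equiv> measure_pmf (poisson_pmf (real n)) \<Otimes>\<^sub>M M"

lemma prob_space_poissonized: "prob_space (poissonized n)"
proof -
  interpret pair_prob_space "measure_pmf (poisson_pmf (real n))" M ..
  show ?thesis by (rule prob_space_axioms)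
qed

lemma measurable_poissonized:
  assumes "\<And>m. g m \<in> measurable M N"
  shows "(\<lambda>x. g (fst x) (snd x)) \<in> measurable (poissonized n) N"
proof -
  have *: "sets (poissonized n) = sets (count_space UNIV \<Otimes>\<^sub>M M)"
    by (intro sets_pair_measure_cong) auto
  show ?thesis
    unfolding measurable_cong_sets[OF * refl]
    by (rule measurable_compose_countable'[where I = UNIV])
      (auto intro: assms measurable_compose[OF measurable_snd])
qed

lemma poissonized_V_measurable:
  "i \<in> I \<Longrightarrow> (\<lambda>x. V (fst x) i (snd x)) \<in> borel_measurable (poissonized n)"
  by (intro measurable_poissonized V_measurable)

text \<open>Averaging \<open>joint_tail\<close> over the number of points is the generating function
  at 1 minus the sum of the thresholds, a nonnegative argument because of \<open>sum_p_le\<close>.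
  An exponential of a sum factorizes, which is the source of independence.\<close>

lemma poissonized_joint_tail:
  assumes n: "0 < n" and J: "J \<subseteq> I" and v: "\<And>i. i \<in> J \<Longrightarrow> 0 \<le> v i \<and> v i \<le> p i"
  shows "measure (poissonized n) {x \<in> space (poissonized n). \<forall>i\<in>J. v i \<le> V (fst x) i (snd x)}
    = exp (- real n * (\<Sum>i\<in>J. v i))"
proof -
  interpret P: pair_prob_space "measure_pmf (poisson_pmf (real n))" M ..
  let ?A = "{x \<in> space (poissonized n). \<forall>i\<in>J. v i \<le> V (fst x) i (snd x)}"
  have finJ: "finite J" using J fin finite_subset by blast
  have [measurable]: "?A \<in> sets (poissonized n)"
  proof (rule sets.sets_Collect_finite_All[OF _ finJ])
    fix i assume "i \<in> J"
    then have [measurable]: "(\<lambda>x. V (fst x) i (snd x)) \<in> borel_measurable (poissonized n)"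
      using poissonized_V_measurable J by auto
    show "{x \<in> space (poissonized n). v i \<le> V (fst x) i (snd x)} \<in> sets (poissonized n)" by measurable
  qed
  have "(\<Sum>i\<in>J. v i) \<le> (\<Sum>i\<in>J. p i)" using v by (intro sum_mono) auto
  also have "\<dots> \<le> (\<Sum>i\<in>I. p i)" using J fin p_nonneg by (intro sum_mono2) auto
  finally have s1: "0 \<le> 1 - (\<Sum>i\<in>J. v i)" using sum_p_le by simp
  have "emeasure (poissonized n) ?A = (\<integral>\<^sup>+m. emeasure M (Pair m -` ?A) \<partial>measure_pmf (poisson_pmf (real n)))"
    by (rule emeasure_pair_measure_alt) measurable
  also have "\<dots> = (\<integral>\<^sup>+m. ennreal ((1 - (\<Sum>i\<in>J. v i)) ^ m) \<partial>measure_pmf (poisson_pmf (real n)))"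
  proof (rule nn_integral_cong)
    fix m
    have "Pair m -` ?A = {\<omega> \<in> space M. \<forall>i\<in>J. v i \<le> V m i \<omega>}"
      by (auto simp: space_pair_measure)
    then show "emeasure M (Pair m -` ?A) = ennreal ((1 - (\<Sum>i\<in>J. v i)) ^ m)"
      using joint_tail[OF J v, of m] by (simp add: emeasure_eq_measure)
  qed
  also have "\<dots> = ennreal (exp (real n * ((1 - (\<Sum>i\<in>J. v i)) - 1)))"
    by (rule nn_integral_poisson_power) (use n s1 in auto)
  finally show ?thesis by (simp add: P.emeasure_eq_measure)
qed

text \<open>Closed upper half-lines form an intersection-stable generator of the Borel sets, and on
  them the joint tail is a product of the individual tails. The empty index set is split off because
  the finite product criterion wants a nonempty one.\<close>

lemma poissonized_indep:
  assumes n: "0 < n"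
  shows "prob_space.indep_vars (poissonized n) (\<lambda>_. borel) (\<lambda>i x. V (fst x) i (snd x)) I"
proof (cases "I = {}")
  case True
  then show ?thesis
    unfolding prob_space.indep_vars_def[OF prob_space_poissonized]
      prob_space.indep_sets_def[OF prob_space_poissonized] by auto
next
  case False
  interpret P: prob_space "poissonized n" by (rule prob_space_poissonized)
  let ?P = "poissonized n"
  define X where "X i x = V (fst x) i (snd x)" for i and x :: "nat \<times> 'a"
  \<comment> \<open>\<open>UNIV\<close> is added because the criterion wants the whole space among
    the generating sets.\<close>
  define E :: "'i \<Rightarrow> real set set" where "E i = insert UNIV (range atLeast)" for i
  have Xm: "\<And>i. i \<in> I \<Longrightarrow> X i \<in> borel_measurable ?P"
    unfolding X_def by (rule poissonized_V_measurable)
  have X0: "0 \<le> X i x" "X i x \<le> p i" if "i \<in> I" "x \<in> space ?P" for i x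
    using that V_nonneg V_le by (auto simp: X_def space_pair_measure)
  have E_borel: "sets (borel :: real measure) = sigma_sets (space borel) (E i)" for i
  proof -
    have "sets (borel :: real measure) = sigma_sets UNIV (range atLeast)"
      using borel_Ici by (metis sets_measure_of top_greatest Pow_UNIV)
    also have "\<dots> = sigma_sets UNIV (insert UNIV (range atLeast))"
    proof (rule sigma_sets_eqI)
      fix a :: "real set" assume "a \<in> insert UNIV (range atLeast)"
      then show "a \<in> sigma_sets UNIV (range atLeast)" by (auto intro: sigma_sets_top)
    qed auto
    finally show ?thesis by (simp add: E_def)
  qed
  have "Int_stable (E i)" for i
  proof (rule Int_stableI)
    fix a b assume "a \<in> E i" "b \<in> E i"
    moreover have "{x..} \<inter> {y..} = {max x y..}" for x y :: real by auto
    ultimately show "a \<inter> b \<in> E i" unfolding E_def by auto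
  qed
  moreover have "space borel \<in> E i" "E i \<subseteq> Pow (space borel)" for i by (auto simp: E_def)
  moreover have "P.prob (\<Inter>j\<in>I. X j -` A j \<inter> space ?P) = (\<Prod>j\<in>I. P.prob (X j -` A j \<inter> space ?P))"
    if A: "A \<in> Pi I E" for A
  proof -
    \<comment> \<open>Since the variables are nonnegative, \<open>UNIV\<close> and half-lines with a
      negative end point both amount to the threshold 0.\<close>
    have "\<exists>v. \<forall>i\<in>I. 0 \<le> v i \<and> X i -` A i \<inter> space ?P = {x \<in> space ?P. v i \<le> X i x}"
    proof (rule bchoice, rule ballI)
      fix i assume i: "i \<in> I"
      show "\<exists>u. 0 \<le> u \<and> X i -` A i \<inter> space ?P = {x \<in> space ?P. u \<le> X i x}"
      proof (cases "A i = UNIV")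
        case True
        then show ?thesis using X0[OF i] by (intro exI[of _ 0]) auto
      next
        case False
        then obtain u where "A i = {u..}" using A i by (auto simp: E_def Pi_iff)
        then show ?thesis using X0[OF i] by (intro exI[of _ "max u 0"]) auto
      qed
    qed
    then obtain v where v: "\<And>i. i \<in> I \<Longrightarrow> 0 \<le> v i"
      "\<And>i. i \<in> I \<Longrightarrow> X i -` A i \<inter> space ?P = {x \<in> space ?P. v i \<le> X i x}" by blast
    have L: "(\<Inter>j\<in>I. X j -` A j \<inter> space ?P) = {x \<in> space ?P. \<forall>j\<in>I. v j \<le> X j x}"
      using v(2) False by auto
    show ?thesis
    \<comment> \<open>The tail formula covers thresholds up to \<open>p i\<close>. Beyond one of
      these levels the event and one factor of the product both have probability 0.\<close>
    proof (cases "\<forall>i\<in>I. v i \<le> p i")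
      case True
      have "P.prob {x \<in> space ?P. \<forall>j\<in>I. v j \<le> X j x} = exp (- real n * (\<Sum>i\<in>I. v i))"
        unfolding X_def by (rule poissonized_joint_tail[OF n]) (use True v in auto)
      also have "\<dots> = (\<Prod>i\<in>I. exp (- real n * v i))"
        by (simp add: exp_sum[OF fin, symmetric] sum_distrib_left)
      also have "\<dots> = (\<Prod>j\<in>I. P.prob (X j -` A j \<inter> space ?P))"
      proof (rule prod.cong[OF refl])
        fix i assume i: "i \<in> I"
        show "exp (- real n * v i) = P.prob (X i -` A i \<inter> space ?P)"
          using poissonized_joint_tail[OF n, of "{i}" v] i v True by (simp add: X_def)
      qed
      finally show ?thesis using L by simp
    next
      case F: False
      then obtain i where i: "i \<in> I" "p i < v i" by auto
      then have e: "{x \<in> space ?P. v i \<le> X i x} = {}" using X0(2)[OF i(1)] by fastforce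
      then have "{x \<in> space ?P. \<forall>j\<in>I. v j \<le> X j x} = {}" using i by blast
      moreover have "P.prob (X i -` A i \<inter> space ?P) = 0"
        unfolding v(2)[OF i(1)] e by simp
      then have "(\<Prod>j\<in>I. P.prob (X j -` A j \<inter> space ?P)) = 0"
        using i(1) fin by (intro prod_zero) blast+
      ultimately show ?thesis unfolding L by (simp only: measure_empty)
    qed
  qed
  ultimately have "P.indep_vars (\<lambda>_. borel) X I"
    using False fin E_borel Xm by (subst P.indep_vars_finite[where E = E]) auto
  then show ?thesis by (simp add: X_def[abs_def])
qed

text \<open>Fubini conditions on the number m of points; for each m the difference is at most n
  times the weight sum times |1/(m+1) - 1/(n+1)|, and the mean of the last factor has order
  n^(-3/2).\<close>

lemma poissonized_expectation_diff_le:
  assumes n: "0 < n"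
  shows "cmod (integral\<^sup>L (poissonized n) (\<lambda>x. iexp (wsum \<rho> n (fst x) (snd x)))
      - expectation (\<lambda>\<omega>. iexp (wsum \<rho> n n \<omega>))) \<le> (\<Sum>i\<in>I. \<bar>\<rho> i\<bar>) * (2 / sqrt (real n))"
proof -
  interpret P: pair_prob_space "measure_pmf (poisson_pmf (real n))" M ..
  let ?Q = "poisson_pmf (real n)"
  define \<Phi> where "\<Phi> m = expectation (\<lambda>\<omega>. iexp (wsum \<rho> n m \<omega>))" for m
  define S where "S = (\<Sum>i\<in>I. \<bar>\<rho> i\<bar>)"
  define d where "d m = \<bar>1 / (real m + 1) - 1 / (real n + 1)\<bar>" for m :: nat
  have S0: "0 \<le> S" by (auto simp: S_def intro: sum_nonneg)
  have [measurable]: "(\<lambda>x. iexp (wsum \<rho> n (fst x) (snd x))) \<in> borel_measurable (poissonized n)"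
    using measurable_poissonized[where g = "\<lambda>m \<omega>. iexp (wsum \<rho> n m \<omega>)" and N = borel] by simp
  have int: "integrable (poissonized n) (\<lambda>x. iexp (wsum \<rho> n (fst x) (snd x)))"
    by (rule P.integrable_const_bound[where B = 1]) auto
  have nPhi: "cmod (\<Phi> m) \<le> 1" for m
  proof -
    have "cmod (\<Phi> m) \<le> expectation (\<lambda>\<omega>. cmod (iexp (wsum \<rho> n m \<omega>)))"
      unfolding \<Phi>_def by (rule integral_norm_bound)
    then show ?thesis by (simp add: prob_space)
  qed
  have intPhi: "integrable (measure_pmf ?Q) \<Phi>"
    by (rule measure_pmf.integrable_const_bound[where B = 1]) (use nPhi in auto)
  have d1: "\<bar>d m\<bar> \<le> 1" for m
  proof -
    have "0 \<le> 1 / (real m + 1)" "1 / (real m + 1) \<le> 1" "0 \<le> 1 / (real n + 1)" "1 / (real n + 1) \<le> 1"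
      by auto
    then show ?thesis unfolding d_def by linarith
  qed
  have intd: "integrable (measure_pmf ?Q) d"
    by (rule measure_pmf.integrable_const_bound[where B = 1]) (use d1 in auto)
  have Ed: "measure_pmf.expectation ?Q d \<le> (1 + sqrt n) / (real n * (real n + 1))"
  proof -
    have "ennreal (measure_pmf.expectation ?Q d) = (\<integral>\<^sup>+m. ennreal (d m) \<partial>measure_pmf ?Q)"
      by (rule nn_integral_eq_integral[symmetric, OF intd]) (simp add: d_def)
    also have "\<dots> \<le> ennreal ((1 + sqrt n) / (real n * (real n + 1)))"
      unfolding d_def by (rule nn_integral_poisson_inverse_dev[OF n])
    finally show ?thesis by (subst (asm) ennreal_le_iff) auto
  qed
  have "integral\<^sup>L (poissonized n) (\<lambda>x. iexp (wsum \<rho> n (fst x) (snd x))) = measure_pmf.expectation ?Q \<Phi>"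
    using P.integral_fst'[OF int] by (simp add: \<Phi>_def[abs_def])
  then have "cmod (integral\<^sup>L (poissonized n) (\<lambda>x. iexp (wsum \<rho> n (fst x) (snd x))) - \<Phi> n)
      = cmod (measure_pmf.expectation ?Q (\<lambda>m. \<Phi> m - \<Phi> n))"
    using intPhi by simp
  also have "\<dots> \<le> measure_pmf.expectation ?Q (\<lambda>m. cmod (\<Phi> m - \<Phi> n))"
    by (rule integral_norm_bound)
  also have "\<dots> \<le> measure_pmf.expectation ?Q (\<lambda>m. real n * S * d m)"
  proof (rule integral_mono)
    show "integrable (measure_pmf ?Q) (\<lambda>m. cmod (\<Phi> m - \<Phi> n))"
      using intPhi by (intro integrable_norm) auto
    show "integrable (measure_pmf ?Q) (\<lambda>m. real n * S * d m)" using intd by simp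
    show "cmod (\<Phi> m - \<Phi> n) \<le> real n * S * d m" for m
      unfolding \<Phi>_def S_def d_def by (rule expectation_wsum_diff_le)
  qed
  also have "\<dots> = real n * S * measure_pmf.expectation ?Q d" by simp
  also have "\<dots> \<le> real n * S * ((1 + sqrt n) / (real n * (real n + 1)))"
    using S0 Ed by (intro mult_left_mono) auto
  also have "\<dots> = S * ((1 + sqrt n) / (real n + 1))" using n by simp
  also have "\<dots> \<le> S * (2 / sqrt n)"
  proof (rule mult_left_mono[OF _ S0])
    have "sqrt n * (1 + sqrt n) = sqrt n + real n" by (simp add: algebra_simps)
    also have "sqrt n \<le> real n" using n real_sqrt_le_mono[of "real n" "(real n)\<^sup>2"]
      by (simp add: power2_eq_square)
    finally have "sqrt n * (1 + sqrt n) \<le> 2 * (real n + 1)" by simp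
    then show "(1 + sqrt n) / (real n + 1) \<le> 2 / sqrt n" using n by (simp add: divide_simps mult_ac)
  qed
  finally show ?thesis by (simp add: \<Phi>_def S_def)
qed

end

section \<open>The standard exponential distribution\<close>

definition std_exponential :: "real measure" where
  "std_exponential = density lborel (exponential_density 1)"

lemma sets_std_exponential [simp, measurable_cong]: "sets std_exponential = sets borel"
  and space_std_exponential [simp]: "space std_exponential = UNIV"
  by (simp_all add: std_exponential_def)

lemma prob_space_std_exponential: "prob_space std_exponential"
  unfolding std_exponential_def by (rule prob_space_exponential_density) simp

lemma distributed_std_exponential: "distributed std_exponential lborel (\<lambda>x. x) (exponential_density 1)"
  unfolding distributed_def std_exponential_def by (auto intro!: distr_id2)

lemma std_exponential_greaterThan:
  assumes "0 \<le> a"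
  shows "measure std_exponential {a<..} = exp (- a)"
proof -
  interpret prob_space std_exponential by (rule prob_space_std_exponential)
  have "{x \<in> space std_exponential. a < x} = {a<..}" by auto
  with exponential_distributedD_gt[OF distributed_std_exponential assms] show ?thesis by simp
qed

lemma std_exponential_atLeast:
  assumes "0 \<le> a"
  shows "measure std_exponential {a..} = exp (- a)"
proof -
  interpret prob_space std_exponential by (rule prob_space_std_exponential)
  have "AE x in std_exponential. x \<noteq> a"
    unfolding std_exponential_def
    by (subst AE_density) (use AE_lborel_singleton[of a] in auto)
  then have "measure std_exponential {a..} = measure std_exponential {a<..}"
    by (intro finite_measure_eq_AE) (auto elim!: eventually_mono)
  with std_exponential_greaterThan[OF assms] show ?thesis by simp
qed

lemma std_exponential_moment:
  shows "integrable std_exponential (\<lambda>x. x ^ i)"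
    and "integral\<^sup>L std_exponential (\<lambda>x. x ^ i) = fact i"
proof -
  interpret prob_space std_exponential by (rule prob_space_std_exponential)
  show "integrable std_exponential (\<lambda>x. x ^ i)" "integral\<^sup>L std_exponential (\<lambda>x. x ^ i) = fact i"
    using erlang_ith_moment_integrable[OF _ distributed_std_exponential, of i]
      erlang_ith_moment[OF _ distributed_std_exponential, of i] by auto
qed

lemma AE_std_exponential_nonneg: "AE x in std_exponential. 0 \<le> x"
  unfolding std_exponential_def by (subst AE_density) (auto simp: exponential_density_def)

text \<open>As 1 - x has mean 0 and variance 1, both sides agree to second order in s. The constant
  4 is 3 from the cubic remainder of the exponential law plus 1 from that of the Gaussian
  factor.\<close>

lemma std_exponential_char_approx:
  "cmod (integral\<^sup>L std_exponential (\<lambda>x. iexp (s * (1 - x))) - exp (- s\<^sup>2 / 2)) \<le> 4 * \<bar>s\<bar> ^ 3"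
proof -
  interpret prob_space std_exponential by (rule prob_space_std_exponential)
  define ch where "ch = integral\<^sup>L std_exponential (\<lambda>x. iexp (s * (1 - x)))"
  note m = std_exponential_moment[of 1, simplified] std_exponential_moment[of 2] std_exponential_moment[of 3]
  have sq: "(\<lambda>x::real. (1 - x)\<^sup>2) = (\<lambda>x. 1 - 2 * x + x\<^sup>2)" by (auto simp: power2_diff)
  have E1: "expectation (\<lambda>x. 1 - x) = 0" using m prob_space by simp
  have E2: "expectation (\<lambda>x. (1 - x)\<^sup>2) = 1" using m prob_space by (simp add: sq)
  have i2: "integrable std_exponential (\<lambda>x. (1 - x)\<^sup>2)" using m by (simp add: sq)
  have E3: "variance (\<lambda>x. 1 - x) = 1" unfolding E1 using E2 by simp
  have i1: "integrable std_exponential (\<lambda>x. 1 - x)" using m by simp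
  have ch_eq: "ch = char (distr std_exponential borel (\<lambda>x. 1 - x)) s"
    unfolding ch_def char_def by (subst integral_distr) auto
  have "cmod (ch - (1 - s\<^sup>2 * 1 / 2)) \<le>
      (s\<^sup>2 / 6) * expectation (\<lambda>x. min (6 * (1 - x)\<^sup>2) (\<bar>s\<bar> * \<bar>1 - x\<bar> ^ 3))"
    unfolding ch_eq
    by (rule char_approx3'[OF _ i1 i2 E1 E3 refl]) simp
  also have "\<dots> \<le> (s\<^sup>2 / 6) * expectation (\<lambda>x. \<bar>s\<bar> * (1 + 3 * x + 3 * x\<^sup>2 + x ^ 3))"
  proof (intro mult_left_mono integral_mono_AE)
    show "integrable std_exponential (\<lambda>x. min (6 * (1 - x)\<^sup>2) (\<bar>s\<bar> * \<bar>1 - x\<bar> ^ 3))"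
      by (rule Bochner_Integration.integrable_bound[OF integrable_mult_right[OF i2, of 6]]) auto
    show "AE x in std_exponential. min (6 * (1 - x)\<^sup>2) (\<bar>s\<bar> * \<bar>1 - x\<bar> ^ 3)
        \<le> \<bar>s\<bar> * (1 + 3 * x + 3 * x\<^sup>2 + x ^ 3)"
      using AE_std_exponential_nonneg
    proof eventually_elim
      case (elim x)
      have "\<bar>1 - x\<bar> ^ 3 \<le> (1 + x) ^ 3" using elim by (intro power_mono) auto
      also have "\<dots> = 1 + 3 * x + 3 * x\<^sup>2 + x ^ 3"
        by (simp add: power3_eq_cube power2_eq_square algebra_simps)
      finally have "\<bar>s\<bar> * \<bar>1 - x\<bar> ^ 3 \<le> \<bar>s\<bar> * (1 + 3 * x + 3 * x\<^sup>2 + x ^ 3)"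
        by (rule mult_left_mono) simp
      then show ?case by linarith
    qed
  qed (use m in auto)
  \<comment> \<open>The moments are factorials: 1 + 3 + 3 * 2 + 6 = 16, and 16/6 is at most
    3.\<close>
  also have "expectation (\<lambda>x. \<bar>s\<bar> * (1 + 3 * x + 3 * x\<^sup>2 + x ^ 3)) = 16 * \<bar>s\<bar>"
    using m prob_space by (simp add: fact_numeral)
  also have "s\<^sup>2 / 6 * (16 * \<bar>s\<bar>) \<le> 3 * \<bar>s\<bar> ^ 3"
  proof -
    have "s\<^sup>2 * \<bar>s\<bar> = \<bar>s\<bar> ^ 3"
      by (cases "0 \<le> s") (simp_all add: power3_eq_cube power2_eq_square)
    moreover have "0 \<le> \<bar>s\<bar> ^ 3" by simp
    ultimately show ?thesis by (simp add: mult.commute)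
  qed
  finally have a: "cmod (ch - (1 - s\<^sup>2 / 2)) \<le> 3 * \<bar>s\<bar> ^ 3" by simp
  show ?thesis
  \<comment> \<open>For small s the Gaussian remainder \<open>s^4/8\<close> is below
    \<open>|s|^3\<close>. For large s the claim is trivial: both terms have modulus at most 1, and 2
    <= 4 |s|^3.\<close>
  proof (cases "\<bar>s\<bar> \<le> 1")
    case True
    define u where "u = s\<^sup>2 / 2"
    have u: "0 \<le> u" by (simp add: u_def)
    have "\<bar>exp (- u) - (1 - u)\<bar> \<le> u\<^sup>2 / 2"
    proof -
      have l: "1 - u \<le> exp (- u)" using exp_ge_add_one_self[of "- u"] by simp
      have "exp (- u) \<le> 1 - u + u\<^sup>2 / 2"
      proof -
        have "((\<lambda>x. 1 - x + x\<^sup>2 / 2 - exp (- x)) has_real_derivative (- 1 + x + exp (- x))) (at x)" for x :: real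
          by (auto intro!: derivative_eq_intros)
        moreover have "0 \<le> - 1 + x + exp (- x)" for x :: real
          using exp_ge_add_one_self[of "- x"] by simp
        ultimately have "1 - 0 + 0\<^sup>2 / 2 - exp (- 0) \<le> 1 - u + u\<^sup>2 / 2 - exp (- u)"
          by (intro DERIV_nonneg_imp_nondecreasing[OF u]) blast
        then show ?thesis by simp
      qed
      with l show ?thesis by simp
    qed
    also have "u\<^sup>2 / 2 = \<bar>s\<bar> ^ 3 * (\<bar>s\<bar> / 8)"
      by (simp add: u_def power3_eq_cube power2_eq_square field_simps)
    also have "\<dots> \<le> \<bar>s\<bar> ^ 3 * 1" using True by (intro mult_left_mono) auto
    finally have "\<bar>exp (- u) - (1 - u)\<bar> \<le> \<bar>s\<bar> ^ 3" by simp
    then have b: "cmod (complex_of_real (1 - s\<^sup>2 / 2) - complex_of_real (exp (- s\<^sup>2 / 2))) \<le> \<bar>s\<bar> ^ 3"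
      unfolding u_def of_real_diff[symmetric] norm_of_real by (simp add: abs_minus_commute)
    show ?thesis using norm_diff_triangle_le[OF a b] by (simp add: ch_def)
  next
    case False
    have "cmod ch \<le> 1"
    proof -
      have "cmod ch \<le> expectation (\<lambda>x. cmod (iexp (s * (1 - x))))"
        unfolding ch_def by (rule integral_norm_bound)
      then show ?thesis using prob_space by simp
    qed
    moreover have "cmod (complex_of_real (exp (- s\<^sup>2 / 2))) \<le> 1"
      unfolding norm_of_real by simp
    ultimately have "cmod (ch - exp (- s\<^sup>2 / 2)) \<le> 2"
      using norm_triangle_ineq4[of ch "complex_of_real (exp (- s\<^sup>2 / 2))"] by linarith
    also have "2 \<le> 4 * \<bar>s\<bar> ^ 3" using False one_le_power[of "\<bar>s\<bar>" 3] by linarith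
    finally show ?thesis by (simp add: ch_def)
  qed
qed

text \<open>The integrands differ only on x > c, where their distance is at most 2.\<close>

lemma std_exponential_truncation:
  assumes c: "0 \<le> c"
  shows "cmod (integral\<^sup>L std_exponential (\<lambda>x. iexp (s * (1 - min x c)))
    - integral\<^sup>L std_exponential (\<lambda>x. iexp (s * (1 - x)))) \<le> 2 * exp (- c)"
proof -
  interpret prob_space std_exponential by (rule prob_space_std_exponential)
  have int: "integrable std_exponential (\<lambda>x. iexp (s * (1 - min x c)))"
    "integrable std_exponential (\<lambda>x. iexp (s * (1 - x)))"
    by (rule integrable_const_bound[where B = 1]; auto)+
  have "cmod (integral\<^sup>L std_exponential (\<lambda>x. iexp (s * (1 - min x c)))
      - integral\<^sup>L std_exponential (\<lambda>x. iexp (s * (1 - x))))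
    = cmod (expectation (\<lambda>x. iexp (s * (1 - min x c)) - iexp (s * (1 - x))))"
    using int by (subst Bochner_Integration.integral_diff) auto
  also have "\<dots> \<le> expectation (\<lambda>x. cmod (iexp (s * (1 - min x c)) - iexp (s * (1 - x))))"
    by (rule integral_norm_bound)
  also have "\<dots> \<le> expectation (\<lambda>x. 2 * indicator {c<..} x)"
  proof (rule integral_mono)
    show "integrable std_exponential (\<lambda>x. cmod (iexp (s * (1 - min x c)) - iexp (s * (1 - x))))"
      using int by (intro integrable_norm Bochner_Integration.integrable_diff)
    show "integrable std_exponential (\<lambda>x. 2 * indicator {c<..} x :: real)"
      by (intro integrable_mult_right) (auto simp: emeasure_eq_measure)
    fix x
    show "cmod (iexp (s * (1 - min x c)) - iexp (s * (1 - x))) \<le> 2 * indicator {c<..} x"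
    proof (cases "c < x")
      case True
      have "cmod (iexp (s * (1 - min x c)) - iexp (s * (1 - x))) \<le>
          cmod (iexp (s * (1 - min x c))) + cmod (iexp (s * (1 - x)))" by (rule norm_triangle_ineq4)
      also have "\<dots> = 2" by simp
      finally show ?thesis using True by simp
    qed (simp add: min_def)
  qed
  also have "\<dots> = 2 * exp (- c)" using std_exponential_greaterThan[OF c] by simp
  finally show ?thesis .
qed

section \<open>Characteristic function of weighted void areas\<close>

lemma borel_measure_eqI_atLeast:
  fixes \<mu> \<nu> :: "real measure"
  assumes "prob_space \<mu>" "prob_space \<nu>" and [simp]: "sets \<mu> = sets borel" "sets \<nu> = sets borel"
    and eq: "\<And>a. measure \<mu> {a..} = measure \<nu> {a..}"
  shows "\<mu> = \<nu>"
proof -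
  interpret \<mu>: prob_space \<mu> by fact
  interpret \<nu>: prob_space \<nu> by fact
  have borel: "sets (borel :: real measure) = sigma_sets UNIV (range atLeast)"
    using borel_Ici by (metis sets_measure_of top_greatest Pow_UNIV)
  show ?thesis
  proof (rule measure_eqI_generator_eq[where E = "range atLeast" and \<Omega> = UNIV and A = "\<lambda>i. {- real i..}"])
    show "Int_stable (range (atLeast :: real \<Rightarrow> _))"
    proof (rule Int_stableI)
      fix a b :: "real set" assume "a \<in> range atLeast" "b \<in> range atLeast"
      moreover have "{x..} \<inter> {y..} = {max x y..}" for x y :: real by auto
      ultimately show "a \<inter> b \<in> range atLeast" by auto
    qed
    show "\<And>X. X \<in> range atLeast \<Longrightarrow> emeasure \<mu> X = emeasure \<nu> X"
      using eq by (auto simp: \<mu>.emeasure_eq_measure \<nu>.emeasure_eq_measure)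
    have "\<exists>i. - real i \<le> x" for x using reals_Archimedean2[of "- x"] by (meson less_imp_le minus_le_iff)
    then show "(\<Union>i. {- real i..}) = (UNIV :: real set)" by auto
  qed (auto simp: borel)
qed

context void_family
begin

text \<open>Both laws have upper tail 1 for a <= 0, \<open>exp (- a)\<close> up to the level
  \<open>n * p i\<close>, and 0 beyond it. The atom at that level has mass
  \<open>exp (- n * p i)\<close>, the probability that \<open>V\<close> takes its largest
  value.\<close>

lemma poissonized_V_distr:
  assumes n: "0 < n" and i: "i \<in> I"
  shows "distr (poissonized n) borel (\<lambda>x. real n * V (fst x) i (snd x))
    = distr std_exponential borel (\<lambda>x. min x (real n * p i))"
proof (rule borel_measure_eqI_atLeast)
  interpret P: prob_space "poissonized n" by (rule prob_space_poissonized)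
  interpret E: prob_space std_exponential by (rule prob_space_std_exponential)
  note [measurable] = poissonized_V_measurable[OF i, of n]
  define c where "c = real n * p i"
  have c: "0 \<le> c" using p_nonneg[OF i] by (simp add: c_def)
  show "prob_space (distr (poissonized n) borel (\<lambda>x. real n * V (fst x) i (snd x)))"
    by (rule P.prob_space_distr) simp
  show "prob_space (distr std_exponential borel (\<lambda>x. min x (real n * p i)))"
    by (rule E.prob_space_distr) simp
  have V: "0 \<le> V (fst x) i (snd x)" "V (fst x) i (snd x) \<le> p i" if "x \<in> space (poissonized n)" for x
    using that V_nonneg[OF i] V_le[OF i] by (auto simp: space_pair_measure)
  fix a :: real
  have L: "measure (distr (poissonized n) borel (\<lambda>x. real n * V (fst x) i (snd x))) {a..}
      = P.prob {x \<in> space (poissonized n). a \<le> real n * V (fst x) i (snd x)}"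
    by (subst measure_distr) (auto intro!: arg_cong[where f = P.prob])
  have R: "measure (distr std_exponential borel (\<lambda>x. min x (real n * p i))) {a..}
      = E.prob {x. a \<le> min x c}"
    by (subst measure_distr) (auto intro!: arg_cong[where f = E.prob] simp: c_def)
  consider "a \<le> 0" | "0 < a" "a \<le> c" | "c < a" by linarith
  then show "measure (distr (poissonized n) borel (\<lambda>x. real n * V (fst x) i (snd x))) {a..} =
      measure (distr std_exponential borel (\<lambda>x. min x (real n * p i))) {a..}"
  proof cases
    case 1
    have "{x \<in> space (poissonized n). a \<le> real n * V (fst x) i (snd x)} = space (poissonized n)"
    proof -
      have "a \<le> real n * V (fst x) i (snd x)" if x: "x \<in> space (poissonized n)" for x
      proof -
        have "0 \<le> real n * V (fst x) i (snd x)" using V(1)[OF x] by simp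
        then show ?thesis using 1 by linarith
      qed
      then show ?thesis by blast
    qed
    moreover have "E.prob {x. a \<le> min x c} = 1"
    proof (subst E.prob_eq_1)
      show "{x. a \<le> min x c} \<in> E.events" by simp
      show "AE x in std_exponential. x \<in> {x. a \<le> min x c}"
        using AE_std_exponential_nonneg by eventually_elim (use 1 c in auto)
    qed
    ultimately show ?thesis unfolding L R using P.prob_space by simp
  next
    case 2
    have "{x \<in> space (poissonized n). a \<le> real n * V (fst x) i (snd x)}
      = {x \<in> space (poissonized n). \<forall>j\<in>{i}. a / real n \<le> V (fst x) j (snd x)}"
      using n by (auto simp: field_simps)
    moreover have "P.prob {x \<in> space (poissonized n). \<forall>j\<in>{i}. a / real n \<le> V (fst x) j (snd x)} = exp (- a)"
      using poissonized_joint_tail[OF n, of "{i}" "\<lambda>_. a / real n"] i 2 n by (simp add: c_def field_simps)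
    moreover have "{x. a \<le> min x c} = {a..}" using 2 by auto
    ultimately show ?thesis unfolding L R using std_exponential_atLeast[of a] 2 by simp
  next
    case 3
    have "{x \<in> space (poissonized n). a \<le> real n * V (fst x) i (snd x)} = {}"
    proof -
      have "real n * V (fst x) i (snd x) \<le> c" if "x \<in> space (poissonized n)" for x
        using V(2)[OF that] by (simp add: c_def mult_left_mono)
      then show ?thesis using 3 by fastforce
    qed
    moreover have "{x. a \<le> min x c} = {}" using 3 by auto
    ultimately show ?thesis unfolding L R by (simp only: measure_empty)
  qed
qed simp_all

text \<open>By independence the left integral is a product of characteristic functions, to be
  compared with a product of Gaussian factors. All factors lie in the unit disk, so the difference
  of the products is at most the sum of the differences; each of these is a truncation error plus a
  cubic Taylor error.\<close>

lemma poissonized_expectation_approx: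
  assumes n: "0 < n"
  shows "cmod (integral\<^sup>L (poissonized n) (\<lambda>x. iexp (wsum \<rho> n (fst x) (snd x)))
      - exp (- (\<Sum>i\<in>I. (\<rho> i)\<^sup>2) / 2))
    \<le> (\<Sum>i\<in>I. 2 * exp (- real n * p i) + 4 * \<bar>\<rho> i\<bar> ^ 3)"
proof -
  interpret P: prob_space "poissonized n" by (rule prob_space_poissonized)
  interpret E: prob_space std_exponential by (rule prob_space_std_exponential)
  define Y where "Y i x = \<rho> i * (1 - real n * V (fst x) i (snd x))" for i and x :: "nat \<times> 'a"
  define z where "z i = char (distr (poissonized n) borel (Y i)) 1" for i
  have Ym: "Y i \<in> borel_measurable (poissonized n)" if "i \<in> I" for i
    unfolding Y_def using poissonized_V_measurable[OF that] by measurable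
  have ind: "P.indep_vars (\<lambda>_. borel) Y I"
    unfolding Y_def using poissonized_indep[OF n]
    by (rule P.indep_vars_compose2[where Y = "\<lambda>i v. \<rho> i * (1 - real n * v)"]) auto
  have "char (distr (poissonized n) borel (\<lambda>x. \<Sum>i\<in>I. Y i x)) 1
      = integral\<^sup>L (poissonized n) (\<lambda>x. iexp (wsum \<rho> n (fst x) (snd x)))"
  proof -
    have "(\<lambda>x. \<Sum>i\<in>I. Y i x) \<in> borel_measurable (poissonized n)"
      by (intro borel_measurable_sum Ym)
    then show ?thesis unfolding char_def by (subst integral_distr) (auto simp: wsum_def Y_def)
  qed
  then have prod: "integral\<^sup>L (poissonized n) (\<lambda>x. iexp (wsum \<rho> n (fst x) (snd x))) = (\<Prod>i\<in>I. z i)"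
    using P.char_distr_sum[OF ind, of 1] by (simp add: z_def)
  have gauss: "exp (- (\<Sum>i\<in>I. (\<rho> i)\<^sup>2) / 2) = (\<Prod>i\<in>I. exp (- (\<rho> i)\<^sup>2 / 2))"
    by (simp add: exp_sum[OF fin, symmetric] sum_negf sum_divide_distrib)
  have "cmod ((\<Prod>i\<in>I. z i) - (\<Prod>i\<in>I. complex_of_real (exp (- (\<rho> i)\<^sup>2 / 2))))
      \<le> (\<Sum>i\<in>I. cmod (z i - complex_of_real (exp (- (\<rho> i)\<^sup>2 / 2))))"
  proof (rule norm_prod_diff)
    fix i assume i: "i \<in> I"
    interpret D: real_distribution "distr (poissonized n) borel (Y i)"
      using Ym[OF i] by (rule P.real_distribution_distr)
    show "cmod (z i) \<le> 1" unfolding z_def by (rule D.cmod_char_le_1)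
    show "cmod (complex_of_real (exp (- (\<rho> i)\<^sup>2 / 2))) \<le> 1" unfolding norm_of_real by simp
  qed
  also have "\<dots> \<le> (\<Sum>i\<in>I. 2 * exp (- real n * p i) + 4 * \<bar>\<rho> i\<bar> ^ 3)"
  proof (rule sum_mono)
    fix i assume i: "i \<in> I"
    note [measurable] = poissonized_V_measurable[OF i, of n]
    have "z i = integral\<^sup>L (distr (poissonized n) borel (\<lambda>x. real n * V (fst x) i (snd x))) (\<lambda>v. iexp (\<rho> i * (1 - v)))"
      unfolding z_def char_def Y_def by (simp add: integral_distr)
    also have "\<dots> = integral\<^sup>L std_exponential (\<lambda>x. iexp (\<rho> i * (1 - min x (real n * p i))))"
      unfolding poissonized_V_distr[OF n i] by (subst integral_distr) auto
    finally have z: "z i = integral\<^sup>L std_exponential (\<lambda>x. iexp (\<rho> i * (1 - min x (real n * p i))))" .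
    show "cmod (z i - complex_of_real (exp (- (\<rho> i)\<^sup>2 / 2))) \<le> 2 * exp (- real n * p i) + 4 * \<bar>\<rho> i\<bar> ^ 3"
      unfolding z
      using norm_diff_triangle_le[OF std_exponential_truncation std_exponential_char_approx,
          of "real n * p i" "\<rho> i"] p_nonneg[OF i]
      by simp
  qed
  finally show ?thesis unfolding prod gauss of_real_prod .
qed

text \<open>Return to the fixed sample size. The bound holds for every n > 0 and all weights, so the
  asymptotics later concern only deterministic sums.\<close>

lemma char_weighted_sum:
  assumes n: "0 < n"
  shows "cmod (expectation (\<lambda>\<omega>. iexp (wsum \<rho> n n \<omega>)) - exp (- (\<Sum>i\<in>I. (\<rho> i)\<^sup>2) / 2))
    \<le> (\<Sum>i\<in>I. \<bar>\<rho> i\<bar>) * (2 / sqrt (real n))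
      + (\<Sum>i\<in>I. 2 * exp (- real n * p i) + 4 * \<bar>\<rho> i\<bar> ^ 3)"
  using norm_diff_triangle_le[OF _ poissonized_expectation_approx[OF n, of \<rho>]]
    poissonized_expectation_diff_le[OF n, of \<rho>]
  by (simp add: norm_minus_commute)

end

section \<open>Area of the region above a level\<close>

text \<open>The area between height \<open>u\<close> and the graph over one cell. Written as an
  integral over the closed cell, it inherits monotonicity and Lipschitz continuity in
  \<open>u\<close> from the integrand; the extra end point is a null set.\<close>

definition excess :: "(real \<Rightarrow> real) \<Rightarrow> nat \<Rightarrow> nat \<Rightarrow> real \<Rightarrow> real" where
  "excess f k r u = integral {(real r - 1) / real k .. real r / real k} (\<lambda>t. max 0 (f t - u))"

lemma cell_subset:
  assumes "r \<in> {1..k}"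
  shows "{(real r - 1) / real k .. real r / real k} \<subseteq> {0..1}"
    and "(real r - 1) / real k < real r / real k"
proof -
  have k: "0 < real k" "1 \<le> real r" "real r \<le> real k" using assms by auto
  have "0 \<le> (real r - 1) / real k" "real r / real k \<le> 1" using k by auto
  then show "{(real r - 1) / real k .. real r / real k} \<subseteq> {0..1}" by auto
  show "(real r - 1) / real k < real r / real k" using k by (simp add: divide_strict_right_mono)
qed

lemma cell_length: "real r / real k - (real r - 1) / real k = 1 / real k"
  by (simp add: diff_divide_distrib)

lemma cells_disjoint:
  assumes "r \<noteq> s" shows "cell k r \<inter> cell k s = {}"
proof (rule ccontr)
  assume "cell k r \<inter> cell k s \<noteq> {}"
  then obtain t where "t \<in> cell k r" "t \<in> cell k s" by blast
  then have t: "(real r - 1) / real k \<le> t" "t < real r / real k"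
    "(real s - 1) / real k \<le> t" "t < real s / real k" unfolding cell_def by simp_all
  have k: "0 < real k" using t(1,2) by (cases "k = 0") auto
  have "real r - 1 \<le> t * real k" "t * real k < real r" "real s - 1 \<le> t * real k" "t * real k < real s"
    using t k by (auto simp: field_simps)
  then have "real r < real s + 1" "real s < real r + 1" by linarith+
  then show False using assms by auto
qed

lemma excess_integrable:
  fixes f :: "real \<Rightarrow> real"
  assumes "continuous_on {0..1} f" "r \<in> {1..k}"
  shows "(\<lambda>t. max 0 (f t - u)) integrable_on {(real r - 1) / real k .. real r / real k}"
  by (rule integrable_continuous_interval)
    (intro continuous_intros continuous_on_subset[OF assms(1) cell_subset(1)[OF assms(2)]])

lemma excess_nonneg: "0 \<le> excess f k r u"
  unfolding excess_def
  \<comment> \<open>A nonintegrable integrand gets the default integral 0, which is nonnegative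
    too.\<close>
  by (cases "(\<lambda>t. max 0 (f t - u)) integrable_on {(real r - 1) / real k .. real r / real k}")
    (auto intro: Henstock_Kurzweil_Integration.integral_nonneg simp: not_integrable_integral)

lemma excess_antimono:
  assumes "continuous_on {0..1} f" "r \<in> {1..k}" "u \<le> u'"
  shows "excess f k r u' \<le> excess f k r u"
  unfolding excess_def
  by (intro integral_le excess_integrable assms(1,2)) (use assms(3) in auto)

lemma excess_lipschitz:
  assumes "continuous_on {0..1} f" "r \<in> {1..k}"
  shows "\<bar>excess f k r u - excess f k r u'\<bar> \<le> \<bar>u - u'\<bar> / real k"
proof -
  have "excess f k r u - excess f k r u'
      = integral {(real r - 1) / real k .. real r / real k} (\<lambda>t. max 0 (f t - u) - max 0 (f t - u'))"
    unfolding excess_def by (intro Henstock_Kurzweil_Integration.integral_diff[symmetric] excess_integrable assms)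
  moreover have "norm (integral {(real r - 1) / real k .. real r / real k} (\<lambda>t. max 0 (f t - u) - max 0 (f t - u')))
      \<le> \<bar>u - u'\<bar> * (real r / real k - (real r - 1) / real k)"
    using cell_subset(2)[OF assms(2)]
    by (intro integral_bound continuous_intros continuous_on_subset[OF assms(1) cell_subset(1)[OF assms(2)]]) auto
  ultimately show ?thesis by (simp add: cell_length)
qed

lemma continuous_excess:
  assumes "continuous_on {0..1} f" "r \<in> {1..k}"
  shows "continuous_on UNIV (excess f k r)"
proof (rule lipschitz_on_continuous_on)
  show "(1 / real k)-lipschitz_on UNIV (excess f k r)"
    using excess_lipschitz[OF assms] by (intro lipschitz_onI) (auto simp: dist_real_def)
qed

text \<open>Pointwise, \<open>max 0 (f t - u)\<close> is within \<open>w\<close> of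
  \<open>m - u\<close>: if \<open>f t > u\<close> this is the oscillation bound; otherwise
  \<open>m - u <= m - f t <= w\<close>, while \<open>u <= m + w\<close> gives the other side.
  Averaging over the cell makes the height an affine function of the void area up to
  \<open>w\<close>.\<close>

lemma excess_approx:
  assumes f: "continuous_on {0..1} f" and r: "r \<in> {1..k}"
    and w: "\<And>t. t \<in> {(real r - 1) / real k .. real r / real k} \<Longrightarrow> \<bar>f t - m\<bar> \<le> w"
    and u: "u \<le> m + w"
  shows "\<bar>u - (m - real k * excess f k r u)\<bar> \<le> w"
proof -
  let ?S = "{(real r - 1) / real k .. real r / real k}"
  have k: "0 < real k" using r by auto
  have le: "(real r - 1) / real k \<le> real r / real k" using cell_subset(2)[OF r] by simp
  have "excess f k r u - (m - u) / real k = integral ?S (\<lambda>t. max 0 (f t - u)) - integral ?S (\<lambda>t. m - u)"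
    unfolding excess_def using cell_length[of r k] le by simp
  also have "\<dots> = integral ?S (\<lambda>t. max 0 (f t - u) - (m - u))"
    by (intro Henstock_Kurzweil_Integration.integral_diff[symmetric] excess_integrable f r) auto
  finally have eq: "excess f k r u - (m - u) / real k = integral ?S (\<lambda>t. max 0 (f t - u) - (m - u))" .
  have "norm (integral ?S (\<lambda>t. max 0 (f t - u) - (m - u))) \<le> w * (real r / real k - (real r - 1) / real k)"
  proof (rule integral_bound[OF le])
    show "continuous_on ?S (\<lambda>t. max 0 (f t - u) - (m - u))"
      by (intro continuous_intros continuous_on_subset[OF f cell_subset(1)[OF r]])
    fix t assume "t \<in> ?S"
    from w[OF this] u show "norm (max 0 (f t - u) - (m - u)) \<le> w" by (auto simp: max_def)
  qed
  then have "\<bar>excess f k r u - (m - u) / real k\<bar> \<le> w / real k" by (simp add: eq cell_length)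
  then have "\<bar>real k * (excess f k r u - (m - u) / real k)\<bar> \<le> w"
    using k by (simp add: abs_mult pos_le_divide_eq mult.commute)
  moreover have "real k * (excess f k r u - (m - u) / real k) = u - (m - real k * excess f k r u)"
    using k by (simp add: field_simps)
  ultimately show ?thesis by simp
qed

text \<open>Vertical slices over the cell are the intervals from \<open>u\<close> to
  \<open>f x\<close>; \<open>0 <= u\<close> keeps the lower edge of the region out of them. The
  right end point, absent from the half-open cell, is discarded as a null set.\<close>

lemma emeasure_region_above:
  assumes f: "continuous_on {0..1} f" and r: "r \<in> {1..k}" and u: "0 \<le> u"
  shows "emeasure lborel (region f \<inter> {z. fst z \<in> cell k r \<and> u < snd z}) = ennreal (excess f k r u)"
proof -
  let ?S = "{(real r - 1) / real k .. real r / real k}"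
  let ?B = "region f \<inter> {z. fst z \<in> cell k r \<and> u < snd z}"
  have "region f \<in> sets borel" using region_closed[OF f] by auto
  moreover have "{z :: real \<times> real. fst z \<in> cell k r \<and> u < snd z} = cell k r \<times> {u<..}" by auto
  moreover have "cell k r \<times> {u<..} \<in> sets (borel :: (real \<times> real) measure)"
    by (rule borel_Times) (auto simp: cell_def)
  ultimately have "?B \<in> sets borel" by (simp only: sets.Int)
  then have [measurable]: "?B \<in> sets (lborel \<Otimes>\<^sub>M lborel)" unfolding lborel_prod by simp
  have "emeasure lborel ?B = emeasure (lborel \<Otimes>\<^sub>M lborel) ?B" by (simp add: lborel_prod)
  also have "\<dots> = (\<integral>\<^sup>+x. emeasure lborel (Pair x -` ?B) \<partial>lborel)"
    by (rule lborel.emeasure_pair_measure_alt) measurable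
  also have "\<dots> = (\<integral>\<^sup>+x. ennreal (max 0 (f x - u)) * indicator ?S x \<partial>lborel)"
  proof (rule nn_integral_cong_AE)
    show "AE x in lborel. emeasure lborel (Pair x -` ?B) = ennreal (max 0 (f x - u)) * indicator ?S x"
      using AE_lborel_singleton[of "real r / real k"]
    proof eventually_elim
      case (elim x)
      show ?case
      proof (cases "x \<in> ?S")
        case True
        then have "x \<in> cell k r" "x \<in> {0..1}" using elim cell_subset(1)[OF r] by (auto simp: cell_def)
        then have "Pair x -` ?B = {u<..f x}" using u by (auto simp: region_def)
        then show ?thesis using True by (auto simp: max_def ennreal_neg)
      next
        case False
        then have "Pair x -` ?B = {}" by (auto simp: cell_def)
        then show ?thesis using False by simp
      qed
    qed
  qed
  also have "\<dots> = ennreal (excess f k r u)"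
    unfolding excess_def
    by (intro nn_integral_has_integral_lebesgue' integrable_integral excess_integrable f r) auto
  finally show ?thesis .
qed

section \<open>Cell maxima of a uniform sample\<close>

text \<open>Inserting 0 makes the maximum nonnegative and monotone in the number of points for every
  sequence, including those leaving the region. The requirements of \<open>void_family\<close>
  therefore hold everywhere, not just almost surely; for points in the region the value is that of
  \<open>cell_max\<close>.\<close>

definition peak :: "(nat \<Rightarrow> real \<times> real) \<Rightarrow> nat \<Rightarrow> nat \<Rightarrow> nat \<Rightarrow> real" where
  "peak z m k r = Max (insert 0 {snd (z i) | i. i \<in> {1..m} \<and> fst (z i) \<in> cell k r})"

lemma peak_nonneg: "0 \<le> peak z m k r"
  unfolding peak_def by (rule Max_ge) auto

lemma peak_le_iff:
  assumes "0 \<le> u"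
  shows "peak z m k r \<le> u \<longleftrightarrow> (\<forall>i\<in>{1..m}. fst (z i) \<in> cell k r \<longrightarrow> snd (z i) \<le> u)"
  unfolding peak_def using assms by (subst Max_le_iff) (auto, blast)

lemma peak_mono: "m \<le> m' \<Longrightarrow> peak z m k r \<le> peak z m' k r"
  unfolding peak_def by (rule Max_mono) auto

lemma cell_max_eq_peak:
  assumes "\<And>i. i \<in> {1..m} \<Longrightarrow> z i \<in> region f"
  shows "cell_max z m k r = peak z m k r"
proof -
  define Ys where "Ys = {snd (z i) | i. i \<in> {1..m} \<and> fst (z i) \<in> cell k r}"
  have "finite Ys" unfolding Ys_def by simp
  moreover have "0 \<le> y" if y: "y \<in> Ys" for y
  proof -
    obtain i where "i \<in> {1..m}" "y = snd (z i)" using y unfolding Ys_def by blast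
    with assms[of i] show ?thesis by (cases "z i") (auto simp: region_def)
  qed
  ultimately have "Max (insert 0 Ys) = (if Ys = {} then 0 else Max Ys)"
    by (auto simp: Max_insert max_def Max_ge_iff not_le Max_less_iff intro: antisym)
  then show ?thesis unfolding cell_max_def peak_def Ys_def[symmetric] Let_def by simp
qed

lemma cell_times_above: "{z :: real \<times> real. fst z \<in> cell k r \<and> u < snd z} \<in> sets borel"
proof -
  have "{z :: real \<times> real. fst z \<in> cell k r \<and> u < snd z} = cell k r \<times> {u<..}" by auto
  moreover have "cell k r \<times> {u<..} \<in> sets (borel :: (real \<times> real) measure)"
    by (rule borel_Times) (auto simp: cell_def)
  ultimately show ?thesis by simp
qed

lemma cell_events:
  fixes Z :: "'a \<Rightarrow> real \<times> real"
  assumes "Z \<in> borel_measurable M"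
  shows "{\<omega> \<in> space M. fst (Z \<omega>) \<in> cell k r} \<in> sets M"
    and "{\<omega> \<in> space M. fst (Z \<omega>) \<notin> cell k r} \<in> sets M"
    and "{\<omega> \<in> space M. snd (Z \<omega>) \<le> y} \<in> sets M"
proof -
  have [measurable]: "(\<lambda>\<omega>. fst (Z \<omega>)) \<in> borel_measurable M" "(\<lambda>\<omega>. snd (Z \<omega>)) \<in> borel_measurable M"
    by (rule measurable_compose[OF assms]; intro borel_measurable_continuous_onI continuous_intros)+
  have [measurable]: "cell k r \<in> sets borel" by (simp add: cell_def)
  show "{\<omega> \<in> space M. fst (Z \<omega>) \<in> cell k r} \<in> sets M"
    "{\<omega> \<in> space M. fst (Z \<omega>) \<notin> cell k r} \<in> sets M"
    "{\<omega> \<in> space M. snd (Z \<omega>) \<le> y} \<in> sets M" by measurable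
qed

lemma peak_measurable:
  assumes "\<And>i. i \<in> {1..m} \<Longrightarrow> Z i \<in> borel_measurable M"
  shows "(\<lambda>\<omega>. peak (\<lambda>i. Z i \<omega>) m k r) \<in> borel_measurable M"
proof (rule borel_measurableI_le)
  fix y :: real
  show "{\<omega> \<in> space M. peak (\<lambda>i. Z i \<omega>) m k r \<le> y} \<in> sets M"
  proof (cases "0 \<le> y")
    case True
    have "{\<omega> \<in> space M. \<forall>i\<in>{1..m}. fst (Z i \<omega>) \<in> cell k r \<longrightarrow> snd (Z i \<omega>) \<le> y} \<in> sets M"
      by (intro sets.sets_Collect_imp sets.sets_Collect_finite_All cell_events assms finite_atLeastAtMost)
    then show ?thesis using True by (simp add: peak_le_iff)
  next
    case False
    then have "{\<omega> \<in> space M. peak (\<lambda>i. Z i \<omega>) m k r \<le> y} = {}"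
      using peak_nonneg order_trans by blast
    then show ?thesis by (simp only: sets.empty_sets)
  qed
qed

lemma cell_max_measurable:
  assumes "\<And>i. i \<in> {1..m} \<Longrightarrow> Z i \<in> borel_measurable M"
  shows "(\<lambda>\<omega>. cell_max (\<lambda>i. Z i \<omega>) m k r) \<in> borel_measurable M"
proof (rule borel_measurableI_le)
  fix y :: real
  \<comment> \<open>The second conjunct accounts for the default value 0 of an empty cell.\<close>
  have "cell_max z m k r \<le> y \<longleftrightarrow>
      (\<forall>i\<in>{1..m}. fst (z i) \<in> cell k r \<longrightarrow> snd (z i) \<le> y) \<and>
      ((\<forall>i\<in>{1..m}. fst (z i) \<notin> cell k r) \<longrightarrow> 0 \<le> y)" for z
  proof -
    define Ys where "Ys = {snd (z i) | i. i \<in> {1..m} \<and> fst (z i) \<in> cell k r}"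
    have "finite Ys" unfolding Ys_def by simp
    then have "cell_max z m k r \<le> y \<longleftrightarrow> (\<forall>u\<in>Ys. u \<le> y) \<and> (Ys = {} \<longrightarrow> 0 \<le> y)"
      unfolding cell_max_def Ys_def[symmetric] Let_def by auto
    then show ?thesis unfolding Ys_def by blast
  qed
  moreover have "{\<omega> \<in> space M. (\<forall>i\<in>{1..m}. fst (Z i \<omega>) \<in> cell k r \<longrightarrow> snd (Z i \<omega>) \<le> y) \<and>
      ((\<forall>i\<in>{1..m}. fst (Z i \<omega>) \<notin> cell k r) \<longrightarrow> 0 \<le> y)} \<in> sets M"
    by (intro sets.sets_Collect_conj sets.sets_Collect_imp sets.sets_Collect_finite_All
        sets.sets_Collect_const cell_events assms finite_atLeastAtMost)
  ultimately show "{\<omega> \<in> space M. cell_max (\<lambda>i. Z i \<omega>) m k r \<le> y} \<in> sets M" by simp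
qed

lemma kernel_estimator_measurable:
  assumes "\<And>i. 1 \<le> i \<Longrightarrow> Z i \<in> borel_measurable M"
  shows "(\<lambda>\<omega>. kernel_estimator K k h n (\<lambda>i. Z i \<omega>) x) \<in> borel_measurable M"
proof -
  have [measurable]: "(\<lambda>\<omega>. cell_max (\<lambda>i. Z i \<omega>) n (k n) r) \<in> borel_measurable M" for r
    by (rule cell_max_measurable) (use assms in auto)
  show ?thesis unfolding kernel_estimator_def by measurable
qed

locale uniform_sample = prob_space M for M :: "'a measure" +
  fixes Z :: "nat \<Rightarrow> 'a \<Rightarrow> real \<times> real" and f :: "real \<Rightarrow> real" and c :: real
  assumes f_cont: "continuous_on {0..1} f"
    and indep_Z: "indep_vars (\<lambda>_. borel) Z {1..}"
    and distr_Z: "\<And>i. 1 \<le> i \<Longrightarrow> distr M borel (Z i) = uniform_measure lborel (region f)"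
    and c_def: "1 / c = measure lborel (region f)"
begin

lemma Z_measurable: "1 \<le> i \<Longrightarrow> Z i \<in> borel_measurable M"
  using indep_Z by (auto simp: indep_vars_def)

lemma region_borel [measurable]: "region f \<in> sets borel"
  using region_closed[OF f_cont] by auto

text \<open>The uniform law has total mass area/area, which is 0 in extended arithmetic if the area
  is 0 or infinite; being the law of \<open>Z 1\<close>, it has mass 1.\<close>

lemma region_finite_pos: "emeasure lborel (region f) \<noteq> 0" "emeasure lborel (region f) \<noteq> \<infinity>"
proof -
  interpret Q: prob_space "uniform_measure lborel (region f)"
    using prob_space_distr[OF Z_measurable[of 1]] distr_Z[of 1] by simp
  have "emeasure (uniform_measure lborel (region f)) UNIV = 1"
    using Q.emeasure_space_1 by simp
  then have "emeasure lborel (region f) / emeasure lborel (region f) = 1"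
    by (subst (asm) emeasure_uniform_measure) auto
  then show "emeasure lborel (region f) \<noteq> 0" "emeasure lborel (region f) \<noteq> \<infinity>" by auto
qed

lemma c_pos: "0 < c"
proof -
  have "0 < measure lborel (region f)"
    using region_finite_pos by (simp add: measure_def enn2real_positive_iff top.not_eq_extremum zero_less_iff_neq_zero)
  then show ?thesis using c_def by (metis zero_less_divide_1_iff)
qed

lemma prob_Z:
  assumes "1 \<le> i" and [measurable]: "B \<in> sets borel"
  shows "prob {\<omega> \<in> space M. Z i \<omega> \<in> B} = c * measure lborel (region f \<inter> B)"
proof -
  have "prob {\<omega> \<in> space M. Z i \<omega> \<in> B} = measure (distr M borel (Z i)) B"
    using Z_measurable[OF assms(1)] by (subst measure_distr) (auto intro!: arg_cong[where f = prob])
  also have "\<dots> = measure lborel (region f \<inter> B) / measure lborel (region f)"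
    unfolding distr_Z[OF assms(1)] using region_finite_pos by (subst measure_uniform_measure) auto
  also have "\<dots> = c * measure lborel (region f \<inter> B)"
    unfolding c_def[symmetric] by simp
  finally show ?thesis .
qed

lemma prob_avoid:
  assumes [measurable]: "B \<in> sets borel"
  shows "prob {\<omega> \<in> space M. \<forall>i\<in>{1..m}. Z i \<omega> \<notin> B} = (1 - c * measure lborel (region f \<inter> B)) ^ m"
\<comment> \<open>The product formula for independent variables is stated for nonempty index
  sets.\<close>
proof (cases "m = 0")
  case True
  then show ?thesis by (simp add: prob_space)
next
  case False
  have "{\<omega> \<in> space M. \<forall>i\<in>{1..m}. Z i \<omega> \<notin> B} = (\<Inter>i\<in>{1..m}. Z i -` (- B) \<inter> space M)"
    using False by auto
  also have "prob \<dots> = (\<Prod>i\<in>{1..m}. prob (Z i -` (- B) \<inter> space M))"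
    by (rule indep_varsD[OF indep_Z]) (use False in auto)
  also have "\<dots> = (\<Prod>i\<in>{1..m}. 1 - c * measure lborel (region f \<inter> B))"
  proof (rule prod.cong[OF refl])
    fix i assume "i \<in> {1..m}"
    then have i: "1 \<le> i" by simp
    note [measurable] = Z_measurable[OF i]
    have "Z i -` (- B) \<inter> space M = {\<omega> \<in> space M. \<not> (Z i \<omega> \<in> B)}" by auto
    also have "prob \<dots> = 1 - prob {\<omega> \<in> space M. Z i \<omega> \<in> B}"
      by (rule prob_neg) measurable
    finally show "prob (Z i -` (- B) \<inter> space M) = 1 - c * measure lborel (region f \<inter> B)"
      using prob_Z[OF i] by simp
  qed
  finally show ?thesis by simp
qed

lemma measure_union_above:
  assumes J: "J \<subseteq> {1..k}" and u: "\<And>r. r \<in> J \<Longrightarrow> 0 \<le> u r"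
  shows "c * measure lborel (region f \<inter> (\<Union>r\<in>J. {z. fst z \<in> cell k r \<and> u r < snd z}))
    = (\<Sum>r\<in>J. c * excess f k r (u r))"
proof -
  have finJ: "finite J" using J finite_subset by blast
  define A where "A r = region f \<inter> {z. fst z \<in> cell k r \<and> u r < snd z}" for r
  have A: "emeasure lborel (A r) = ennreal (excess f k r (u r))" if "r \<in> J" for r
    unfolding A_def using that J u by (intro emeasure_region_above[OF f_cont]) auto
  have Am: "A r \<in> sets lborel" for r
    unfolding A_def using cell_times_above by simp
  have "measure lborel (\<Union>r\<in>J. A r) = (\<Sum>r\<in>J. measure lborel (A r))"
  proof (rule measure_finite_Union[OF finJ])
    show "disjoint_family_on A J"
      unfolding disjoint_family_on_def A_def using cells_disjoint by blast
  qed (use A Am in auto)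
  also have "\<dots> = (\<Sum>r\<in>J. excess f k r (u r))"
    using A excess_nonneg by (intro sum.cong) (auto simp: measure_def)
  also have "(\<Union>r\<in>J. A r) = region f \<inter> (\<Union>r\<in>J. {z. fst z \<in> cell k r \<and> u r < snd z})"
    by (auto simp: A_def)
  finally show ?thesis by (simp add: sum_distrib_left)
qed

text \<open>The factor \<open>c\<close> turns area into probability: this is the chance that a
  further point falls into the cell above the current peak.\<close>

definition void :: "nat \<Rightarrow> nat \<Rightarrow> nat \<Rightarrow> 'a \<Rightarrow> real" where
  "void k m r \<omega> = c * excess f k r (peak (\<lambda>i. Z i \<omega>) m k r)"

text \<open>Translates a threshold on the area into one on the height. Taking for \<open>u\<close>
  the largest height whose excess still reaches \<open>v\<close> gives both directions of the
  equivalence, even where the excess is constant. For \<open>v = 0\<close> there is no largest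
  height, as the excess vanishes at all heights above the graph.\<close>

lemma void_ge_iff:
  assumes r: "r \<in> {1..k}" and v: "0 < v" "v \<le> c * excess f k r 0"
  obtains u where "0 \<le> u" "c * excess f k r u = v"
    "\<And>m \<omega>. v \<le> void k m r \<omega> \<longleftrightarrow> peak (\<lambda>i. Z i \<omega>) m k r \<le> u"
proof -
  have "compact (f ` {0..1})" using f_cont by (intro compact_continuous_image) auto
  then obtain B0 where B0: "\<And>t. t \<in> {0..1} \<Longrightarrow> f t \<le> B0"
    by (meson bounded_imp_bdd_above compact_imp_bounded bdd_above.E imageI)
  define B where "B = max 0 B0"
  define G where "G u = c * excess f k r u" for u
  have G_anti: "G u' \<le> G u" if "u \<le> u'" for u u'
    unfolding G_def using c_pos excess_antimono[OF f_cont r that] by simp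
  have G_cont: "continuous_on S G" for S
    unfolding G_def by (intro continuous_intros continuous_on_subset[OF continuous_excess[OF f_cont r]]) auto
  have "excess f k r B = integral {(real r - 1) / real k .. real r / real k} (\<lambda>_. 0)"
    unfolding excess_def
  proof (rule Henstock_Kurzweil_Integration.integral_cong)
    fix t assume "t \<in> {(real r - 1) / real k .. real r / real k}"
    then have "f t \<le> B0" using cell_subset(1)[OF r] B0 by blast
    then show "max 0 (f t - B) = 0" by (simp add: B_def)
  qed
  then have GB: "G B = 0" by (simp add: G_def)
  define S where "S = {u \<in> {0..B}. v \<le> G u}"
  have "compact S"
  proof -
    have "closed S" unfolding S_def
      by (intro continuous_closed_preimage_constant continuous_on_closed_Collect_le G_cont continuous_intros)
    moreover have "bounded S" by (rule bounded_subset[of "{0..B}"]) (auto simp: S_def)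
    ultimately show ?thesis by (simp add: compact_eq_bounded_closed)
  qed
  moreover have "0 \<in> S" using v by (auto simp: S_def G_def B_def)
  ultimately obtain u where u: "u \<in> S" "\<And>y. y \<in> S \<Longrightarrow> y \<le> u"
    using compact_attains_sup[of S] by auto
  have uB: "0 \<le> u" "u \<le> B" "v \<le> G u" using u(1) by (auto simp: S_def)
  have max: "y \<le> u" if "0 \<le> y" "v \<le> G y" for y
  proof -
    have "y \<le> B" using that(2) G_anti[of B y] GB v by (cases "y \<le> B") auto
    then show ?thesis using that u(2) by (simp add: S_def)
  qed
  have "G u = v"
  proof (rule ccontr)
    assume "G u \<noteq> v"
    then have "v < G u" using uB by simp
    \<comment> \<open>If the excess at \<open>u\<close> exceeded \<open>v\<close>, a height y >= u
      would attain \<open>v\<close> exactly, and maximality would force y = u.\<close>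
    moreover have "\<exists>y\<ge>u. y \<le> B \<and> G y = v"
      by (rule IVT2') (use uB GB v G_cont in auto)
    then obtain y where y: "u \<le> y" "G y = v" by auto
    then have "y \<le> u" using uB by (intro max) auto
    with y have "G u = v" by simp
    ultimately show False by simp
  qed
  moreover have "v \<le> void k m r \<omega> \<longleftrightarrow> peak (\<lambda>i. Z i \<omega>) m k r \<le> u" for m \<omega>
    using max[OF peak_nonneg, of "\<lambda>i. Z i \<omega>" m k r] G_anti[of "peak (\<lambda>i. Z i \<omega>) m k r" u] uB
    unfolding void_def G_def by auto
  ultimately show ?thesis using that uB(1) by (simp add: G_def)
qed

text \<open>Void areas all reach their thresholds exactly when the first m points avoid a union of
  pieces of the region, one above a suitable height in each cell. The pieces are disjoint, so the
  probability of the union is the sum of the thresholds, and independence of the points gives the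
  m-th power.\<close>

lemma void_family_void: "void_family M {1..k} (\<lambda>r. c * excess f k r 0) (void k)"
proof
  show "finite {1..k}" by simp
  fix m m' r \<omega>
  assume r: "r \<in> {1..k}"
  have peak: "(\<lambda>\<omega>. peak (\<lambda>i. Z i \<omega>) m k r) \<in> borel_measurable M"
    by (rule peak_measurable) (use Z_measurable in auto)
  have "excess f k r \<in> borel_measurable borel"
    by (rule borel_measurable_continuous_onI[OF continuous_excess[OF f_cont r]])
  from measurable_compose[OF peak this] show "void k m r \<in> borel_measurable M"
    unfolding void_def by measurable
  show "0 \<le> void k m r \<omega>" using c_pos excess_nonneg by (simp add: void_def)
  show "void k m r \<omega> \<le> c * excess f k r 0"
    unfolding void_def using c_pos excess_antimono[OF f_cont r peak_nonneg] by simp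
  show "void k m' r \<omega> \<le> void k m r \<omega>" if "m \<le> m'"
    unfolding void_def using c_pos excess_antimono[OF f_cont r peak_mono[OF that]] by simp
next
  fix m J and v :: "nat \<Rightarrow> real"
  assume J: "J \<subseteq> {1..k}" and v: "\<And>r. r \<in> J \<Longrightarrow> 0 \<le> v r \<and> v r \<le> c * excess f k r 0"
  \<comment> \<open>Zero thresholds are always met and add nothing to the sum; removing them leaves
    the positive ones that \<open>void_ge_iff\<close> handles.\<close>
  define J' where "J' = {r \<in> J. 0 < v r}"
  have J': "J' \<subseteq> {1..k}" "finite J" using J finite_subset by (auto simp: J'_def)
  have "\<forall>r\<in>J'. \<exists>u\<ge>0. c * excess f k r u = v r \<and>
      (\<forall>m \<omega>. v r \<le> void k m r \<omega> \<longleftrightarrow> peak (\<lambda>i. Z i \<omega>) m k r \<le> u)"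
  proof
    fix r assume "r \<in> J'"
    then have "r \<in> {1..k}" "0 < v r" "v r \<le> c * excess f k r 0" using J v by (auto simp: J'_def)
    from void_ge_iff[OF this] show "\<exists>u\<ge>0. c * excess f k r u = v r \<and>
      (\<forall>m \<omega>. v r \<le> void k m r \<omega> \<longleftrightarrow> peak (\<lambda>i. Z i \<omega>) m k r \<le> u)" by metis
  qed
  then obtain u where u: "\<And>r. r \<in> J' \<Longrightarrow> 0 \<le> u r" "\<And>r. r \<in> J' \<Longrightarrow> c * excess f k r (u r) = v r"
    "\<And>r m \<omega>. r \<in> J' \<Longrightarrow> v r \<le> void k m r \<omega> \<longleftrightarrow> peak (\<lambda>i. Z i \<omega>) m k r \<le> u r"
    unfolding bchoice_iff by blast
  define B where "B = (\<Union>r\<in>J'. {z :: real \<times> real. fst z \<in> cell k r \<and> u r < snd z})"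
  have "B \<in> sets borel" unfolding B_def
    by (rule sets.finite_UN) (use J' cell_times_above in \<open>auto simp: J'_def\<close>)
  have ev: "(\<forall>r\<in>J. v r \<le> void k m r \<omega>) \<longleftrightarrow> (\<forall>i\<in>{1..m}. Z i \<omega> \<notin> B)" for \<omega>
  proof -
    have "0 \<le> void k m r \<omega>" for r using c_pos excess_nonneg by (simp add: void_def)
    then have "(\<forall>r\<in>J. v r \<le> void k m r \<omega>) \<longleftrightarrow> (\<forall>r\<in>J'. v r \<le> void k m r \<omega>)"
      using v by (auto simp: J'_def) (metis less_eq_real_def)
    also have "\<dots> \<longleftrightarrow> (\<forall>r\<in>J'. \<forall>i\<in>{1..m}. fst (Z i \<omega>) \<in> cell k r \<longrightarrow> snd (Z i \<omega>) \<le> u r)"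
      using u(1,3) by (simp add: peak_le_iff)
    also have "\<dots> \<longleftrightarrow> (\<forall>i\<in>{1..m}. Z i \<omega> \<notin> B)" by (auto simp: B_def not_less)
    finally show ?thesis .
  qed
  have "prob {\<omega> \<in> space M. \<forall>r\<in>J. v r \<le> void k m r \<omega>} = (1 - (\<Sum>r\<in>J'. c * excess f k r (u r))) ^ m"
    unfolding ev prob_avoid[OF \<open>B \<in> sets borel\<close>] using measure_union_above[OF J'(1) u(1)] by (simp add: B_def)
  also have "(\<Sum>r\<in>J'. c * excess f k r (u r)) = (\<Sum>r\<in>J'. v r)" using u(2) by simp
  also have "\<dots> = (\<Sum>r\<in>J. v r)"
    using J' v by (intro sum.mono_neutral_left) (force simp: J'_def)+
  finally show "prob {\<omega> \<in> space M. \<forall>r\<in>J. v r \<le> void k m r \<omega>} = (1 - (\<Sum>r\<in>J. v r)) ^ m" .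
next
  have "(\<Sum>r\<in>{1..k}. c * excess f k r 0)
      = c * measure lborel (region f \<inter> (\<Union>r\<in>{1..k}. {z. fst z \<in> cell k r \<and> 0 < snd z}))"
    by (rule measure_union_above[symmetric]) auto
  also have "\<dots> \<le> c * measure lborel (region f)"
    using c_pos region_finite_pos
    by (intro mult_left_mono measure_mono_fmeasurable)
      (auto simp: fmeasurable_def top.not_eq_extremum intro!: sets.Int sets.finite_UN cell_times_above)
  also have "\<dots> = 1" using c_pos by (simp add: c_def[symmetric])
  finally show "(\<Sum>r\<in>{1..k}. c * excess f k r 0) \<le> 1" .
qed

end

section \<open>Riemann sums of kernels\<close>

lemma cell_center_in:
  assumes "r \<in> {1..k}"
  shows "cell_center k r \<in> {(real r - 1) / real k .. real r / real k}"
proof -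
  have "(a + b) / 2 \<in> {a..b}" if "a < b" for a b :: real using that by auto
  from this[OF cell_subset(2)[OF assms]] show ?thesis unfolding cell_center_def .
qed

lemma cell_center_dist:
  assumes "t \<in> {(real r - 1) / real k .. real r / real k}"
  shows "\<bar>cell_center k r - t\<bar> \<le> 1 / real k"
proof -
  have "\<bar>(a + b) / 2 - t\<bar> \<le> b - a" if "t \<in> {a..b}" for a b :: real
  proof -
    have "a \<le> t" "t \<le> b" using that by auto
    then show ?thesis unfolding abs_le_iff by (intro conjI; simp add: field_simps)
  qed
  from this[OF assms] show ?thesis unfolding cell_center_def cell_length .
qed

lemma integral_cells:
  fixes g :: "real \<Rightarrow> real"
  assumes k: "0 < k" and g: "g integrable_on {0..1}"
  shows "integral {0..1} g = (\<Sum>r = 1..k. integral {(real r - 1) / real k .. real r / real k} g)"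
proof -
  have "integral {0..real j / real k} g = (\<Sum>r = 1..j. integral {(real r - 1) / real k .. real r / real k} g)"
    if "j \<le> k" for j
    using that
  proof (induction j)
    case (Suc j)
    have le: "0 \<le> real j / real k" "real j / real k \<le> real (Suc j) / real k" "real (Suc j) / real k \<le> 1"
      using k Suc.prems by (auto simp: divide_right_mono)
    have "integral {0..real j / real k} g + integral {real j / real k..real (Suc j) / real k} g
        = integral {0..real (Suc j) / real k} g"
      using le by (intro Henstock_Kurzweil_Integration.integral_combine integrable_subinterval_real[OF g]) auto
    then show ?case using Suc by simp
  qed simp
  from this[of k] k show ?thesis by simp
qed

text \<open>A cell that misses \<open>[lo, hi]\<close> contributes no error. Bounding the error on a cell by an integral
  over \<open>[lo - 1/k, hi + 1/k]\<close> avoids counting the other cells.\<close>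

lemma midpoint_sum_error:
  fixes G :: "real \<Rightarrow> real"
  assumes k: "0 < k" and G: "continuous_on {0..1} G"
    and e: "\<And>r t. r \<in> {1..k} \<Longrightarrow> t \<in> {(real r - 1) / real k .. real r / real k} \<Longrightarrow>
      \<bar>G t - G (cell_center k r) - d r * (t - cell_center k r)\<bar> \<le> e"
    and supp: "\<And>t. t \<in> {0..1} \<Longrightarrow> t \<notin> {lo..hi} \<Longrightarrow> G t = 0" and lohi: "lo \<le> hi"
  shows "\<bar>(\<Sum>r = 1..k. G (cell_center k r) / real k) - integral {0..1} G\<bar> \<le> e * (hi - lo + 2 / real k)"
proof -
  define S where "S r = {(real r - 1) / real k .. real r / real k}" for r
  define \<iota> where "\<iota> t = (if t \<in> {lo - 1 / real k .. hi + 1 / real k} then e else 0)" for t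
  have mid: "cell_center k r \<in> S r" if "r \<in> {1..k}" for r
    unfolding S_def by (rule cell_center_in[OF that])
  have e0: "0 \<le> e" using e[of 1 "cell_center k 1"] mid[of 1] k by (auto simp: S_def)
  have \<iota>_int: "\<iota> integrable_on {a..b}" for a b
    unfolding \<iota>_def integrable_restrict_Int by (auto simp: Int_atLeastAtMost)
  have \<iota>0: "0 \<le> \<iota> t" for t using e0 by (simp add: \<iota>_def)
  have cell: "\<bar>G (cell_center k r) / real k - integral (S r) G\<bar> \<le> integral (S r) \<iota>" if r: "r \<in> {1..k}" for r
  proof (cases "S r \<inter> {lo..hi} = {}")
    case True
    have z: "G t = 0" if "t \<in> S r" for t
      using True that supp cell_subset(1)[OF r] by (auto simp: S_def)
    have "integral (S r) G = integral (S r) (\<lambda>_. 0)"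
      by (rule Henstock_Kurzweil_Integration.integral_cong) (rule z)
    then have "integral (S r) G = 0" by simp
    moreover have "0 \<le> integral (S r) \<iota>"
      unfolding S_def by (rule Henstock_Kurzweil_Integration.integral_nonneg[OF \<iota>_int]) (rule \<iota>0)
    ultimately show ?thesis using z[OF mid[OF r]] by simp
  next
    case False
    have le: "(real r - 1) / real k \<le> real r / real k" using cell_subset(2)[OF r] by simp
    let ?m = "cell_center k r"
    have Gc: "continuous_on (S r) G" using continuous_on_subset[OF G] cell_subset(1)[OF r] by (simp add: S_def)
    \<comment> \<open>A linear function centred at the midpoint integrates to 0 over the cell,
      whatever the slope \<open>d r\<close>. Subtracting it is what lets \<open>e\<close> be of
      second order.\<close>
    have "((\<lambda>t. t) has_integral ((real r / real k)\<^sup>2 - ((real r - 1) / real k)\<^sup>2) / 2) (S r)"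
      unfolding S_def by (rule ident_has_integral[OF le])
    moreover have "((\<lambda>t. ?m) has_integral (real r / real k - (real r - 1) / real k) * ?m) (S r)"
      using has_integral_const_real[of ?m "(real r - 1) / real k" "real r / real k"] le by (simp add: S_def)
    ultimately have "((\<lambda>t. d r * (t - ?m)) has_integral d r *
        (((real r / real k)\<^sup>2 - ((real r - 1) / real k)\<^sup>2) / 2 - (real r / real k - (real r - 1) / real k) * ?m)) (S r)"
      by (intro has_integral_mult_right has_integral_diff)
    moreover have "((real r / real k)\<^sup>2 - ((real r - 1) / real k)\<^sup>2) / 2 - (real r / real k - (real r - 1) / real k) * ?m = 0"
      by (simp add: cell_center_def power2_eq_square algebra_simps)
    ultimately have lin: "((\<lambda>t. d r * (t - ?m)) has_integral 0) (S r)" by simp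
    have const: "((\<lambda>t. G ?m) has_integral G ?m / real k) (S r)"
      using has_integral_const_real[of "G ?m" "(real r - 1) / real k" "real r / real k"] le cell_length[of r k]
      by (simp add: S_def)
    have "(G has_integral integral (S r) G) (S r)"
      using Gc unfolding S_def by (intro integrable_integral integrable_continuous_interval)
    from has_integral_diff[OF has_integral_diff[OF this const] lin]
    have H: "((\<lambda>t. G t - G ?m - d r * (t - ?m)) has_integral integral (S r) G - G ?m / real k) (S r)" by simp
    have "norm (integral (S r) (\<lambda>t. G t - G ?m - d r * (t - ?m))) \<le> integral (S r) \<iota>"
    proof (rule integral_norm_bound_integral)
      show "(\<lambda>t. G t - G ?m - d r * (t - ?m)) integrable_on S r" using H by blast
      show "\<iota> integrable_on S r" unfolding S_def by (rule \<iota>_int)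
      fix t assume t: "t \<in> S r"
      obtain s where s: "s \<in> S r" "s \<in> {lo..hi}" using False by blast
      have "t \<in> {lo - 1 / real k .. hi + 1 / real k}"
        using t s cell_length[of r k] by (auto simp: S_def)
      then show "norm (G t - G ?m - d r * (t - ?m)) \<le> \<iota> t"
        using e[OF r] t by (simp add: \<iota>_def S_def)
    qed
    then show ?thesis using integral_unique[OF H] by (simp add: abs_minus_commute)
  qed
  have "\<bar>(\<Sum>r = 1..k. G (cell_center k r) / real k) - integral {0..1} G\<bar>
      = \<bar>\<Sum>r = 1..k. G (cell_center k r) / real k - integral (S r) G\<bar>"
    using integral_cells[OF k integrable_continuous_interval[OF G]] by (simp add: S_def sum_subtractf)
  also have "\<dots> \<le> (\<Sum>r = 1..k. integral (S r) \<iota>)"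
    by (rule order_trans[OF sum_abs sum_mono]) (use cell in auto)
  also have "\<dots> = integral {0..1} \<iota>"
    using integral_cells[OF k \<iota>_int] by (simp add: S_def)
  also have "\<dots> = integral ({lo - 1 / real k .. hi + 1 / real k} \<inter> {0..1}) (\<lambda>_. e)"
    unfolding \<iota>_def by (rule integral_restrict_Int)
  also have "\<dots> \<le> e * (hi - lo + 2 / real k)"
  proof -
    have "integral ({lo - 1 / real k .. hi + 1 / real k} \<inter> {0..1}) (\<lambda>_. e)
        \<le> integral {lo - 1 / real k .. hi + 1 / real k} (\<lambda>_. e)"
      by (rule integral_subset_le) (auto simp: Int_atLeastAtMost e0)
    also have "\<dots> = e * (hi - lo + 2 / real k)"
    proof -
      have "0 \<le> 2 / real k" by simp
      then have "lo \<le> 2 / real k + hi" using lohi by linarith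
      then show ?thesis by simp
    qed
    finally show ?thesis .
  qed
  finally show ?thesis .
qed

text \<open>The assumptions on \<open>x\<close> put the whole window of radius \<open>A * h\<close>
  inside the unit interval, so no mass is lost at the boundary and an affine substitution
  remains.\<close>

lemma kernel_integral:
  fixes F :: "real \<Rightarrow> real"
  assumes F: "continuous_on UNIV F" and supp: "\<And>t. t \<notin> {-A..A} \<Longrightarrow> F t = 0"
    and h: "0 < h" and x: "0 \<le> x - A * h" "x + A * h \<le> 1"
  shows "integral {0..1} (\<lambda>t. F ((x - t) / h) / h) = (\<integral>t. F t \<partial>lborel)"
proof -
  let ?G = "\<lambda>t. F ((x - t) / h) / h"
  have Gc: "continuous_on S ?G" for S
    using h by (intro continuous_intros continuous_on_compose2[OF F]) auto
  have Gs: "?G t = 0" if "t \<notin> {0..1}" for t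
  proof -
    have "t \<notin> {x - A * h .. x + A * h}" using that x by auto
    then have "(x - t) / h \<notin> {-A..A}" using h by (auto simp: field_simps)
    then show ?thesis using supp by simp
  qed
  have "integral {0..1} ?G = (LINT t:{0..1}|lborel. ?G t)"
    by (rule set_borel_integral_eq_integral(2)[symmetric]) (rule borel_integrable_atLeastAtMost'[OF Gc])
  also have "\<dots> = (\<integral>t. ?G t \<partial>lborel)"
    unfolding set_lebesgue_integral_def
    by (rule Bochner_Integration.integral_cong) (use Gs in \<open>auto simp: indicator_def\<close>)
  also have "\<dots> = (\<integral>t. F t \<partial>lborel)"
    using lborel_integral_real_affine[of "- 1 / h" F "x / h"] h
    by (simp add: diff_divide_distrib)
  finally show ?thesis .
qed

text \<open>The free slope \<open>D\<close> allows two uses: with the derivative of \<open>K\<close>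
  the error is of second order in 1/(h k), and with slope 0 the same estimate gives first order for
  the square of \<open>K\<close>.\<close>

lemma kernel_riemann_sum:
  fixes F D :: "real \<Rightarrow> real"
  assumes F: "continuous_on UNIV F" and supp: "\<And>t. t \<notin> {-A..A} \<Longrightarrow> F t = 0" and A: "0 \<le> A"
    and h: "0 < h" and k: "0 < k" and x: "0 \<le> x - A * h" "x + A * h \<le> 1"
    and e: "\<And>s s0. \<bar>s - s0\<bar> \<le> 1 / (h * real k) \<Longrightarrow> \<bar>F s - F s0 - D s0 * (s - s0)\<bar> \<le> e"
  shows "\<bar>(\<Sum>r = 1..k. F ((x - cell_center k r) / h) / h / real k) - (\<integral>t. F t \<partial>lborel)\<bar>
    \<le> e * (2 * A + 2 / (h * real k))"
proof -
  have "\<bar>(\<Sum>r = 1..k. F ((x - cell_center k r) / h) / h / real k) - integral {0..1} (\<lambda>t. F ((x - t) / h) / h)\<bar>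
     \<le> e / h * (x + A * h - (x - A * h) + 2 / real k)"
  \<comment> \<open>The slope is what the chain rule gives for t -> F((x - t)/h)/h if
    \<open>D\<close> is the derivative of \<open>F\<close>.\<close>
  proof (rule midpoint_sum_error[OF k, where d = "\<lambda>r. - D ((x - cell_center k r) / h) / h\<^sup>2"])
    show "continuous_on {0..1} (\<lambda>t. F ((x - t) / h) / h)"
      using h by (intro continuous_intros continuous_on_compose2[OF F]) auto
    show "x - A * h \<le> x + A * h" using A h by simp
    fix t
    show "F ((x - t) / h) / h = 0" if "t \<notin> {x - A * h..x + A * h}"
    proof -
      have "(x - t) / h \<notin> {-A..A}" using that h by (auto simp: field_simps)
      then show ?thesis using supp by simp
    qed
    fix r assume r: "r \<in> {1..k}" and t: "t \<in> {(real r - 1) / real k..real r / real k}"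
    let ?m = "cell_center k r"
    have "\<bar>?m - t\<bar> \<le> 1 / real k"
      using cell_center_dist[OF t] .
    moreover have diff: "(x - t) / h - (x - ?m) / h = (?m - t) / h" by (simp add: diff_divide_distrib)
    ultimately have "\<bar>(x - t) / h - (x - ?m) / h\<bar> \<le> 1 / (h * real k)"
      unfolding diff using divide_right_mono[of "\<bar>?m - t\<bar>" "1 / real k" h] h
      by (simp add: abs_divide mult.commute)
    from e[OF this] have "\<bar>F ((x - t) / h) - F ((x - ?m) / h) - D ((x - ?m) / h) * ((?m - t) / h)\<bar> / h \<le> e / h"
      using h diff by (simp add: divide_right_mono)
    moreover have "F ((x - t) / h) / h - F ((x - ?m) / h) / h - - D ((x - ?m) / h) / h\<^sup>2 * (t - ?m)
       = (F ((x - t) / h) - F ((x - ?m) / h) - D ((x - ?m) / h) * ((?m - t) / h)) / h"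
      using h by (simp add: field_simps power2_eq_square)
    ultimately show "\<bar>F ((x - t) / h) / h - F ((x - ?m) / h) / h - - D ((x - ?m) / h) / h\<^sup>2 * (t - ?m)\<bar> \<le> e / h"
      using h by (simp add: abs_divide)
  qed
  also have "e / h * (x + A * h - (x - A * h) + 2 / real k) = e * (2 * A + 2 / (h * real k))"
    using h k by (simp add: field_simps)
  finally show ?thesis using kernel_integral[OF F supp h x] by simp
qed

section \<open>Regularity of piecewise smooth kernels\<close>

text \<open>Break points may be end points of the piece. By continuity \<open>K\<close> equals its
  smooth representative there as well, and since \<open>K\<close> is differentiable, its derivative
  equals the one-sided derivative of the representative. The second derivative of the latter is
  bounded by compactness.\<close>

lemma piecewise_C2_deriv_lipschitz_piece:
  assumes ab: "a < b" and S: "{a<..<b} \<inter> S = {}"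
    and C2: "\<And>a b. a < b \<Longrightarrow> {a<..<b} \<inter> S = {} \<Longrightarrow> \<exists>g. C2_on_Icc g a b \<and> (\<forall>t\<in>{a<..<b}. K t = g t)"
    and diff: "\<And>t. K differentiable (at t)"
  shows "\<exists>C\<ge>0. \<forall>s\<in>{a..b}. \<forall>t\<in>{a..b}. \<bar>deriv K s - deriv K t\<bar> \<le> C * \<bar>s - t\<bar>"
proof -
  obtain g g' g'' where g: "\<And>t. t \<in> {a<..<b} \<Longrightarrow> K t = g t"
    "\<And>t. t \<in> {a..b} \<Longrightarrow> (g has_real_derivative g' t) (at t within {a..b})"
    "\<And>t. t \<in> {a..b} \<Longrightarrow> (g' has_real_derivative g'' t) (at t within {a..b})"
    "continuous_on {a..b} g''"
    using C2[OF ab S] unfolding C2_on_Icc_def by blast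
  have DK: "(K has_real_derivative deriv K t) (at t)" for t
    using diff DERIV_deriv_iff_real_differentiable by blast
  have Kc: "continuous_on {a..b} K"
    using DK by (meson DERIV_continuous continuous_at_imp_continuous_on)
  have gc: "continuous_on {a..b} g"
    using g(2) by (meson DERIV_continuous continuous_on_eq_continuous_within)
  have Kg: "K t = g t" if "t \<in> {a..b}" for t
  proof -
    have "K t - g t = 0"
    proof (rule continuous_constant_on_closure[where S = "{a<..<b}" and f = "\<lambda>t. K t - g t"])
      show "continuous_on (closure {a<..<b}) (\<lambda>t. K t - g t)" using ab Kc gc by (intro continuous_intros) auto
    qed (use g(1) that ab in auto)
    then show ?thesis by simp
  qed
  have Kg': "deriv K t = g' t" if "t \<in> {a..b}" for t
  proof -
    have "(K has_real_derivative deriv K t) (at t within {a..b})"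
      using DK by (rule has_field_derivative_at_within)
    moreover have "(K has_real_derivative g' t) (at t within {a..b})"
      using g(2)[OF that] unfolding has_field_derivative_def
      by (rule has_derivative_transform[OF that, rotated]) (use Kg in auto)
    ultimately show ?thesis
      unfolding has_real_derivative_iff_has_vector_derivative
      using vector_derivative_unique_within_closed_interval[of a b t K "deriv K t" "g' t"] ab that
      by (simp add: box_real)
  qed
  have "bounded (g'' ` {a..b})"
    by (intro compact_imp_bounded compact_continuous_image g(4) compact_Icc)
  then obtain C where C: "0 < C" "\<And>t. t \<in> {a..b} \<Longrightarrow> norm (g'' t) \<le> C"
    unfolding bounded_pos by blast
  have "\<bar>deriv K s - deriv K t\<bar> \<le> C * \<bar>s - t\<bar>" if "s \<in> {a..b}" "t \<in> {a..b}" for s t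
  proof -
    have "norm (g' s - g' t) \<le> C * norm (s - t)"
      by (rule field_differentiable_bound[of "{a..b}" g' g'' C]) (use g(3) C(2) that in auto)
    then show ?thesis using Kg' that by simp
  qed
  then show ?thesis using C(1) by (intro exI[of _ C]) auto
qed

text \<open>The second derivative may jump at break points, but Lipschitz bounds on adjacent
  intervals glue at the common point. Every point has a neighbourhood with no break point other than
  itself, so bisection extends the local bounds to the interval.\<close>

lemma piecewise_C2_deriv_lipschitz_on_Icc:
  assumes K: "piecewise_C2 K" and diff: "\<And>t. K differentiable (at t)" and ab: "a \<le> b"
  shows "\<exists>C\<ge>0. \<forall>s\<in>{a..b}. \<forall>t\<in>{a..b}. \<bar>deriv K s - deriv K t\<bar> \<le> C * \<bar>s - t\<bar>"
proof -
  obtain S where S: "finite S" and C2: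
    "\<And>a b. a < b \<Longrightarrow> {a<..<b} \<inter> S = {} \<Longrightarrow> \<exists>g. C2_on_Icc g a b \<and> (\<forall>t\<in>{a<..<b}. K t = g t)"
    using K unfolding piecewise_C2_def by blast
  define P where "P a b \<longleftrightarrow> (\<exists>C\<ge>0. \<forall>s\<in>{a..b}. \<forall>t\<in>{a..b}. \<bar>deriv K s - deriv K t\<bar> \<le> C * \<bar>s - t\<bar>)" for a b
  have glue: "P a c" if P: "P a b" "P b c" and le: "a \<le> b" "b \<le> c" for a b c
  proof -
    obtain C1 C2 where C: "0 \<le> C1" "0 \<le> C2"
      "\<And>s t. s \<in> {a..b} \<Longrightarrow> t \<in> {a..b} \<Longrightarrow> \<bar>deriv K s - deriv K t\<bar> \<le> C1 * \<bar>s - t\<bar>"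
      "\<And>s t. s \<in> {b..c} \<Longrightarrow> t \<in> {b..c} \<Longrightarrow> \<bar>deriv K s - deriv K t\<bar> \<le> C2 * \<bar>s - t\<bar>"
      using P unfolding P_def by blast
    define C where "C = max C1 C2"
    have 1: "\<bar>deriv K s - deriv K t\<bar> \<le> C * \<bar>s - t\<bar>" if "s \<in> {a..b}" "t \<in> {a..b}" for s t
      using C(3)[OF that] mult_right_mono[of C1 C "\<bar>s - t\<bar>"] by (simp add: C_def)
    have 2: "\<bar>deriv K s - deriv K t\<bar> \<le> C * \<bar>s - t\<bar>" if "s \<in> {b..c}" "t \<in> {b..c}" for s t
      using C(4)[OF that] mult_right_mono[of C2 C "\<bar>s - t\<bar>"] by (simp add: C_def)
    have 3: "\<bar>deriv K s - deriv K t\<bar> \<le> C * \<bar>s - t\<bar>" if "s \<in> {a..b}" "t \<in> {b..c}" for s t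
    proof -
      have "C * \<bar>s - b\<bar> + C * \<bar>b - t\<bar> = C * \<bar>s - t\<bar>"
        using that by (simp add: distrib_left[symmetric])
      then show ?thesis using 1[of s b] 2[of b t] that le by auto
    qed
    have "\<bar>deriv K s - deriv K t\<bar> \<le> C * \<bar>s - t\<bar>" if "s \<in> {a..c}" "t \<in> {a..c}" for s t
    proof -
      consider "s \<le> b" "t \<le> b" | "b \<le> s" "b \<le> t" | "s \<le> b" "b \<le> t" | "b \<le> s" "t \<le> b" by linarith
      then show ?thesis
      proof cases
        case 4
        then show ?thesis using 3[of t s] that by (simp add: abs_minus_commute)
      qed (use 1 2 3 that in auto)
    qed
    then show ?thesis unfolding P_def using C(1) by (intro exI[of _ C]) (auto simp: C_def)
  qed
  have sub: "P a' b'" if "P a b" "a \<le> a'" "b' \<le> b" for a b a' b'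
    using that unfolding P_def by (meson atLeastatMost_subset_iff subsetD)
  have "P a b"
  proof (rule Bolzano[OF ab])
    show "P a c" if "P a b" "P b c" "a \<le> b" "b \<le> c" for a b c
      using glue that by blast
    fix x :: real
    obtain d where d: "0 < d" "\<And>s. s \<in> S \<Longrightarrow> s \<noteq> x \<Longrightarrow> d \<le> dist x s"
      using finite_set_avoid[OF S, of x] by blast
    have "{x - d<..<x} \<inter> S = {}" "{x<..<x + d} \<inter> S = {}"
      using d(2) by (force simp: dist_real_def)+
    then have "P (x - d) x" "P x (x + d)"
      unfolding P_def using d(1) by (intro piecewise_C2_deriv_lipschitz_piece[OF _ _ C2 diff]; simp)+
    then have Pd: "P (x - d) (x + d)" by (rule glue) (use d(1) in auto)
    show "\<exists>d>0. \<forall>a b. a \<le> x \<and> x \<le> b \<and> b - a < d \<longrightarrow> P a b"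
    proof (intro exI[of _ d] conjI d(1) allI impI)
      fix a b assume ab: "a \<le> x \<and> x \<le> b \<and> b - a < d"
      show "P a b" by (rule sub[OF Pd]) (use ab in linarith)+
    qed
  qed
  then show ?thesis by (simp add: P_def)
qed

lemma piecewise_C2_deriv_lipschitz:
  assumes K: "piecewise_C2 K" and diff: "\<And>t. K differentiable (at t)"
    and supp: "\<And>t. t \<notin> {-A..A} \<Longrightarrow> K t = 0" and A: "0 \<le> A"
  obtains C where "0 \<le> C" "\<And>s t. \<bar>deriv K s - deriv K t\<bar> \<le> C * \<bar>s - t\<bar>"
proof -
  \<comment> \<open>The margin 1 sends, by clamping to [-B, B], every point outside to a point where
    the derivative vanishes too.\<close>
  define B where "B = A + 1"
  obtain C where C: "0 \<le> C" "\<And>s t. s \<in> {-B..B} \<Longrightarrow> t \<in> {-B..B} \<Longrightarrow> \<bar>deriv K s - deriv K t\<bar> \<le> C * \<bar>s - t\<bar>"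
    using piecewise_C2_deriv_lipschitz_on_Icc[OF K diff, of "-B" B] A by (auto simp: B_def)
  have zero: "deriv K t = 0" if "t \<notin> {-A..A}" for t
  proof -
    have "eventually (\<lambda>s. s \<in> - {-A..A}) (nhds t)"
      using that by (intro eventually_nhds_in_open) auto
    then have "eventually (\<lambda>s. K s = 0) (nhds t)"
      by eventually_elim (use supp in auto)
    then have "deriv K t = deriv (\<lambda>_. 0) t" by (rule deriv_cong_ev) simp
    then show ?thesis by simp
  qed
  define cl where "cl t = max (- B) (min B t)" for t
  have cl: "deriv K (cl t) = deriv K t" "cl t \<in> {-B..B}" for t
  proof -
    show "cl t \<in> {-B..B}" using A by (auto simp: cl_def B_def)
    show "deriv K (cl t) = deriv K t"
    proof (cases "t \<in> {-B..B}")
      case False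
      then have "t \<notin> {-A..A}" "cl t \<notin> {-A..A}" using A by (auto simp: cl_def B_def max_def min_def)
      then show ?thesis by (simp add: zero)
    qed (auto simp: cl_def)
  qed
  have "\<bar>deriv K s - deriv K t\<bar> \<le> C * \<bar>s - t\<bar>" for s t
  proof -
    have "\<bar>deriv K s - deriv K t\<bar> \<le> C * \<bar>cl s - cl t\<bar>"
      using C(2)[OF cl(2) cl(2), of s t] by (simp add: cl(1))
    also have "\<dots> \<le> C * \<bar>s - t\<bar>" using C(1) A by (intro mult_left_mono) (auto simp: cl_def B_def max_def min_def)
    finally show ?thesis .
  qed
  then show ?thesis using that C(1) by blast
qed

text \<open>Mean value inequality for u -> K u - K'(t) u, whose derivative on the segment is at most
  C |s - t|.\<close>

lemma taylor_lipschitz_deriv: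
  fixes K :: "real \<Rightarrow> real"
  assumes diff: "\<And>t. K differentiable (at t)" and C: "\<And>s t. \<bar>deriv K s - deriv K t\<bar> \<le> C * \<bar>s - t\<bar>"
    and C0: "0 \<le> C"
  shows "\<bar>K s - K t - deriv K t * (s - t)\<bar> \<le> C * (s - t)\<^sup>2"
proof -
  have DK: "(K has_real_derivative deriv K t) (at t)" for t
    using diff DERIV_deriv_iff_real_differentiable by blast
  let ?S = "closed_segment t s"
  have "norm ((K s - deriv K t * s) - (K t - deriv K t * t)) \<le> (C * \<bar>s - t\<bar>) * norm (s - t)"
  proof (rule field_differentiable_bound[where S = ?S and f' = "\<lambda>u. deriv K u - deriv K t"])
    fix u assume "u \<in> ?S"
    show "((\<lambda>u. K u - deriv K t * u) has_real_derivative deriv K u - deriv K t) (at u within ?S)"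
      by (rule has_field_derivative_at_within) (auto intro!: derivative_eq_intros DK)
    have "\<bar>u - t\<bar> \<le> \<bar>s - t\<bar>" using \<open>u \<in> ?S\<close> by (auto simp: closed_segment_eq_real_ivl split: if_splits)
    then show "norm (deriv K u - deriv K t) \<le> C * \<bar>s - t\<bar>"
      using C[of u t] C0 mult_left_mono by fastforce
  qed auto
  then show ?thesis by (simp add: power2_eq_square algebra_simps)
qed

section \<open>Linearization of the estimator\<close>

lemma cell_max_approx:
  assumes f: "continuous_on {0..1} f" and z: "\<And>i. i \<in> {1..n} \<Longrightarrow> z i \<in> region f"
    and r: "r \<in> {1..k}" and w: "\<And>t. t \<in> {(real r - 1) / real k .. real r / real k} \<Longrightarrow> \<bar>f t - m\<bar> \<le> w"
    and m: "0 \<le> m"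
  shows "\<bar>cell_max z n k r - (m - real k * excess f k r (peak z n k r))\<bar> \<le> w"
proof -
  have w0: "0 \<le> w" using w[OF cell_center_in[OF r]] by simp
  have "peak z n k r \<le> m + w"
  proof (subst peak_le_iff)
    show "\<forall>i\<in>{1..n}. fst (z i) \<in> cell k r \<longrightarrow> snd (z i) \<le> m + w"
    proof (intro ballI impI)
      fix i assume i: "i \<in> {1..n}" "fst (z i) \<in> cell k r"
      have "snd (z i) \<le> f (fst (z i))" using z[OF i(1)] by (cases "z i") (auto simp: region_def)
      moreover have "fst (z i) \<in> {(real r - 1) / real k .. real r / real k}"
        using i(2) by (simp add: cell_def)
      ultimately show "snd (z i) \<le> m + w" using w[of "fst (z i)"] by linarith
    qed
  qed (use m w0 in auto)
  moreover have "cell_max z n k r = peak z n k r" by (rule cell_max_eq_peak) (rule z)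
  ultimately show ?thesis using excess_approx[OF f r w] by simp
qed

text \<open>Serves the correction term: the sum of all maxima needs \<open>k\<close> times the area
  of the region as its leading term.\<close>

lemma sum_cell_center_approx:
  assumes f: "continuous_on {0..1} f" and k: "0 < k"
    and w: "\<And>r t. r \<in> {1..k} \<Longrightarrow> t \<in> {(real r - 1) / real k .. real r / real k} \<Longrightarrow> \<bar>f t - f (cell_center k r)\<bar> \<le> w"
  shows "\<bar>(\<Sum>r = 1..k. f (cell_center k r)) - real k * integral {0..1} f\<bar> \<le> real k * w"
proof -
  have cell: "\<bar>f (cell_center k r) - real k * integral {(real r - 1) / real k .. real r / real k} f\<bar> \<le> w"
    if r: "r \<in> {1..k}" for r
  proof -
    let ?S = "{(real r - 1) / real k .. real r / real k}"
    have le: "(real r - 1) / real k \<le> real r / real k" using cell_subset(2)[OF r] by simp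
    have fc: "continuous_on ?S f" by (rule continuous_on_subset[OF f cell_subset(1)[OF r]])
    have "integral ?S (\<lambda>t. f t - f (cell_center k r)) = integral ?S f - integral ?S (\<lambda>t. f (cell_center k r))"
      using fc by (intro Henstock_Kurzweil_Integration.integral_diff integrable_continuous_interval continuous_intros)
    also have "\<dots> = integral ?S f - f (cell_center k r) / real k"
      using le cell_length[of r k] by simp
    finally have eq: "integral ?S (\<lambda>t. f t - f (cell_center k r)) = integral ?S f - f (cell_center k r) / real k" .
    have "norm (integral ?S (\<lambda>t. f t - f (cell_center k r))) \<le> w * (real r / real k - (real r - 1) / real k)"
      by (rule integral_bound[OF le]) (use fc w[OF r] in \<open>auto intro!: continuous_intros\<close>)
    then have "\<bar>integral ?S f - f (cell_center k r) / real k\<bar> * real k \<le> w"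
      unfolding eq cell_length using k by (simp add: pos_le_divide_eq)
    also have "\<bar>integral ?S f - f (cell_center k r) / real k\<bar> * real k
        = \<bar>(integral ?S f - f (cell_center k r) / real k) * real k\<bar>"
      by (simp add: abs_mult)
    also have "(integral ?S f - f (cell_center k r) / real k) * real k = real k * integral ?S f - f (cell_center k r)"
      using k by (simp add: left_diff_distrib)
    also have "\<bar>\<dots>\<bar> = \<bar>f (cell_center k r) - real k * integral ?S f\<bar>"
      by (rule abs_minus_commute)
    finally show ?thesis .
  qed
  have "(\<Sum>r = 1..k. f (cell_center k r)) - real k * integral {0..1} f
      = (\<Sum>r = 1..k. f (cell_center k r) - real k * integral {(real r - 1) / real k .. real r / real k} f)"
    using integral_cells[OF k integrable_continuous_interval[OF f]] by (simp add: sum_subtractf sum_distrib_left)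
  also have "\<bar>\<dots>\<bar> \<le> (\<Sum>r = 1..k. w)"
    by (rule order_trans[OF sum_abs sum_mono]) (use cell in auto)
  finally show ?thesis by simp
qed

text \<open>The correction term adds the same amount \<open>b\<close> to every kernel weight, so the
  estimator is one weighted sum of maxima. The three errors are the oscillation of \<open>f\<close>
  on the kernel window, the defect of the kernel weights from total 1, and the oscillation of
  \<open>f\<close> on single cells.\<close>

lemma kernel_estimator_approx:
  fixes f K :: "real \<Rightarrow> real" and h :: "nat \<Rightarrow> real" and k :: "nat \<Rightarrow> nat" and x :: real
  defines "a r n \<equiv> scaled_kernel K (h n) (x - cell_center (k n) r) / real (k n)"
  assumes f: "continuous_on {0..1} f" and f0: "\<And>t. t \<in> {0..1} \<Longrightarrow> 0 \<le> f t"
    and c: "1 / c = integral {0..1} f" "0 < c"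
    and L: "0 \<le> L" "\<And>s t. s \<in> {0..1} \<Longrightarrow> t \<in> {0..1} \<Longrightarrow> \<bar>f s - f t\<bar> \<le> L * \<bar>s - t\<bar> powr \<alpha>"
    and \<alpha>: "0 < \<alpha>" and x: "x \<in> {0..1}"
    and K: "\<And>t. 0 \<le> K t" "\<And>t. t \<notin> {-A..A} \<Longrightarrow> K t = 0"
    and kn: "0 < k n" "k n < n" and hn: "0 < h n"
    and z: "\<And>i. i \<in> {1..n} \<Longrightarrow> z i \<in> region f"
    and A1: "A1 = (\<Sum>r = 1..k n. a r n)" and b: "b = A1 / (real n - real (k n))"
  shows "\<bar>kernel_estimator K k h n z x - f x -
      (\<Sum>r = 1..k n. (a r n + b) * (real (k n) / (c * real n)) *
         (1 - real n * (c * excess f (k n) r (peak z n (k n) r))))\<bar>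
    \<le> A1 * (L * (A * h n) powr \<alpha>) + f x * \<bar>A1 - 1\<bar>
      + A1 * (L * (1 / real (k n)) powr \<alpha>) * ((real n + real (k n)) / (real n - real (k n)))"
proof -
  define w where "w = L * (1 / real (k n)) powr \<alpha>"
  define N where "N = real n"
  define \<kappa> where "\<kappa> = real (k n)"
  define U where "U r = cell_max z n (k n) r" for r
  define E where "E r = excess f (k n) r (peak z n (k n) r)" for r
  define m where "m r = f (cell_center (k n) r)" for r
  define e where "e r = U r - (m r - \<kappa> * E r)" for r
  have pos: "0 < N" "0 < \<kappa>" "\<kappa> < N" using kn by (auto simp: N_def \<kappa>_def)
  have a0: "0 \<le> a r n" for r using K(1) hn by (simp add: a_def scaled_kernel_def)
  have A10: "0 \<le> A1" unfolding A1 using a0 by (intro sum_nonneg) auto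
  have b0: "0 \<le> b" unfolding b using A10 kn by simp
  have w0: "0 \<le> w" using L by (simp add: w_def)
  have center: "cell_center (k n) r \<in> {0..1}" if "r \<in> {1..k n}" for r
    using cell_center_in[OF that] cell_subset(1)[OF that] by blast
  have cellw: "\<bar>f t - f (cell_center (k n) r)\<bar> \<le> w"
    if r: "r \<in> {1..k n}" and t: "t \<in> {(real r - 1) / real (k n) .. real r / real (k n)}" for r t
  proof -
    have "\<bar>f t - f (cell_center (k n) r)\<bar> \<le> L * \<bar>t - cell_center (k n) r\<bar> powr \<alpha>"
      using L(2) t cell_subset(1)[OF r] center[OF r] by blast
    also have "\<dots> \<le> w"
      unfolding w_def using L(1) \<alpha> cell_center_dist[OF t]
      by (intro mult_left_mono powr_mono2) (auto simp: abs_minus_commute)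
    finally show ?thesis .
  qed
  have e: "\<bar>e r\<bar> \<le> w" if r: "r \<in> {1..k n}" for r
    unfolding e_def U_def m_def E_def \<kappa>_def
    by (rule cell_max_approx[OF f z r cellw[OF r]]) (use center[OF r] f0 in auto)
  have sum_ab: "(\<Sum>r = 1..k n. a r n + b) = A1 * N / (N - \<kappa>)"
  proof -
    have "(\<Sum>r = 1..k n. a r n + b) = A1 + \<kappa> * b" by (simp add: sum.distrib A1 \<kappa>_def)
    also have "\<dots> = A1 * N / (N - \<kappa>)" using pos by (simp add: b N_def \<kappa>_def field_simps)
    finally show ?thesis .
  qed
  have est: "kernel_estimator K k h n z x = (\<Sum>r = 1..k n. (a r n + b) * U r)"
  proof -
    have "kernel_estimator K k h n z x
        = (\<Sum>r = 1..k n. a r n * (U r + 1 / (N - \<kappa>) * (\<Sum>s = 1..k n. U s)))"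
      unfolding kernel_estimator_def a_def U_def N_def \<kappa>_def by (simp add: sum_distrib_left)
    also have "\<dots> = (\<Sum>r = 1..k n. a r n * U r) + A1 * (1 / (N - \<kappa>) * (\<Sum>s = 1..k n. U s))"
      unfolding A1 by (simp add: distrib_left sum.distrib sum_distrib_right sum_divide_distrib)
    also have "A1 * (1 / (N - \<kappa>) * (\<Sum>s = 1..k n. U s)) = (\<Sum>s = 1..k n. b * U s)"
      by (simp add: b N_def \<kappa>_def sum_distrib_left)
    finally show ?thesis by (simp add: distrib_right sum.distrib)
  qed
  \<comment> \<open>The centring 1 contributes the total weight \<open>A1 N/(N - \<kappa>)\<close>
    times \<open>\<kappa>/(c N)\<close>, which is exactly \<open>b * (\<kappa> * (1 / c))\<close>,
    the mean level of the correction term. No bias of order k/n remains.\<close>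
  have id: "kernel_estimator K k h n z x - f x
      - (\<Sum>r = 1..k n. (a r n + b) * (\<kappa> / (c * N)) * (1 - N * (c * E r)))
    = (\<Sum>r = 1..k n. (a r n + b) * e r) + (\<Sum>r = 1..k n. a r n * (m r - f x)) + f x * (A1 - 1)
      + b * ((\<Sum>r = 1..k n. m r) - \<kappa> * (1 / c))"
  proof -
    have "(a r n + b) * (\<kappa> / (c * N)) * (1 - N * (c * E r))
        = (a r n + b) * (\<kappa> / (c * N)) - (a r n + b) * (\<kappa> * E r)" for r
      using pos c(2) by (simp add: field_simps)
    then have "(\<Sum>r = 1..k n. (a r n + b) * (\<kappa> / (c * N)) * (1 - N * (c * E r)))
        = A1 * N / (N - \<kappa>) * (\<kappa> / (c * N)) - (\<Sum>r = 1..k n. (a r n + b) * (\<kappa> * E r))"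
      by (simp only: sum_subtractf sum_distrib_right[symmetric] sum_ab)
    also have "A1 * N / (N - \<kappa>) * (\<kappa> / (c * N)) = b * (\<kappa> * (1 / c))"
      using pos by (simp add: b N_def \<kappa>_def)
    finally have 1: "(\<Sum>r = 1..k n. (a r n + b) * (\<kappa> / (c * N)) * (1 - N * (c * E r)))
        = b * (\<kappa> * (1 / c)) - (\<Sum>r = 1..k n. (a r n + b) * (\<kappa> * E r))" .
    have "(\<Sum>r = 1..k n. (a r n + b) * e r) = (\<Sum>r = 1..k n. (a r n + b) * U r)
        - (\<Sum>r = 1..k n. (a r n + b) * m r) + (\<Sum>r = 1..k n. (a r n + b) * (\<kappa> * E r))"
      unfolding e_def by (simp add: algebra_simps sum.distrib sum_subtractf)
    moreover have "(\<Sum>r = 1..k n. (a r n + b) * m r) = (\<Sum>r = 1..k n. a r n * m r) + b * (\<Sum>r = 1..k n. m r)"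
      by (simp add: distrib_right sum.distrib sum_distrib_left)
    moreover have "(\<Sum>r = 1..k n. a r n * (m r - f x)) = (\<Sum>r = 1..k n. a r n * m r) - A1 * f x"
      by (simp add: right_diff_distrib sum_subtractf A1 sum_distrib_right)
    ultimately show ?thesis unfolding 1 est by (simp add: algebra_simps)
  qed
  have b1: "\<bar>\<Sum>r = 1..k n. (a r n + b) * e r\<bar> \<le> A1 * N / (N - \<kappa>) * w"
  proof -
    have "\<bar>\<Sum>r = 1..k n. (a r n + b) * e r\<bar> \<le> (\<Sum>r = 1..k n. (a r n + b) * w)"
      by (rule order_trans[OF sum_abs sum_mono])
        (use e a0 b0 in \<open>auto simp: abs_mult intro!: mult_mono\<close>)
    also have "\<dots> = A1 * N / (N - \<kappa>) * w" by (simp only: sum_distrib_right[symmetric] sum_ab)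
    finally show ?thesis .
  qed
  have b2: "\<bar>\<Sum>r = 1..k n. a r n * (m r - f x)\<bar> \<le> A1 * (L * (A * h n) powr \<alpha>)"
  proof -
    have "\<bar>\<Sum>r = 1..k n. a r n * (m r - f x)\<bar> \<le> (\<Sum>r = 1..k n. a r n * (L * (A * h n) powr \<alpha>))"
    proof (rule order_trans[OF sum_abs sum_mono])
      fix r assume r: "r \<in> {1..k n}"
      show "\<bar>a r n * (m r - f x)\<bar> \<le> a r n * (L * (A * h n) powr \<alpha>)"
      proof (cases "a r n = 0")
        case False
        \<comment> \<open>A nonzero weight forces the centre into the kernel window, so only the
          oscillation of \<open>f\<close> over distance \<open>A * h n\<close> matters.\<close>
        then have "(x - cell_center (k n) r) / h n \<in> {-A..A}"
          using K(2) unfolding a_def scaled_kernel_def by fastforce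
        then have "\<bar>cell_center (k n) r - x\<bar> \<le> A * h n" using hn by (auto simp: field_simps abs_le_iff)
        then have "L * \<bar>cell_center (k n) r - x\<bar> powr \<alpha> \<le> L * (A * h n) powr \<alpha>"
          using L(1) \<alpha> by (intro mult_left_mono powr_mono2) auto
        then have "\<bar>m r - f x\<bar> \<le> L * (A * h n) powr \<alpha>"
          using L(2)[OF center[OF r] x] by (simp add: m_def)
        then show ?thesis using a0 by (simp add: abs_mult mult_left_mono)
      qed simp
    qed
    also have "\<dots> = A1 * (L * (A * h n) powr \<alpha>)" by (simp add: A1 sum_distrib_right)
    finally show ?thesis .
  qed
  have b3: "\<bar>f x * (A1 - 1)\<bar> \<le> f x * \<bar>A1 - 1\<bar>" using f0[OF x] by (simp add: abs_mult)
  have b4: "\<bar>b * ((\<Sum>r = 1..k n. m r) - \<kappa> * (1 / c))\<bar> \<le> b * (\<kappa> * w)"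
    unfolding abs_mult abs_of_nonneg[OF b0] c(1) m_def \<kappa>_def
    by (intro mult_left_mono b0 sum_cell_center_approx f kn(1) cellw)
  have "\<bar>kernel_estimator K k h n z x - f x
      - (\<Sum>r = 1..k n. (a r n + b) * (\<kappa> / (c * N)) * (1 - N * (c * E r)))\<bar>
    \<le> A1 * N / (N - \<kappa>) * w + A1 * (L * (A * h n) powr \<alpha>) + f x * \<bar>A1 - 1\<bar> + b * (\<kappa> * w)"
    unfolding id using b1 b2 b3 b4 by linarith
  \<comment> \<open>The cell oscillation \<open>w\<close> enters twice: with factor N/(N - \<kappa>)
    through the maxima and \<kappa>/(N - \<kappa>) through the correction term.\<close>
  also have "\<dots> = A1 * (L * (A * h n) powr \<alpha>) + f x * \<bar>A1 - 1\<bar> + A1 * w * ((N + \<kappa>) / (N - \<kappa>))"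
    by (simp add: b N_def \<kappa>_def add_divide_distrib algebra_simps)
  finally show ?thesis unfolding E_def N_def \<kappa>_def w_def .
qed

section \<open>Kernel weights\<close>

lemma char_normal_density:
  assumes \<sigma>: "0 < \<sigma>"
  shows "char (density lborel (normal_density 0 \<sigma>)) t = exp (- (\<sigma> * t)\<^sup>2 / 2)"
proof -
  let ?N = "density lborel (normal_density 0 \<sigma>)"
  interpret N: prob_space ?N using \<sigma> by (rule prob_space_normal_density)
  have "distributed ?N lborel (\<lambda>x. x) (normal_density 0 \<sigma>)"
    unfolding distributed_def by (auto intro!: distr_id2)
  then have "distributed ?N lborel (\<lambda>x. (x - 0) / \<sigma>) std_normal_density"
    using N.normal_standard_normal_convert[OF \<sigma>, of "\<lambda>x. x" 0] by simp
  then have "distributed ?N lborel (\<lambda>x. x / \<sigma>) std_normal_density" by simp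
  then have d: "distr ?N lborel (\<lambda>x. x / \<sigma>) = std_normal_distribution"
    unfolding distributed_def by simp
  have "char ?N t = (CLINT x | ?N. iexp ((\<sigma> * t) * (x / \<sigma>)))"
    unfolding char_def using \<sigma> by (intro Bochner_Integration.integral_cong) auto
  also have "\<dots> = (CLINT y | distr ?N lborel (\<lambda>x. x / \<sigma>). iexp ((\<sigma> * t) * y))"
    by (rule integral_distr[symmetric]) auto
  also have "\<dots> = char std_normal_distribution (\<sigma> * t)" unfolding d char_def ..
  finally show ?thesis by (simp add: char_std_normal_distribution)
qed

lemma kernel_support:
  assumes "closure {t. K t \<noteq> 0} \<subseteq> {-A..A}" "t \<notin> {-A..A}"
  shows "K t = (0 :: real)"
  using assms closure_subset[of "{t. K t \<noteq> 0}"] by blast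

lemma kernel_support_radius_nonneg:
  fixes K :: "real \<Rightarrow> real"
  assumes "\<And>t. t \<notin> {-A..A} \<Longrightarrow> K t = 0" "has_bochner_integral lborel K 1"
  shows "0 \<le> A"
proof (rule ccontr)
  assume "\<not> 0 \<le> A"
  then have "K = (\<lambda>_. 0)" using assms(1) by fastforce
  then show False using assms(2) by (auto simp: has_bochner_integral_iff)
qed

text \<open>A vanishing norm would make \<open>K\<close> zero almost everywhere, against its
  integral 1. Positivity makes the limit law nondegenerate, so that it has a density.\<close>

lemma kernel_L2_norm_pos:
  fixes K :: "real \<Rightarrow> real"
  assumes K: "\<And>t. 0 \<le> K t" "has_bochner_integral lborel K 1" "\<And>t. K t \<le> B"
  shows "0 < L2_norm K" "(L2_norm K)\<^sup>2 = (\<integral>t. (K t)\<^sup>2 \<partial>lborel)"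
proof -
  have int: "integrable lborel K" and I1: "integral\<^sup>L lborel K = 1"
    using K(2) by (auto simp: has_bochner_integral_iff)
  have "(K t)\<^sup>2 \<le> B * K t" for t using K(1)[of t] K(3)[of t] by (simp add: power2_eq_square mult_right_mono)
  then have int2: "integrable lborel (\<lambda>t. (K t)\<^sup>2)"
    using int by (intro Bochner_Integration.integrable_bound[OF integrable_mult_right[OF int, of B]])
      (auto intro!: AE_I2 simp: order_trans[OF _ abs_ge_self])
  have nn: "0 \<le> (\<integral>t. (K t)\<^sup>2 \<partial>lborel)" by (rule integral_nonneg_AE) simp
  moreover have "(\<integral>t. (K t)\<^sup>2 \<partial>lborel) \<noteq> 0"
  proof
    assume "(\<integral>t. (K t)\<^sup>2 \<partial>lborel) = 0"
    then have "AE t in lborel. (K t)\<^sup>2 = 0"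
      using int2 by (subst (asm) integral_nonneg_eq_0_iff_AE) auto
    then have ae: "AE t in lborel. K t = 0" by simp
    have "integral\<^sup>L lborel K = integral\<^sup>L lborel (\<lambda>_ :: real. 0)"
      by (rule Bochner_Integration.integral_cong_AE) (use int ae in auto)
    then show False using I1 by simp
  qed
  ultimately have "0 < (\<integral>t. (K t)\<^sup>2 \<partial>lborel)" by (metis less_eq_real_def)
  with nn show "0 < L2_norm K" "(L2_norm K)\<^sup>2 = (\<integral>t. (K t)\<^sup>2 \<partial>lborel)"
    unfolding L2_norm_def by simp_all
qed

text \<open>The precision differs on purpose: the total weight affects the bias, which is magnified
  by the normalization, while the sum of squares only fixes the limiting variance.\<close>

lemma kernel_weights:
  fixes K :: "real \<Rightarrow> real" and h :: "nat \<Rightarrow> real" and k :: "nat \<Rightarrow> nat" and x :: real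
  defines "a \<equiv> \<lambda>n r. scaled_kernel K (h n) (x - cell_center (k n) r) / real (k n)"
  assumes supp: "\<And>t. t \<notin> {-A..A} \<Longrightarrow> K t = 0" and int: "has_bochner_integral lborel K 1"
    and B: "\<And>t. \<bar>K t\<bar> \<le> B" and B': "\<And>t. \<bar>deriv K t\<bar> \<le> B'"
    and diff: "\<And>t. K differentiable (at t)" and C2: "piecewise_C2 K"
    and h: "\<forall>\<^sub>F n in sequentially. 0 < h n" "h \<longlonglongrightarrow> 0" and k: "\<forall>\<^sub>F n in sequentially. 0 < k n"
    and hk: "filterlim (\<lambda>n. h n * real (k n)) at_top sequentially"
    and x: "0 < x" "x < 1"
  obtains C where "\<forall>\<^sub>F n in sequentially. \<bar>(\<Sum>r = 1..k n. a n r) - 1\<bar> \<le> C / (h n * real (k n))\<^sup>2"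
    and "(\<lambda>n. h n * real (k n) * (\<Sum>r = 1..k n. (a n r)\<^sup>2)) \<longlonglongrightarrow> (\<integral>t. (K t)\<^sup>2 \<partial>lborel)"
proof -
  have A: "0 \<le> A" by (rule kernel_support_radius_nonneg[OF supp int])
  have DK: "(K has_real_derivative deriv K t) (at t)" for t
    using diff DERIV_deriv_iff_real_differentiable by blast
  have Kc: "continuous_on UNIV K"
    using DK by (meson DERIV_continuous continuous_at_imp_continuous_on)
  obtain C where C: "0 \<le> C" "\<And>s t. \<bar>deriv K s - deriv K t\<bar> \<le> C * \<bar>s - t\<bar>"
    using piecewise_C2_deriv_lipschitz[OF C2 diff supp A] by metis
  have B0: "0 \<le> B" "0 \<le> B'" using B[of 0] B'[of 0] by auto
  have lip: "\<bar>K s - K t\<bar> \<le> B' * \<bar>s - t\<bar>" for s t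
    using field_differentiable_bound[of UNIV K "deriv K" B' s t] DK B' by simp
  have lip2: "\<bar>(K s)\<^sup>2 - (K t)\<^sup>2\<bar> \<le> 2 * B * B' * \<bar>s - t\<bar>" for s t
  proof -
    have "\<bar>(K s)\<^sup>2 - (K t)\<^sup>2\<bar> = \<bar>K s + K t\<bar> * \<bar>K s - K t\<bar>"
      by (simp add: abs_mult[symmetric] power2_eq_square algebra_simps)
    also have "\<dots> \<le> (2 * B) * (B' * \<bar>s - t\<bar>)"
      using B[of s] B[of t] by (intro mult_mono lip) auto
    finally show ?thesis by simp
  qed
  have Ah: "(\<lambda>n. A * h n) \<longlonglongrightarrow> 0" using tendsto_mult_right_zero[OF h(2)] .
  \<comment> \<open>An interior \<open>x\<close> eventually has its whole window in the unit
    interval. The bound 1 <= h k makes 2/(h k) at most 2, whence the factor \<open>2 * A + 2\<close>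
    below.\<close>
  have ev: "\<forall>\<^sub>F n in sequentially. 0 < h n \<and> 0 < k n \<and> 1 \<le> h n * real (k n) \<and> A * h n < min x (1 - x)"
    using h(1) k hk[unfolded filterlim_at_top, rule_format, of 1] order_tendstoD(2)[OF Ah, of "min x (1 - x)"] x
    by (auto simp: eventually_conj_iff)
  have 1: "\<forall>\<^sub>F n in sequentially. \<bar>(\<Sum>r = 1..k n. a n r) - 1\<bar> \<le> (C * (2 * A + 2)) / (h n * real (k n))\<^sup>2"
    using ev
  proof eventually_elim
    case (elim n)
    define s where "s = h n * real (k n)"
    have s: "1 \<le> s" using elim by (simp add: s_def)
    have "\<bar>(\<Sum>r = 1..k n. K ((x - cell_center (k n) r) / h n) / h n / real (k n)) - (\<integral>t. K t \<partial>lborel)\<bar>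
        \<le> C * (1 / s)\<^sup>2 * (2 * A + 2 / (h n * real (k n)))"
    proof (rule kernel_riemann_sum[OF Kc supp A, where D = "deriv K"])
      fix u v :: real assume "\<bar>u - v\<bar> \<le> 1 / (h n * real (k n))"
      then have "\<bar>u - v\<bar>\<^sup>2 \<le> (1 / s)\<^sup>2" unfolding s_def by (intro power_mono) auto
      then have "C * (u - v)\<^sup>2 \<le> C * (1 / s)\<^sup>2" using C(1) by (intro mult_left_mono) auto
      with taylor_lipschitz_deriv[OF diff C(2) C(1), of u v]
      show "\<bar>K u - K v - deriv K v * (u - v)\<bar> \<le> C * (1 / s)\<^sup>2" by linarith
    qed (use elim in auto)
    also have "\<dots> \<le> C * (1 / s)\<^sup>2 * (2 * A + 2)"
      using C(1) s by (intro mult_left_mono) (auto simp: s_def[symmetric] divide_le_eq)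
    finally show ?case using int
      by (simp add: a_def scaled_kernel_def s_def has_bochner_integral_iff power_divide mult.commute)
  qed
  have "\<forall>\<^sub>F n in sequentially. norm (h n * real (k n) * (\<Sum>r = 1..k n. (a n r)\<^sup>2) - (\<integral>t. (K t)\<^sup>2 \<partial>lborel))
      \<le> 2 * B * B' * (2 * A + 2) / (h n * real (k n))"
    using ev
  proof eventually_elim
    case (elim n)
    define s where "s = h n * real (k n)"
    have s: "1 \<le> s" using elim by (simp add: s_def)
    have "\<bar>(\<Sum>r = 1..k n. (K ((x - cell_center (k n) r) / h n))\<^sup>2 / h n / real (k n)) - (\<integral>t. (K t)\<^sup>2 \<partial>lborel)\<bar>
        \<le> 2 * B * B' * (1 / s) * (2 * A + 2 / (h n * real (k n)))"
    proof (rule kernel_riemann_sum[where D = "\<lambda>_. 0"])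
      show "continuous_on UNIV (\<lambda>t. (K t)\<^sup>2)" by (intro continuous_intros Kc)
      fix u v :: real assume "\<bar>u - v\<bar> \<le> 1 / (h n * real (k n))"
      then have "2 * B * B' * \<bar>u - v\<bar> \<le> 2 * B * B' * (1 / s)"
        using B0 unfolding s_def by (intro mult_left_mono) auto
      with lip2[of u v] show "\<bar>(K u)\<^sup>2 - (K v)\<^sup>2 - 0 * (u - v)\<bar> \<le> 2 * B * B' * (1 / s)" by linarith
    qed (use elim supp A in auto)
    also have "\<dots> \<le> 2 * B * B' * (1 / s) * (2 * A + 2)"
      using B0 s by (intro mult_left_mono) (auto simp: s_def[symmetric] divide_le_eq)
    also have "(\<Sum>r = 1..k n. (K ((x - cell_center (k n) r) / h n))\<^sup>2 / h n / real (k n))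
        = h n * real (k n) * (\<Sum>r = 1..k n. (a n r)\<^sup>2)"
      unfolding sum_distrib_left
      using elim by (intro sum.cong) (auto simp: a_def scaled_kernel_def power2_eq_square)
    finally show ?case by (simp add: s_def)
  qed
  moreover have "(\<lambda>n. 2 * B * B' * (2 * A + 2) / (h n * real (k n))) \<longlonglongrightarrow> 0"
    by (rule tendsto_divide_0[OF tendsto_const filterlim_at_top_imp_at_infinity[OF hk]])
  ultimately have "(\<lambda>n. h n * real (k n) * (\<Sum>r = 1..k n. (a n r)\<^sup>2) - (\<integral>t. (K t)\<^sup>2 \<partial>lborel)) \<longlonglongrightarrow> 0"
    by (rule Lim_null_comparison)
  from that[OF 1 LIM_zero_cancel[OF this]] show ?thesis .
qed

lemma (in uniform_sample) AE_sample_in_region: "AE \<omega> in M. \<forall>i\<in>{1..}. Z i \<omega> \<in> region f"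
proof (rule AE_ball_countable[THEN iffD2])
  show "\<forall>i\<in>{1..}. AE \<omega> in M. Z i \<omega> \<in> region f"
  proof
    fix i :: nat assume "i \<in> {1..}"
    then have i: "1 \<le> i" by simp
    note [measurable] = Z_measurable[OF i]
    have "prob {\<omega> \<in> space M. Z i \<omega> \<in> region f} = c * (1 / c)"
      using prob_Z[OF i region_borel] by (simp add: c_def)
    also have "\<dots> = 1" using c_pos by simp
    finally show "AE \<omega> in M. Z i \<omega> \<in> region f"
      by (subst (asm) prob_Collect_eq_1) auto
  qed
qed simp

section \<open>Asymptotic normality\<close>

text \<open>A positive minimum \<open>m\<close> of \<open>f\<close> makes all truncation levels at
  least \<open>c m n / k\<close> simultaneously.\<close>

lemma excess_zero_ge:
  assumes f: "continuous_on {0..1} f" and r: "r \<in> {1..k}" and m: "\<And>t. t \<in> {0..1} \<Longrightarrow> m \<le> f t"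
  shows "m / real k \<le> excess f k r 0"
proof -
  let ?S = "{(real r - 1) / real k .. real r / real k}"
  have "integral ?S (\<lambda>_. m) \<le> excess f k r 0"
    unfolding excess_def
  proof (rule integral_le)
    show "(\<lambda>t. max 0 (f t - 0)) integrable_on ?S" by (rule excess_integrable[OF f r])
    fix t assume "t \<in> ?S"
    then show "m \<le> max 0 (f t - 0)" using m cell_subset(1)[OF r] by fastforce
  qed auto
  moreover have "integral ?S (\<lambda>_. m) = m / real k"
    using cell_subset(2)[OF r] cell_length[of r k] by simp
  ultimately show ?thesis by simp
qed

lemma (in uniform_sample) inverse_c_eq_integral:
  assumes "\<And>t. t \<in> {0..1} \<Longrightarrow> 0 \<le> f t"
  shows "1 / c = integral {0..1} f"
proof -
  have "1 / c = (LBINT x:{0..1}. f x)"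
    using c_def measure_region[OF f_cont assms] by simp
  also have "\<dots> = integral {0..1} f"
    by (rule set_borel_integral_eq_integral(2)[OF borel_integrable_atLeastAtMost'[OF f_cont]])
  finally show ?thesis .
qed

text \<open>Nonasymptotic form of the result. The argument \<open>t\<close> is absorbed into the
  weights, so the bound for weighted void areas applies directly. The summands are, in order, the
  linearization, Poissonization, truncation and Lyapunov errors.\<close>

lemma (in uniform_sample) char_estimator_bound:
  fixes K :: "real \<Rightarrow> real" and h :: "nat \<Rightarrow> real" and k :: "nat \<Rightarrow> nat" and x \<tau> t :: real
  defines "a \<equiv> \<lambda>n r. scaled_kernel K (h n) (x - cell_center (k n) r) / real (k n)"
  assumes f0: "\<And>t. t \<in> {0..1} \<Longrightarrow> m \<le> f t" "0 \<le> m"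
    and L: "0 \<le> L" "\<And>s t. s \<in> {0..1} \<Longrightarrow> t \<in> {0..1} \<Longrightarrow> \<bar>f s - f t\<bar> \<le> L * \<bar>s - t\<bar> powr \<alpha>"
    and \<alpha>: "0 < \<alpha>" and x: "x \<in> {0..1}"
    and K: "\<And>t. 0 \<le> K t" "\<And>t. t \<notin> {-A..A} \<Longrightarrow> K t = 0"
    and kn: "0 < k n" "k n < n" and hn: "0 < h n"
    and A1: "A1 = (\<Sum>r = 1..k n. a n r)" and b: "b = A1 / (real n - real (k n))"
    and \<tau>: "0 \<le> \<tau>" and \<rho>: "\<And>r. \<rho> r = \<tau> * (real (k n) / (c * real n)) * (a n r + b)"
  shows "cmod (expectation (\<lambda>\<omega>. iexp (t * (\<tau> * (kernel_estimator K k h n (\<lambda>i. Z i \<omega>) x - f x))))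
      - exp (- (t\<^sup>2 * (\<Sum>r = 1..k n. (\<rho> r)\<^sup>2)) / 2))
    \<le> \<bar>t\<bar> * (\<tau> * (A1 * (L * (A * h n) powr \<alpha>) + f x * \<bar>A1 - 1\<bar>
        + A1 * (L * (1 / real (k n)) powr \<alpha>) * ((real n + real (k n)) / (real n - real (k n)))))
      + \<bar>t\<bar> * (\<Sum>r = 1..k n. \<bar>\<rho> r\<bar>) * (2 / sqrt (real n))
      + (2 * (real (k n) * exp (- real n * (c * m / real (k n)))) + 4 * \<bar>t\<bar> ^ 3 * (\<Sum>r = 1..k n. \<bar>\<rho> r\<bar> ^ 3))"
proof -
  interpret V: void_family M "{1..k n}" "\<lambda>r. c * excess f (k n) r 0" "void (k n)"
    by (rule void_family_void)
  define \<delta> where "\<delta> = A1 * (L * (A * h n) powr \<alpha>) + f x * \<bar>A1 - 1\<bar>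
        + A1 * (L * (1 / real (k n)) powr \<alpha>) * ((real n + real (k n)) / (real n - real (k n)))"
  define X where "X \<omega> = kernel_estimator K k h n (\<lambda>i. Z i \<omega>) x - f x" for \<omega>
  define \<rho>' where "\<rho>' r = t * \<rho> r" for r
  have n: "0 < n" using kn by simp
  have f0': "0 \<le> f s" if "s \<in> {0..1}" for s using f0 that by (meson order_trans)
  have Xm [measurable]: "X \<in> borel_measurable M"
    unfolding X_def using kernel_estimator_measurable[OF Z_measurable] by measurable
  have "AE \<omega> in M. \<bar>t * (\<tau> * X \<omega>) - V.wsum \<rho>' n n \<omega>\<bar> \<le> \<bar>t\<bar> * (\<tau> * \<delta>)"
    using AE_sample_in_region
  proof eventually_elim
    case (elim \<omega>)
    have z: "Z i \<omega> \<in> region f" if "i \<in> {1..n}" for i using elim that by simp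
    have "V.wsum \<rho>' n n \<omega> = t * (\<tau> * (\<Sum>r = 1..k n. (a n r + b) * (real (k n) / (c * real n)) *
         (1 - real n * (c * excess f (k n) r (peak (\<lambda>i. Z i \<omega>) n (k n) r)))))"
      unfolding V.wsum_def \<rho>'_def \<rho> void_def sum_distrib_left by (simp add: mult_ac)
    then have "\<bar>t * (\<tau> * X \<omega>) - V.wsum \<rho>' n n \<omega>\<bar> = \<bar>t\<bar> * (\<tau> * \<bar>X \<omega> - (\<Sum>r = 1..k n. (a n r + b) * (real (k n) / (c * real n)) *
         (1 - real n * (c * excess f (k n) r (peak (\<lambda>i. Z i \<omega>) n (k n) r))))\<bar>)"
      using \<tau> by (simp add: right_diff_distrib[symmetric] abs_mult)
    also have "\<dots> \<le> \<bar>t\<bar> * (\<tau> * \<delta>)"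
      unfolding X_def \<delta>_def a_def
      by (intro mult_left_mono kernel_estimator_approx f_cont f0' inverse_c_eq_integral c_pos L \<alpha> x K kn hn z
          \<tau> abs_ge_zero A1[unfolded a_def] b)
    finally show ?case .
  qed
  from norm_expectation_iexp_diff_le[OF _ V.wsum_measurable _ this]
  have 1: "cmod (expectation (\<lambda>\<omega>. iexp (t * (\<tau> * X \<omega>))) - expectation (\<lambda>\<omega>. iexp (V.wsum \<rho>' n n \<omega>))) \<le> \<bar>t\<bar> * (\<tau> * \<delta>)"
    by (simp add: prob_space)
  have "cmod (expectation (\<lambda>\<omega>. iexp (V.wsum \<rho>' n n \<omega>)) - exp (- (\<Sum>r = 1..k n. (\<rho>' r)\<^sup>2) / 2))
      \<le> (\<Sum>r = 1..k n. \<bar>\<rho>' r\<bar>) * (2 / sqrt (real n))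
      + (\<Sum>r = 1..k n. 2 * exp (- real n * (c * excess f (k n) r 0)) + 4 * \<bar>\<rho>' r\<bar> ^ 3)"
    by (rule V.char_weighted_sum[OF n])
  also have "(\<Sum>r = 1..k n. (\<rho>' r)\<^sup>2) = t\<^sup>2 * (\<Sum>r = 1..k n. (\<rho> r)\<^sup>2)"
    by (simp add: \<rho>'_def power_mult_distrib sum_distrib_left)
  also have "(\<Sum>r = 1..k n. \<bar>\<rho>' r\<bar>) = \<bar>t\<bar> * (\<Sum>r = 1..k n. \<bar>\<rho> r\<bar>)"
    by (simp add: \<rho>'_def abs_mult sum_distrib_left)
  also have "(\<Sum>r = 1..k n. 2 * exp (- real n * (c * excess f (k n) r 0)) + 4 * \<bar>\<rho>' r\<bar> ^ 3)
      \<le> (\<Sum>r = 1..k n. 2 * exp (- real n * (c * m / real (k n))) + 4 * \<bar>t\<bar> ^ 3 * \<bar>\<rho> r\<bar> ^ 3)"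
  proof (rule sum_mono)
    fix r assume r: "r \<in> {1..k n}"
    have "c * (m / real (k n)) \<le> c * excess f (k n) r 0"
      using excess_zero_ge[OF f_cont r f0(1)] c_pos by (intro mult_left_mono) auto
    then have "real n * (c * m / real (k n)) \<le> real n * (c * excess f (k n) r 0)"
      by (intro mult_left_mono) auto
    then have "exp (- real n * (c * excess f (k n) r 0)) \<le> exp (- real n * (c * m / real (k n)))"
      unfolding exp_le_cancel_iff mult_minus_left by (rule le_imp_neg_le)
    then show "2 * exp (- real n * (c * excess f (k n) r 0)) + 4 * \<bar>\<rho>' r\<bar> ^ 3
        \<le> 2 * exp (- real n * (c * m / real (k n))) + 4 * \<bar>t\<bar> ^ 3 * \<bar>\<rho> r\<bar> ^ 3"
      by (simp add: \<rho>'_def abs_mult power_mult_distrib)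
  qed
  also have "\<dots> = 2 * (real (k n) * exp (- real n * (c * m / real (k n)))) + 4 * \<bar>t\<bar> ^ 3 * (\<Sum>r = 1..k n. \<bar>\<rho> r\<bar> ^ 3)"
    by (simp add: sum.distrib sum_distrib_left)
  finally have 2: "cmod (expectation (\<lambda>\<omega>. iexp (V.wsum \<rho>' n n \<omega>)) - exp (- (t\<^sup>2 * (\<Sum>r = 1..k n. (\<rho> r)\<^sup>2)) / 2))
      \<le> \<bar>t\<bar> * (\<Sum>r = 1..k n. \<bar>\<rho> r\<bar>) * (2 / sqrt (real n))
        + (2 * (real (k n) * exp (- real n * (c * m / real (k n)))) + 4 * \<bar>t\<bar> ^ 3 * (\<Sum>r = 1..k n. \<bar>\<rho> r\<bar> ^ 3))"
    by simp
  show ?thesis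
    using norm_diff_triangle_le[OF 1 2] unfolding \<delta>_def X_def by (simp only: add.assoc)
qed

text \<open>Only about h k cells carry kernel weight, whereas the correction is spread over all k
  cells; its effect therefore carries the vanishing factors \<open>h n\<close> and
  \<open>k n / (n - k n)\<close>.\<close>

lemma weights_limits:
  fixes a \<rho> :: "nat \<Rightarrow> nat \<Rightarrow> real" and h :: "nat \<Rightarrow> real" and k :: "nat \<Rightarrow> nat"
  assumes ev: "\<forall>\<^sub>F n in sequentially. 0 < k n \<and> k n < n \<and> 0 < h n"
    and a: "\<And>n r. 0 < h n \<Longrightarrow> 0 \<le> a n r \<and> a n r \<le> B / (h n * real (k n))"
    and A1: "(\<lambda>n. \<Sum>r = 1..k n. a n r) \<longlonglongrightarrow> 1"
    and I: "(\<lambda>n. h n * real (k n) * (\<Sum>r = 1..k n. (a n r)\<^sup>2)) \<longlonglongrightarrow> I"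
    and h: "h \<longlonglongrightarrow> 0" and hk: "filterlim (\<lambda>n. h n * real (k n)) at_top sequentially"
    and kn: "(\<lambda>n. real (k n) / real n) \<longlonglongrightarrow> 0" and c: "0 < c"
    and \<rho>: "\<And>n r. \<rho> n r = sqrt (h n * real (k n)) / c * (a n r + (\<Sum>r = 1..k n. a n r) / (real n - real (k n)))"
  shows "(\<lambda>n. real (k n) / (real n - real (k n))) \<longlonglongrightarrow> 0"
    and "(\<lambda>n. \<Sum>r = 1..k n. (\<rho> n r)\<^sup>2) \<longlonglongrightarrow> I / c\<^sup>2"
    and "(\<lambda>n. (\<Sum>r = 1..k n. \<bar>\<rho> n r\<bar>) * (2 / sqrt (real n))) \<longlonglongrightarrow> 0"
    and "(\<lambda>n. \<Sum>r = 1..k n. \<bar>\<rho> n r\<bar> ^ 3) \<longlonglongrightarrow> 0"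
proof -
  define S where "S n = (\<Sum>r = 1..k n. a n r)" for n
  define Q where "Q n = (\<Sum>r = 1..k n. (a n r)\<^sup>2)" for n
  define s where "s n = h n * real (k n)" for n
  define u where "u n = real (k n) / (real n - real (k n))" for n
  have S: "S \<longlonglongrightarrow> 1" using A1 by (simp add: S_def[abs_def])
  have Q: "(\<lambda>n. s n * Q n) \<longlonglongrightarrow> I" using I by (simp add: s_def Q_def)
  have "(\<lambda>n. (real (k n) / real n) / (1 - real (k n) / real n)) \<longlonglongrightarrow> 0 / (1 - 0)"
    by (intro tendsto_intros kn) auto
  moreover have "\<forall>\<^sub>F n in sequentially. (real (k n) / real n) / (1 - real (k n) / real n) = u n"
    using ev by eventually_elim (auto simp: u_def field_simps)
  ultimately have u: "u \<longlonglongrightarrow> 0" using Lim_transform_eventually by fastforce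
  then show "(\<lambda>n. real (k n) / (real n - real (k n))) \<longlonglongrightarrow> 0" by (simp add: u_def[abs_def])
  have \<rho>_def: "\<rho> n r = sqrt (s n) / c * (a n r + S n / (real n - real (k n)))" for n r
    by (simp add: \<rho> s_def S_def)
  have sum: "(\<Sum>r = 1..k n. (a n r + b)\<^sup>2) = Q n + 2 * b * S n + real (k n) * b\<^sup>2" for n b
    by (simp add: power2_sum sum.distrib Q_def S_def sum_distrib_left algebra_simps)
  \<comment> \<open>Expansion of the square: with \<open>k b = u S\<close>, the cross term becomes
    \<open>h u S^2\<close> and the square of the correction \<open>h u^2 S^2\<close>.\<close>
  have "(\<lambda>n. (s n * Q n + 2 * (h n * u n * (S n)\<^sup>2) + h n * (u n)\<^sup>2 * (S n)\<^sup>2) / c\<^sup>2)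
      \<longlonglongrightarrow> (I + 2 * (0 * 0 * 1\<^sup>2) + 0 * 0\<^sup>2 * 1\<^sup>2) / c\<^sup>2"
    using c by (intro tendsto_intros Q u S h) auto
  moreover have "\<forall>\<^sub>F n in sequentially. (s n * Q n + 2 * (h n * u n * (S n)\<^sup>2) + h n * (u n)\<^sup>2 * (S n)\<^sup>2) / c\<^sup>2
      = (\<Sum>r = 1..k n. (\<rho> n r)\<^sup>2)"
    using ev
  proof eventually_elim
    case (elim n)
    have d: "0 < real n - real (k n)" using elim by simp
    have s0: "0 \<le> s n" using elim by (simp add: s_def)
    define v where "v = S n / (real n - real (k n))"
    have "(\<Sum>r = 1..k n. (\<rho> n r)\<^sup>2) = s n / c\<^sup>2 * (\<Sum>r = 1..k n. (a n r + v)\<^sup>2)"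
      unfolding \<rho>_def v_def sum_distrib_left using s0 by (simp add: power_mult_distrib power_divide)
    also have "\<dots> = (s n * Q n + 2 * (s n * v * S n) + s n * real (k n) * v\<^sup>2) / c\<^sup>2"
      unfolding sum by (simp add: algebra_simps add_divide_distrib)
    also have "s n * v * S n = h n * u n * (S n)\<^sup>2"
      by (simp add: v_def s_def u_def power2_eq_square)
    also have "s n * real (k n) * v\<^sup>2 = h n * (u n)\<^sup>2 * (S n)\<^sup>2"
      by (simp add: v_def s_def u_def power2_eq_square)
    finally show ?case by simp
  qed
  ultimately show R2: "(\<lambda>n. \<Sum>r = 1..k n. (\<rho> n r)\<^sup>2) \<longlonglongrightarrow> I / c\<^sup>2"
    using Lim_transform_eventually by fastforce
  \<comment> \<open>Nonnegative weights add up to \<open>sqrt (h k) / c\<close> times S(1 + u), so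
    the Poissonization error has the order of \<open>sqrt (h k / n)\<close>.\<close>
  have "(\<lambda>n. 2 / c * (S n * (1 + u n)) * sqrt (h n * (real (k n) / real n))) \<longlonglongrightarrow> 2 / c * (1 * (1 + 0)) * sqrt (0 * 0)"
    by (intro tendsto_intros S u h kn)
  moreover have "\<forall>\<^sub>F n in sequentially. 2 / c * (S n * (1 + u n)) * sqrt (h n * (real (k n) / real n))
      = (\<Sum>r = 1..k n. \<bar>\<rho> n r\<bar>) * (2 / sqrt (real n))"
    using ev
  proof eventually_elim
    case (elim n)
    have d: "0 < real n - real (k n)" using elim by simp
    have S0: "0 \<le> S n" unfolding S_def using a elim by (intro sum_nonneg) auto
    have "\<bar>\<rho> n r\<bar> = \<rho> n r" for r
      unfolding \<rho>_def using elim a[of n r] c d S0 by (intro abs_of_nonneg) (auto simp: s_def)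
    then have "(\<Sum>r = 1..k n. \<bar>\<rho> n r\<bar>) = sqrt (s n) / c * (S n + real (k n) * (S n / (real n - real (k n))))"
      by (simp only: \<rho>_def sum_distrib_left[symmetric] sum.distrib S_def[symmetric]) simp
    also have "S n + real (k n) * (S n / (real n - real (k n))) = S n * (1 + u n)"
      by (simp add: u_def distrib_left)
    finally have e: "(\<Sum>r = 1..k n. \<bar>\<rho> n r\<bar>) = sqrt (s n) / c * (S n * (1 + u n))" .
    have "sqrt (h n * (real (k n) / real n)) = sqrt (s n) / sqrt (real n)"
      by (simp add: s_def real_sqrt_divide[symmetric])
    then show ?case unfolding e by simp
  qed
  ultimately show "(\<lambda>n. (\<Sum>r = 1..k n. \<bar>\<rho> n r\<bar>) * (2 / sqrt (real n))) \<longlonglongrightarrow> 0"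
    using Lim_transform_eventually by fastforce
  have sqs: "filterlim (\<lambda>n. sqrt (s n)) at_infinity sequentially"
    using filterlim_compose[OF sqrt_at_top hk] unfolding s_def by (rule filterlim_at_top_imp_at_infinity)
  \<comment> \<open>Lyapunov condition: the cubes are bounded by the largest weight times the sum of
    squares. The largest weight vanishes because a kernel weight is at most B/(h k) before the
    scaling by \<open>sqrt (h k) / c\<close>.\<close>
  have "(\<lambda>n. (B / sqrt (s n) + sqrt (h n) * u n * S n) / c * (\<Sum>r = 1..k n. (\<rho> n r)\<^sup>2))
      \<longlonglongrightarrow> (0 + sqrt 0 * 0 * 1) / c * (I / c\<^sup>2)"
    using c by (intro tendsto_intros tendsto_divide_0[OF tendsto_const sqs] R2 u S h) auto
  then have lim: "(\<lambda>n. (B / sqrt (s n) + sqrt (h n) * u n * S n) / c * (\<Sum>r = 1..k n. (\<rho> n r)\<^sup>2)) \<longlonglongrightarrow> 0" by simp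
  have "\<forall>\<^sub>F n in sequentially. norm (\<Sum>r = 1..k n. \<bar>\<rho> n r\<bar> ^ 3)
      \<le> (B / sqrt (s n) + sqrt (h n) * u n * S n) / c * (\<Sum>r = 1..k n. (\<rho> n r)\<^sup>2)"
    using ev
  proof eventually_elim
    case (elim n)
    have d: "0 < real n - real (k n)" using elim by simp
    have s0: "0 < s n" using elim by (simp add: s_def)
    have S0: "0 \<le> S n" unfolding S_def using a elim by (intro sum_nonneg) auto
    have k1: "sqrt (real (k n)) \<le> real (k n)"
      using elim real_sqrt_le_mono[of "real (k n)" "(real (k n))\<^sup>2"] by (simp add: power2_eq_square)
    have bound: "\<bar>\<rho> n r\<bar> \<le> (B / sqrt (s n) + sqrt (h n) * u n * S n) / c" for r
    proof -
      have "\<bar>\<rho> n r\<bar> = (sqrt (s n) * a n r + sqrt (s n) * (S n / (real n - real (k n)))) / c"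
        unfolding \<rho>_def using elim a[of n r] c d S0 s0 by (subst abs_of_nonneg) (auto simp: distrib_left add_divide_distrib mult.commute)
      also have "\<dots> \<le> (B / sqrt (s n) + sqrt (h n) * u n * S n) / c"
      proof (intro divide_right_mono add_mono)
        have "sqrt (s n) * a n r \<le> sqrt (s n) * (B / s n)"
          using a[of n r] elim s0 by (intro mult_left_mono) (auto simp: s_def)
        also have "\<dots> = B / sqrt (s n)"
          using s0 by (metis real_div_sqrt less_imp_le times_divide_eq_right mult.commute divide_divide_eq_right real_sqrt_gt_0_iff divide_self_if mult_cancel_left2 real_sqrt_mult_self abs_of_pos nonzero_divide_mult_cancel_right less_irrefl)
        finally show "sqrt (s n) * a n r \<le> B / sqrt (s n)" .
        have "sqrt (s n) * (S n / (real n - real (k n))) = sqrt (h n) * (sqrt (real (k n)) / (real n - real (k n))) * S n"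
          by (simp add: s_def real_sqrt_mult)
        also have "\<dots> \<le> sqrt (h n) * u n * S n"
          unfolding u_def using elim d S0 k1
          by (intro mult_right_mono mult_left_mono divide_right_mono) auto
        finally show "sqrt (s n) * (S n / (real n - real (k n))) \<le> sqrt (h n) * u n * S n" .
      qed (use c in auto)
      finally show ?thesis .
    qed
    have "\<bar>\<rho> n r\<bar> ^ 3 \<le> (B / sqrt (s n) + sqrt (h n) * u n * S n) / c * (\<rho> n r)\<^sup>2" for r
      using mult_right_mono[OF bound[of r], of "\<bar>\<rho> n r\<bar>\<^sup>2"] by (simp add: power3_eq_cube power2_eq_square mult.assoc)
    then have "(\<Sum>r = 1..k n. \<bar>\<rho> n r\<bar> ^ 3) \<le> (\<Sum>r = 1..k n. (B / sqrt (s n) + sqrt (h n) * u n * S n) / c * (\<rho> n r)\<^sup>2)"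
      by (intro sum_mono) auto
    moreover have "norm (\<Sum>r = 1..k n. \<bar>\<rho> n r\<bar> ^ 3) = (\<Sum>r = 1..k n. \<bar>\<rho> n r\<bar> ^ 3)"
      by (simp add: sum_nonneg)
    ultimately show ?case by (simp only: sum_distrib_left)
  qed
  from Lim_null_comparison[OF this lim] show "(\<lambda>n. \<Sum>r = 1..k n. \<bar>\<rho> n r\<bar> ^ 3) \<longlonglongrightarrow> 0" .
qed

theorem theorem1:
  fixes M :: "'a measure"
    and Z :: "nat \<Rightarrow> 'a \<Rightarrow> real \<times> real"
    and f K :: "real \<Rightarrow> real"
    and k :: "nat \<Rightarrow> nat"
    and h :: "nat \<Rightarrow> real"
    and \<alpha> A c \<sigma> x :: real
  assumes "0 < \<alpha>" and "\<alpha> \<le> 1"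
    and "\<forall>t\<in>{0..1}. 0 < f t"
    and "holder_01 \<alpha> f"
    and "prob_space M"
    and "prob_space.indep_vars M (\<lambda>_. borel) Z {1..}"
    and "\<forall>i\<ge>1. distr M borel (Z i) = uniform_measure lborel (region f)"
    and "mono_on {2..} k" and "\<forall>n\<ge>2. 0 < k n \<and> k n < n"
    and "filterlim k at_top sequentially"
    and "antimono_on {2..} h" and "\<forall>n\<ge>2. 0 < h n"
    and "h \<longlonglongrightarrow> 0"
    and "\<forall>t. 0 \<le> K t" and "has_bochner_integral lborel K 1"
    and "bounded (range K)"
    and "closure {t. K t \<noteq> 0} \<subseteq> {-A..A}"
    and "\<forall>t. K differentiable (at t)" and "bounded (range (deriv K))"
    and "piecewise_C2 K"
    and "filterlim (\<lambda>n. h n * real (k n)) at_top sequentially"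
    and "(\<lambda>n. real n) \<in> o(\<lambda>n. real (k n) powr (1/2) * h n powr (- (1/2) - \<alpha>))"
    and "(\<lambda>n. real n) \<in> o(\<lambda>n. real (k n) powr (5/2) * h n powr (3/2))"
    and "(\<lambda>n. real (k n)) \<in> o(\<lambda>n. real n / ln (real n))"
    and "1 / c = measure lborel (region f)"
    and "\<sigma> = L2_norm K / c"
    and "0 < x" and "x < 1"
  shows "weak_conv_m
    (\<lambda>n. distr M borel (\<lambda>\<omega>. real n * h n powr (1/2) / real (k n) powr (1/2) *
                              (kernel_estimator K k h n (\<lambda>i. Z i \<omega>) x - f x)))
    (density lborel (normal_density 0 \<sigma>))"
proof -
  interpret prob_space M by fact
  note ass = assms
  have \<alpha>: "0 < \<alpha>" and x: "0 < x" "x < 1" and K0: "\<And>t. 0 \<le> K t" and diff: "\<And>t. K differentiable (at t)"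
    and Kint: "has_bochner_integral lborel K 1" and KC2: "piecewise_C2 K"
    using ass by auto
  have f_cont: "continuous_on {0..1} f" by (rule holder_01_imp_continuous_on[OF ass(4,1)])
  interpret uniform_sample M Z f c
    using f_cont ass(6,7,25) by unfold_locales auto
  obtain L where L: "0 \<le> L" "\<And>s t. s \<in> {0..1} \<Longrightarrow> t \<in> {0..1} \<Longrightarrow> \<bar>f s - f t\<bar> \<le> L * \<bar>s - t\<bar> powr \<alpha>"
    using ass(4) unfolding holder_01_def by (meson less_imp_le)
  obtain t0 where t0: "t0 \<in> {0..1}" "\<And>t. t \<in> {0..1} \<Longrightarrow> f t0 \<le> f t"
    using continuous_attains_inf[OF compact_Icc _ f_cont] by auto
  define m where "m = f t0"
  have m: "0 < m" "\<And>t. t \<in> {0..1} \<Longrightarrow> m \<le> f t" using t0 ass(3) by (auto simp: m_def)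
  obtain B where B: "\<And>t. \<bar>K t\<bar> \<le> B" using ass(16) unfolding bounded_iff by auto
  obtain B' where B': "\<And>t. \<bar>deriv K t\<bar> \<le> B'" using ass(19) unfolding bounded_iff by auto
  have supp: "K t = 0" if "t \<notin> {-A..A}" for t by (rule kernel_support[OF ass(17) that])
  have A0: "0 \<le> A" by (rule kernel_support_radius_nonneg[OF supp Kint])
  have hk: "filterlim (\<lambda>n. h n * real (k n)) at_top sequentially" and h0: "h \<longlonglongrightarrow> 0" using ass by auto
  have ev: "\<forall>\<^sub>F n in sequentially. 0 < k n \<and> k n < n \<and> 0 < h n"
    using eventually_ge_at_top[of 2] by eventually_elim (use ass(9,12) in auto)
  define s where "s n = h n * real (k n)" for n
  define \<tau> where "\<tau> n = real n * h n powr (1/2) / real (k n) powr (1/2)" for n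
  define a where "a n r = scaled_kernel K (h n) (x - cell_center (k n) r) / real (k n)" for n r
  define S where "S n = (\<Sum>r = 1..k n. a n r)" for n
  define b where "b n = S n / (real n - real (k n))" for n
  define \<rho> where "\<rho> n r = sqrt (h n * real (k n)) / c * (a n r + S n / (real n - real (k n)))" for n r
  define u where "u n = real (k n) / (real n - real (k n))" for n

  have kln: "(\<lambda>n. real (k n) / (real n / ln (real n))) \<longlonglongrightarrow> 0"
    using ass(24) by (rule smalloD_tendsto)
  have kn: "(\<lambda>n. real (k n) / real n) \<longlonglongrightarrow> 0"
  proof (rule Lim_null_comparison[OF _ kln])
    show "\<forall>\<^sub>F n in sequentially. norm (real (k n) / real n) \<le> real (k n) / (real n / ln (real n))"
      \<comment> \<open>From 3 on the logarithm is at least 1, so the logarithmic condition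
        dominates k/n.\<close>
      using eventually_ge_at_top[of 3]
    proof eventually_elim
      case (elim n)
      have "exp 1 \<le> real n" using order_trans[OF exp_le, of "real n"] elim by simp
      then have "1 \<le> ln (real n)" using elim by (subst ln_ge_iff) auto
      then have "real (k n) / real n * 1 \<le> real (k n) / real n * ln (real n)"
        by (intro mult_left_mono) auto
      then show ?case by simp
    qed
  qed
  obtain C where C: "\<forall>\<^sub>F n in sequentially. \<bar>S n - 1\<bar> \<le> C / (s n)\<^sup>2"
    and Q: "(\<lambda>n. h n * real (k n) * (\<Sum>r = 1..k n. (a n r)\<^sup>2)) \<longlonglongrightarrow> (\<integral>t. (K t)\<^sup>2 \<partial>lborel)"
    unfolding S_def s_def a_def
    using kernel_weights[OF supp Kint B B' diff KC2 _ h0 _ hk x] ev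
    by (smt (verit, best) eventually_mono)
  have S1: "S \<longlonglongrightarrow> 1"
  proof (rule LIM_zero_cancel, rule Lim_null_comparison)
    show "\<forall>\<^sub>F n in sequentially. norm (S n - 1) \<le> C / (s n)\<^sup>2" using C by simp
    have "filterlim (\<lambda>n. (s n)\<^sup>2) at_top sequentially"
      unfolding s_def by (rule filterlim_pow_at_top[OF _ hk]) simp
    then show "(\<lambda>n. C / (s n)\<^sup>2) \<longlonglongrightarrow> 0"
      by (intro tendsto_divide_0[OF tendsto_const] filterlim_at_top_imp_at_infinity)
  qed
  have a: "0 \<le> a n r \<and> a n r \<le> B / (h n * real (k n))" if "0 < h n" for n r
  proof -
    have "K ((x - cell_center (k n) r) / h n) / (h n * real (k n)) \<le> B / (h n * real (k n))"
      using B[of "(x - cell_center (k n) r) / h n"] that by (intro divide_right_mono) auto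
    then show ?thesis using K0 that by (simp add: a_def scaled_kernel_def)
  qed
  have S1': "(\<lambda>n. \<Sum>r = 1..k n. a n r) \<longlonglongrightarrow> 1" using S1 by (simp add: S_def[abs_def])
  note W = weights_limits[OF ev a S1' Q h0 hk kn c_pos \<rho>_def[unfolded S_def]]
  have u0: "u \<longlonglongrightarrow> 0" using W(1) by (simp add: u_def[abs_def])
  \<comment> \<open>The first growth condition, rewritten: the normalization kills the oscillation
    of \<open>f\<close> at scale \<open>h\<close>.\<close>
  have T1: "(\<lambda>n. \<tau> n * h n powr \<alpha>) \<longlonglongrightarrow> 0"
  proof (rule Lim_transform_eventually[OF smalloD_tendsto[OF ass(22)]])
    show "\<forall>\<^sub>F n in sequentially. real n / (real (k n) powr (1 / 2) * h n powr (- (1 / 2) - \<alpha>)) = \<tau> n * h n powr \<alpha>"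
      using ev
    proof eventually_elim
      case (elim n)
      have "h n powr (- (1 / 2) - \<alpha>) = inverse (h n powr (1 / 2) * h n powr \<alpha>)"
        by (simp add: powr_minus[symmetric] powr_add[symmetric])
      then show ?case by (simp add: \<tau>_def field_simps)
    qed
  qed
  \<comment> \<open>The second growth condition, rewritten: the normalization kills the second-order
    quadrature error.\<close>
  have T2: "(\<lambda>n. \<tau> n / (s n)\<^sup>2) \<longlonglongrightarrow> 0"
  proof (rule Lim_transform_eventually[OF smalloD_tendsto[OF ass(23)]])
    show "\<forall>\<^sub>F n in sequentially. real n / (real (k n) powr (5 / 2) * h n powr (3 / 2)) = \<tau> n / (s n)\<^sup>2"
      using ev
    proof eventually_elim
      case (elim n)
      have "real (k n) powr (5 / 2) = real (k n) powr (1 / 2) * (real (k n))\<^sup>2"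
        using elim powr_add[of "real (k n)" "1 / 2" 2] by (simp add: powr_numeral)
      moreover have "(h n)\<^sup>2 = h n powr (3 / 2) * h n powr (1 / 2)"
        using elim powr_add[of "h n" "3 / 2" "1 / 2"] by (simp add: powr_numeral)
      moreover have "0 < h n powr (1 / 2)" "0 < h n powr (3 / 2)" using elim by auto
      ultimately show ?case using elim by (simp add: \<tau>_def s_def power_mult_distrib)
    qed
  qed
  define \<delta> where "\<delta> n = S n * (L * (A * h n) powr \<alpha>) + f x * \<bar>S n - 1\<bar>
    + S n * (L * (1 / real (k n)) powr \<alpha>) * ((real n + real (k n)) / (real n - real (k n)))" for n
  have \<delta>0: "(\<lambda>n. \<tau> n * \<delta> n) \<longlonglongrightarrow> 0"
  proof (rule Lim_null_comparison)
    have "(\<lambda>n. S n * L * A powr \<alpha> * (\<tau> n * h n powr \<alpha>) + f x * (C * (\<tau> n / (s n)\<^sup>2))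
        + S n * L * (\<tau> n * h n powr \<alpha>) * (1 + 2 * u n))
      \<longlonglongrightarrow> 1 * L * A powr \<alpha> * 0 + f x * (C * 0) + 1 * L * 0 * (1 + 2 * 0)"
      by (intro tendsto_intros S1 T1 T2 u0)
    then show "(\<lambda>n. S n * L * A powr \<alpha> * (\<tau> n * h n powr \<alpha>) + f x * (C * (\<tau> n / (s n)\<^sup>2))
        + S n * L * (\<tau> n * h n powr \<alpha>) * (1 + 2 * u n)) \<longlonglongrightarrow> 0" by simp
    show "\<forall>\<^sub>F n in sequentially. norm (\<tau> n * \<delta> n) \<le> S n * L * A powr \<alpha> * (\<tau> n * h n powr \<alpha>)
        + f x * (C * (\<tau> n / (s n)\<^sup>2)) + S n * L * (\<tau> n * h n powr \<alpha>) * (1 + 2 * u n)"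
      using ev C hk[unfolded filterlim_at_top, rule_format, of 1]
    proof eventually_elim
      case (elim n)
      have S0: "0 \<le> S n" unfolding S_def using a elim by (intro sum_nonneg) auto
      have \<tau>0: "0 \<le> \<tau> n" by (simp add: \<tau>_def)
      have fx: "0 \<le> f x" using m(1) m(2)[of x] x by auto
      have d: "0 < real n - real (k n)" using elim by simp
      have q: "(real n + real (k n)) / (real n - real (k n)) = 1 + 2 * u n" "0 \<le> 1 + 2 * u n"
        using d by (auto simp: u_def field_simps)
      have 1: "\<tau> n * (S n * (L * (A * h n) powr \<alpha>)) = S n * L * A powr \<alpha> * (\<tau> n * h n powr \<alpha>)"
        using A0 elim by (simp add: powr_mult)
      have 2: "\<tau> n * (f x * \<bar>S n - 1\<bar>) \<le> f x * (C * (\<tau> n / (s n)\<^sup>2))"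
      proof -
        have "f x * (\<tau> n * \<bar>S n - 1\<bar>) \<le> f x * (\<tau> n * (C / (s n)\<^sup>2))"
          using elim \<tau>0 fx by (intro mult_left_mono) auto
        then show ?thesis by (simp add: mult_ac)
      qed
      have 3: "\<tau> n * (S n * (L * (1 / real (k n)) powr \<alpha>) * (1 + 2 * u n)) \<le> S n * L * (\<tau> n * h n powr \<alpha>) * (1 + 2 * u n)"
      proof -
        \<comment> \<open>Cells are eventually shorter than the bandwidth, so their oscillation is
          covered by the same condition as that of the window.\<close>
        have "1 / real (k n) \<le> h n" using elim by (simp add: divide_le_eq)
        then have "(1 / real (k n)) powr \<alpha> \<le> h n powr \<alpha>" using \<alpha> by (intro powr_mono2) auto
        then have "(S n * L * \<tau> n * (1 + 2 * u n)) * (1 / real (k n)) powr \<alpha> \<le> (S n * L * \<tau> n * (1 + 2 * u n)) * h n powr \<alpha>"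
          using S0 L(1) \<tau>0 q(2) by (intro mult_left_mono mult_nonneg_nonneg) auto
        then show ?thesis by (simp add: mult_ac)
      qed
      have "0 \<le> u n" using d by (simp add: u_def)
      then have "0 \<le> \<delta> n" unfolding \<delta>_def q using S0 L(1) fx by (intro add_nonneg_nonneg mult_nonneg_nonneg) auto
      then have "norm (\<tau> n * \<delta> n) = \<tau> n * \<delta> n" using \<tau>0 by simp
      also have "\<dots> = \<tau> n * (S n * (L * (A * h n) powr \<alpha>)) + \<tau> n * (f x * \<bar>S n - 1\<bar>)
          + \<tau> n * (S n * (L * (1 / real (k n)) powr \<alpha>) * (1 + 2 * u n))"
        unfolding \<delta>_def q by (simp only: distrib_left)
      finally show ?case using 1 2 3 by linarith
    qed
  qed
  have T3: "(\<lambda>n. real (k n) * exp (- real n * (c * m / real (k n)))) \<longlonglongrightarrow> 0"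
  proof (rule Lim_null_comparison[OF _ lim_1_over_n])
    \<comment> \<open>The level \<open>c * m / 2\<close> makes the exponent at least 2 ln n; each
      cell then costs at most n^(-2), and there are fewer than n cells.\<close>
    have "\<forall>\<^sub>F n in sequentially. real (k n) / (real n / ln (real n)) < c * m / 2"
      by (rule order_tendstoD(2)[OF kln]) (use c_pos m(1) in simp)
    then show "\<forall>\<^sub>F n in sequentially. norm (real (k n) * exp (- real n * (c * m / real (k n)))) \<le> 1 / real n"
      using ev
    proof eventually_elim
      case (elim n)
      have n: "0 < real n" "0 < real (k n)" "real (k n) \<le> real n" using elim by auto
      have "2 * ln (real n) \<le> real n * (c * m / real (k n))" using elim n by (simp add: field_simps)
      then have "exp (- real n * (c * m / real (k n))) \<le> exp (- (2 * ln (real n)))" by simp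
      also have "\<dots> = 1 / (real n)\<^sup>2"
        using n by (simp add: exp_minus exp_double exp_ln inverse_eq_divide)
      finally have "real (k n) * exp (- real n * (c * m / real (k n))) \<le> real n * (1 / (real n)\<^sup>2)"
        using n by (intro mult_mono) auto
      also have "\<dots> = 1 / real n" using n by (simp add: power2_eq_square)
      finally show ?case by simp
    qed
  qed
  have \<sigma>: "0 < \<sigma>" "\<sigma>\<^sup>2 = (\<integral>t. (K t)\<^sup>2 \<partial>lborel) / c\<^sup>2"
  proof -
    have KB: "K t \<le> B" for t using B[of t] by simp
    show "0 < \<sigma>" "\<sigma>\<^sup>2 = (\<integral>t. (K t)\<^sup>2 \<partial>lborel) / c\<^sup>2"
      unfolding ass(26) using kernel_L2_norm_pos[OF K0 Kint KB] c_pos by (auto simp: power_divide)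
  qed
  define X where "X n \<omega> = \<tau> n * (kernel_estimator K k h n (\<lambda>i. Z i \<omega>) x - f x)" for n \<omega>
  have Xm [measurable]: "X n \<in> borel_measurable M" for n
    unfolding X_def using kernel_estimator_measurable[OF Z_measurable] by measurable
  have "weak_conv_m (\<lambda>n. distr M borel (X n)) (density lborel (normal_density 0 \<sigma>))"
  proof (rule levy_continuity)
    show "real_distribution (distr M borel (X n))" for n
      by (rule real_distribution_distr) simp
    show "real_distribution (density lborel (normal_density 0 \<sigma>))"
      unfolding real_distribution_def real_distribution_axioms_def
      using prob_space_normal_density[OF \<sigma>(1)] by simp
    fix t :: real
    define \<Phi> where "\<Phi> n = expectation (\<lambda>\<omega>. iexp (t * X n \<omega>))" for n
    \<comment> \<open>The comparison is with the Gaussian whose variance is that of stage n; this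
      variance converges separately.\<close>
    define G where "G n = exp (- (t\<^sup>2 * (\<Sum>r = 1..k n. (\<rho> n r)\<^sup>2)) / 2)" for n
    have "(\<lambda>n. \<Phi> n - complex_of_real (G n)) \<longlonglongrightarrow> 0"
    proof (rule Lim_null_comparison)
      have "(\<lambda>n. \<bar>t\<bar> * (\<tau> n * \<delta> n) + \<bar>t\<bar> * ((\<Sum>r = 1..k n. \<bar>\<rho> n r\<bar>) * (2 / sqrt (real n)))
          + (2 * (real (k n) * exp (- real n * (c * m / real (k n)))) + 4 * \<bar>t\<bar> ^ 3 * (\<Sum>r = 1..k n. \<bar>\<rho> n r\<bar> ^ 3)))
        \<longlonglongrightarrow> \<bar>t\<bar> * 0 + \<bar>t\<bar> * 0 + (2 * 0 + 4 * \<bar>t\<bar> ^ 3 * 0)"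
        by (intro tendsto_intros \<delta>0 W(3,4) T3)
      then show "(\<lambda>n. \<bar>t\<bar> * (\<tau> n * \<delta> n) + \<bar>t\<bar> * ((\<Sum>r = 1..k n. \<bar>\<rho> n r\<bar>) * (2 / sqrt (real n)))
          + (2 * (real (k n) * exp (- real n * (c * m / real (k n)))) + 4 * \<bar>t\<bar> ^ 3 * (\<Sum>r = 1..k n. \<bar>\<rho> n r\<bar> ^ 3)))
        \<longlonglongrightarrow> 0" by simp
      show "\<forall>\<^sub>F n in sequentially. cmod (\<Phi> n - complex_of_real (G n)) \<le>
          \<bar>t\<bar> * (\<tau> n * \<delta> n) + \<bar>t\<bar> * ((\<Sum>r = 1..k n. \<bar>\<rho> n r\<bar>) * (2 / sqrt (real n)))
          + (2 * (real (k n) * exp (- real n * (c * m / real (k n)))) + 4 * \<bar>t\<bar> ^ 3 * (\<Sum>r = 1..k n. \<bar>\<rho> n r\<bar> ^ 3))"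
        using ev
      proof eventually_elim
        case (elim n)
        have n: "0 < k n" "k n < n" "0 < h n" "0 \<le> \<tau> n" using elim by (auto simp: \<tau>_def)
        \<comment> \<open>Reconciles the two forms of the weights: normalization times
          \<open>k/(c n)\<close>, and the explicit \<open>sqrt (h k) / c\<close>.\<close>
        have "\<tau> n * (real (k n) / (c * real n)) = sqrt (h n * real (k n)) / c"
        proof -
          have "\<tau> n * (real (k n) / (c * real n)) = sqrt (h n) * (real (k n) / sqrt (real (k n))) / c"
            using n by (simp add: \<tau>_def powr_half_sqrt)
          then show ?thesis using real_div_sqrt[of "real (k n)"] by (simp add: real_sqrt_mult)
        qed
        then have \<rho>: "\<rho> n r = \<tau> n * (real (k n) / (c * real n)) * (a n r + b n)" for r
          by (simp add: \<rho>_def b_def)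
        show ?case
          unfolding \<Phi>_def X_def G_def \<delta>_def mult.assoc[symmetric, of "\<bar>t\<bar>" "\<Sum>r = 1..k n. \<bar>\<rho> n r\<bar>"]
          by (rule char_estimator_bound[where h = h and k = k and n = n and x = x and K = K
              and \<rho> = "\<rho> n" and A = A and b = "b n" and \<alpha> = \<alpha> and L = L, OF m(2) _ L \<alpha> _ K0 supp n(1-3) _ _ n(4)])
            (use m(1) x \<rho> in \<open>auto simp: S_def b_def a_def\<close>)
      qed
    qed
    moreover have "(\<lambda>n. complex_of_real (G n)) \<longlonglongrightarrow> complex_of_real (exp (- (t\<^sup>2 * ((\<integral>t. (K t)\<^sup>2 \<partial>lborel) / c\<^sup>2)) / 2))"
      unfolding G_def
      by (intro tendsto_of_real tendsto_exp tendsto_divide tendsto_minus tendsto_mult tendsto_const W(2)) auto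
    ultimately have "(\<lambda>n. (\<Phi> n - complex_of_real (G n)) + complex_of_real (G n))
        \<longlonglongrightarrow> 0 + complex_of_real (exp (- (t\<^sup>2 * ((\<integral>t. (K t)\<^sup>2 \<partial>lborel) / c\<^sup>2)) / 2))"
      by (rule tendsto_add)
    moreover have "char (distr M borel (X n)) t = \<Phi> n" for n
      unfolding char_def \<Phi>_def by (subst integral_distr) auto
    moreover have "char (density lborel (normal_density 0 \<sigma>)) t
        = complex_of_real (exp (- (t\<^sup>2 * ((\<integral>t. (K t)\<^sup>2 \<partial>lborel) / c\<^sup>2)) / 2))"
      by (simp only: char_normal_density[OF \<sigma>(1)] \<sigma>(2)[symmetric] power_mult_distrib mult.commute)
    ultimately show "(\<lambda>n. char (distr M borel (X n)) t) \<longlonglongrightarrow> char (density lborel (normal_density 0 \<sigma>)) t"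
      by simp
  qed
  then show ?thesis by (simp add: X_def[abs_def] \<tau>_def)
qed

end
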